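(* Let $(\Omega,\sigma)$ be a dynamical system on a locally compact Hausdorff space $\Omega$. Assume that the set of eventually periodic points of $\sigma$ has empty interior (e.g., $\sigma$ is a homeomorphism). Then every approximately local derivation on the semicrossed product $C_0(\Omega)\times_\sigma\mathbb{Z}^+$ is a derivation. Hence the space $\mathcal{Z}_1(C_0(\Omega)\times_\sigma\mathbb{Z}^+)$ of all derivations of $C_0(\Omega)\times_\sigma\mathbb{Z}^+$ is reflexive.
   Context: A dynamical system $(\Omega,\sigma)$ consists of a $\sigma$-compact locally compact Hausdorff space $\Omega$ and a proper continuous map $\sigma:\Omega\to\Omega$; $\sigma^{(i)}$ denotes the $i$-fold iterate. A point $x$ is periodic if $\sigma^{(i)}(x)=x$ for some $i\ge1$; it is eventually periodic if it is not periodic but some iterate $\sigma^{(i)}(x)$, $i\ge1$, is periodic. The semicrossed product $C_0(\Omega)\times_\sigma\mathbb{Z}^+$ is the universal non-selfadjoint operator algebra generated by a copy of $C_0(\Omega)$ and an isometry $V$ subject to the covariance relations $fV=V(f\circ\sigma)$, $f\in C_0(\Omega)$. Equivalently, it is the tensor algebra $\mathcal{T}_X^+$ of the $C^*$-correspondence $X=C_0(\Omega)$ over $C_0(\Omega)$ with $(fFg)(x)=f(\sigma(x))F(x)g(x)$ and $\langle F,G\rangle=\overline{F}G$. Here, a Toeplitz representation of a $C^*$-correspondence $X$ over $A$ is a pair $(\pi,t)$ of a $*$-homomorphism $\pi$ of $A$ and a linear map $t$ of $X$ into a $C^*$-algebra with $\pi(a)t(\xi)=t(a\xi)$ and $t(\xi)^*t(\eta)=\pi(\langle\xi,\eta\rangle)$,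 and $\mathcal{T}_X^+$ is the norm-closed algebra generated by the images of $A$ and $X$ under the universal Toeplitz representation. All linear maps are bounded. A derivation of a Banach algebra $\mathcal{A}$ is a bounded linear map $\delta:\mathcal{A}\to\mathcal{A}$ with $\delta(AB)=\delta(A)B+A\delta(B)$. A bounded linear map $\delta:\mathcal{A}\to\mathcal{A}$ is an approximately local derivation if for every $A\in\mathcal{A}$ there is a sequence of derivations $\delta_{A,k}$ of $\mathcal{A}$ with $\delta(A)=\lim_k\delta_{A,k}(A)$. A linear space $\mathcal{S}$ of bounded operators on a Banach space $Y$ is reflexive if every bounded operator $T$ on $Y$ with $Ty\in\overline{\mathcal{S}y}$ for all $y\in Y$ belongs to $\mathcal{S}$. *)

theory Defs
  imports "HOL-Analysis.Analysis"
begin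

section \<open>The Hilbert space of square-summable families\<close>

typedef 'i ell2 = "{x :: 'i \<Rightarrow> complex. (\<lambda>i. (cmod (x i))\<^sup>2) summable_on UNIV}"
  morphisms ell2_nth Abs_ell2
  by (rule exI[of _ "\<lambda>_. 0"]) simp

lemma ell2_summable: "(\<lambda>i. (cmod (ell2_nth x i))\<^sup>2) summable_on UNIV"
  using ell2_nth by blast

lemma ell2_eqI: "(\<And>i. ell2_nth x i = ell2_nth y i) \<Longrightarrow> x = y"
  by (simp add: ell2_nth_inject[symmetric] fun_eq_iff)

lemma ell2_prod_summable:
  "(\<lambda>i. norm (cnj (ell2_nth x i) * ell2_nth y i)) summable_on UNIV"
proof -
  have *: "(\<lambda>i. norm (cnj (ell2_nth x i) * cnj (ell2_nth x i))) summable_on UNIV"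
    "(\<lambda>i. norm (ell2_nth y i * ell2_nth y i)) summable_on UNIV"
    using ell2_summable[of x] ell2_summable[of y]
    by (simp_all add: norm_mult power2_eq_square)
  from abs_summable_product[OF *] show ?thesis .
qed

lemma ell2_prod_summable': "(\<lambda>i. cnj (ell2_nth x i) * ell2_nth y i) summable_on UNIV"
  using ell2_prod_summable by (rule abs_summable_summable)

lemma ell2_nth_Abs:
  assumes "(\<lambda>i. (cmod (f i))\<^sup>2) summable_on UNIV"
  shows "ell2_nth (Abs_ell2 f) = f"
  using assms by (simp add: Abs_ell2_inverse)

lemma square_summable_dominated:
  assumes "g summable_on (UNIV :: 'i set)" "\<And>i. (cmod (f i))\<^sup>2 \<le> (g i :: real)"
  shows "(\<lambda>i. (cmod (f i))\<^sup>2) summable_on UNIV"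
proof -
  have g: "0 \<le> g i" for i by (rule order_trans[OF _ assms(2)]) simp
  have "(\<lambda>i. norm ((cmod (f i))\<^sup>2)) summable_on UNIV"
    by (rule Infinite_Sum.abs_summable_on_comparison_test[where g = g])
      (use assms g in \<open>simp_all add: abs_of_nonneg\<close>)
  then show ?thesis by simp
qed

lemma square_summable_add:
  assumes "(\<lambda>i. (cmod (f i))\<^sup>2) summable_on UNIV" "(\<lambda>i. (cmod (g i))\<^sup>2) summable_on UNIV"
  shows "(\<lambda>i. (cmod (f i + g i))\<^sup>2) summable_on UNIV"
proof (rule square_summable_dominated)
  show "(\<lambda>i. 2 * ((cmod (f i))\<^sup>2 + (cmod (g i))\<^sup>2)) summable_on UNIV"
    by (rule summable_on_cmult_right, rule summable_on_add) (rule assms)+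
  fix i
  have "(cmod (f i + g i))\<^sup>2 \<le> (cmod (f i) + cmod (g i))\<^sup>2"
    by (simp add: norm_triangle_ineq power_mono)
  also have "\<dots> \<le> 2 * ((cmod (f i))\<^sup>2 + (cmod (g i))\<^sup>2)"
    using sum_squares_bound[of "cmod (f i)" "cmod (g i)"] by (simp add: power2_sum)
  finally show "(cmod (f i + g i))\<^sup>2 \<le> 2 * ((cmod (f i))\<^sup>2 + (cmod (g i))\<^sup>2)" .
qed

lemma square_summable_scale:
  assumes "(\<lambda>i. (cmod (f i))\<^sup>2) summable_on UNIV"
  shows "(\<lambda>i. (cmod (c * f i))\<^sup>2) summable_on UNIV"
  unfolding norm_mult power_mult_distrib by (rule summable_on_cmult_right[OF assms])

definition cscale :: "complex \<Rightarrow> 'i ell2 \<Rightarrow> 'i ell2" where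
  "cscale c x = Abs_ell2 (\<lambda>i. c * ell2_nth x i)"

(* Conjugate-linear in the first argument, linear in the second. *)
definition cinner :: "'i ell2 \<Rightarrow> 'i ell2 \<Rightarrow> complex" where
  "cinner x y = (\<Sum>\<^sub>\<infinity>i. cnj (ell2_nth x i) * ell2_nth y i)"

instantiation ell2 :: (type) real_inner
begin

definition "0 = Abs_ell2 (\<lambda>_. 0)"
definition "x + y = Abs_ell2 (\<lambda>i. ell2_nth x i + ell2_nth y i)"
definition "- x = cscale (-1) x" for x :: "'a ell2"
definition "x - y = x + (- y)" for x y :: "'a ell2"
definition "r *\<^sub>R x = cscale (of_real r) x" for x :: "'a ell2"
definition "inner x y = Re (cinner x y)" for x y :: "'a ell2"
definition "norm x = sqrt (inner x x)" for x :: "'a ell2"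
definition "dist x y = norm (x - y)" for x y :: "'a ell2"
definition "sgn x = inverse (norm x) *\<^sub>R x" for x :: "'a ell2"
definition [code del]:
  "(uniformity :: ('a ell2 \<times> 'a ell2) filter) = (INF e\<in>{0<..}. principal {(x, y). dist x y < e})"
definition [code del]:
  "open (U :: 'a ell2 set) \<longleftrightarrow> (\<forall>x\<in>U. eventually (\<lambda>(x', y). x' = x \<longrightarrow> y \<in> U) uniformity)"

lemma nth_zero [simp]: "ell2_nth 0 i = 0"
  by (simp add: zero_ell2_def ell2_nth_Abs)

lemma nth_add [simp]: "ell2_nth (x + y) i = ell2_nth x i + ell2_nth y i"
  by (simp add: plus_ell2_def ell2_nth_Abs square_summable_add ell2_summable)

lemma nth_cscale [simp]: "ell2_nth (cscale c x) i = c * ell2_nth x i"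
  by (simp add: cscale_def ell2_nth_Abs square_summable_scale ell2_summable)

lemma nth_uminus [simp]: "ell2_nth (- x) i = - ell2_nth x i"
  by (simp add: uminus_ell2_def)

lemma nth_diff [simp]: "ell2_nth (x - y) i = ell2_nth x i - ell2_nth y i"
  by (simp add: minus_ell2_def)

lemma nth_scaleR [simp]: "ell2_nth (r *\<^sub>R x) i = of_real r * ell2_nth x i"
  by (simp add: scaleR_ell2_def)

lemma cinner_self: "cinner x x = of_real (\<Sum>\<^sub>\<infinity>i. (cmod (ell2_nth x i))\<^sup>2)"
proof -
  have "(\<Sum>\<^sub>\<infinity>i. of_real ((cmod (ell2_nth x i))\<^sup>2)) =
      complex_of_real (\<Sum>\<^sub>\<infinity>i. (cmod (ell2_nth x i))\<^sup>2)"
    by (intro infsumI has_sum_of_real has_sum_infsum ell2_summable)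
  moreover have "cnj z * z = of_real ((cmod z)\<^sup>2)" for z
    using complex_norm_square[of z] by (simp add: mult.commute)
  ultimately show ?thesis by (simp add: cinner_def)
qed

lemma cinner_add_left: "cinner (x + y) z = cinner x z + cinner y z"
  unfolding cinner_def
  by (simp add: ring_distribs infsum_add ell2_prod_summable')

lemma cinner_commute: "cinner x y = cnj (cinner y x)"
  by (simp add: cinner_def mult.commute flip: infsum_cnj)

lemma cinner_cscale_right: "cinner x (cscale c y) = c * cinner x y"
proof -
  have "cinner x (cscale c y) = (\<Sum>\<^sub>\<infinity>i. c * (cnj (ell2_nth x i) * ell2_nth y i))"
    by (simp add: cinner_def mult.left_commute)
  also have "\<dots> = c * cinner x y"
    by (simp add: cinner_def infsum_cmult_right ell2_prod_summable')
  finally show ?thesis .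
qed

lemma cinner_cscale_left: "cinner (cscale c x) y = cnj c * cinner x y"
  by (metis cinner_commute cinner_cscale_right complex_cnj_mult)

instance
proof
  fix x y z :: "'a ell2" and r s :: real
  show "x + y + z = x + (y + z)" "x + y = y + x" "0 + x = x" "- x + x = 0" "x - y = x + - y"
    "r *\<^sub>R (x + y) = r *\<^sub>R x + r *\<^sub>R y" "(r + s) *\<^sub>R x = r *\<^sub>R x + s *\<^sub>R x"
    "r *\<^sub>R s *\<^sub>R x = (r * s) *\<^sub>R x" "1 *\<^sub>R x = x"
    by (auto intro!: ell2_eqI simp: algebra_simps)
  show "dist x y = norm (x - y)" "sgn x = inverse (norm x) *\<^sub>R x" "norm x = sqrt (inner x x)"
    by (simp_all add: dist_ell2_def sgn_ell2_def norm_ell2_def)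
  show "inner x y = inner y x"
    by (subst (2) inner_ell2_def, subst cinner_commute) (simp add: inner_ell2_def)
  show "inner (x + y) z = inner x z + inner y z"
    by (simp add: inner_ell2_def cinner_add_left)
  show "inner (r *\<^sub>R x) y = r * inner x y"
    by (simp add: inner_ell2_def scaleR_ell2_def cinner_cscale_left)
  show "0 \<le> inner x x"
    by (simp add: inner_ell2_def cinner_self infsum_nonneg)
  show "inner x x = 0 \<longleftrightarrow> x = 0"
  proof
    assume "inner x x = 0"
    then have "(\<Sum>\<^sub>\<infinity>i. (cmod (ell2_nth x i))\<^sup>2) \<le> 0"
      by (simp add: inner_ell2_def cinner_self)
    then have "(cmod (ell2_nth x i))\<^sup>2 = 0" for i
      by (rule nonneg_infsum_le_0D[OF _ ell2_summable]) auto
    then show "x = 0" by (intro ell2_eqI) simp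
  qed (simp add: inner_ell2_def cinner_def)
qed (rule uniformity_ell2_def open_ell2_def)+

end

lemma norm_ell2_square: "(norm x)\<^sup>2 = (\<Sum>\<^sub>\<infinity>i. (cmod (ell2_nth x i))\<^sup>2)"
  by (simp add: power2_norm_eq_inner inner_ell2_def cinner_self)

lemma norm_nth_le: "cmod (ell2_nth x i) \<le> norm x"
proof -
  have "(\<Sum>j\<in>{i}. (cmod (ell2_nth x j))\<^sup>2) \<le> (\<Sum>\<^sub>\<infinity>j. (cmod (ell2_nth x j))\<^sup>2)"
    by (rule finite_sum_le_infsum) (auto simp: ell2_summable)
  then have "(cmod (ell2_nth x i))\<^sup>2 \<le> (norm x)\<^sup>2"
    by (simp add: norm_ell2_square)
  then show ?thesis by (rule power2_le_imp_le) simp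
qed

lemma norm_cscale: "norm (cscale c x) = cmod c * norm x"
proof -
  have "(norm (cscale c x))\<^sup>2 = (cmod c * norm x)\<^sup>2"
    unfolding norm_ell2_square nth_cscale norm_mult power_mult_distrib
    by (rule infsum_cmult_right) (rule ell2_summable)
  then show ?thesis by (simp add: power2_eq_iff_nonneg)
qed

instance ell2 :: (type) banach
proof
  fix X :: "nat \<Rightarrow> 'a ell2"
  assume X: "Cauchy X"
  have "Cauchy (\<lambda>n. ell2_nth (X n) i)" for i
  proof (rule CauchyI)
    fix e :: real assume "0 < e"
    then obtain M where M: "\<And>m n. m \<ge> M \<Longrightarrow> n \<ge> M \<Longrightarrow> norm (X m - X n) < e"
      using CauchyD[OF X] by blast
    have "norm (ell2_nth (X m) i - ell2_nth (X n) i) < e" if "m \<ge> M" "n \<ge> M" for m n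
      using norm_nth_le[of "X m - X n" i] M[OF that] by simp
    then show "\<exists>M. \<forall>m\<ge>M. \<forall>n\<ge>M. norm (ell2_nth (X m) i - ell2_nth (X n) i) < e" by blast
  qed
  then have "\<exists>l. (\<lambda>n. ell2_nth (X n) i) \<longlonglongrightarrow> l" for i
    by (simp add: Cauchy_convergent_iff convergent_def)
  then obtain L where L: "\<And>i. (\<lambda>n. ell2_nth (X n) i) \<longlonglongrightarrow> L i" by metis
  have bound: "(\<lambda>i. (cmod (L i - ell2_nth (X n) i))\<^sup>2) summable_on UNIV \<and>
      (\<Sum>\<^sub>\<infinity>i. (cmod (L i - ell2_nth (X n) i))\<^sup>2) \<le> e\<^sup>2"
    if "0 < e" and M: "\<And>m n. m \<ge> M \<Longrightarrow> n \<ge> M \<Longrightarrow> norm (X m - X n) < e" and "n \<ge> M" for e M n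
  proof -
    have fin: "(\<Sum>i\<in>F. (cmod (L i - ell2_nth (X n) i))\<^sup>2) \<le> e\<^sup>2" if "finite F" for F
    proof (rule tendsto_upperbound)
      show "(\<lambda>m. \<Sum>i\<in>F. (cmod (ell2_nth (X m) i - ell2_nth (X n) i))\<^sup>2)
          \<longlonglongrightarrow> (\<Sum>i\<in>F. (cmod (L i - ell2_nth (X n) i))\<^sup>2)"
        by (intro tendsto_intros L)
      show "\<forall>\<^sub>F m in sequentially.
          (\<Sum>i\<in>F. (cmod (ell2_nth (X m) i - ell2_nth (X n) i))\<^sup>2) \<le> e\<^sup>2"
        using eventually_ge_at_top[of M]
      proof eventually_elim
        case (elim m)
        have "(\<Sum>i\<in>F. (cmod (ell2_nth (X m - X n) i))\<^sup>2) \<le> (norm (X m - X n))\<^sup>2"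
          unfolding norm_ell2_square
          by (rule finite_sum_le_infsum) (use that in \<open>auto simp only: ell2_summable\<close>, auto)
        also have "\<dots> \<le> e\<^sup>2"
          using M[OF elim \<open>n \<ge> M\<close>] by (intro power_mono) auto
        finally show ?case by simp
      qed
    qed simp
    have s: "(\<lambda>i. (cmod (L i - ell2_nth (X n) i))\<^sup>2) summable_on UNIV"
      by (rule nonneg_bdd_above_summable_on) (auto intro!: bdd_aboveI2 fin)
    with fin show ?thesis by (auto intro!: infsum_le_finite_sums)
  qed
  obtain M where M: "\<And>m n. m \<ge> M \<Longrightarrow> n \<ge> M \<Longrightarrow> norm (X m - X n) < 1"
    using CauchyD[OF X, of 1] by auto
  have "(\<lambda>i. (cmod ((L i - ell2_nth (X M) i) + ell2_nth (X M) i))\<^sup>2) summable_on UNIV"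
    by (intro square_summable_add ell2_summable) (use bound[OF _ M] in auto)
  then have nth: "ell2_nth (Abs_ell2 L) = L" by (simp add: ell2_nth_Abs)
  have "X \<longlonglongrightarrow> Abs_ell2 L"
  proof (rule LIMSEQ_I)
    fix r :: real assume "0 < r"
    then obtain N where N: "\<And>m n. m \<ge> N \<Longrightarrow> n \<ge> N \<Longrightarrow> norm (X m - X n) < r / 2"
      using CauchyD[OF X, of "r / 2"] by auto
    have "norm (X n - Abs_ell2 L) < r" if "n \<ge> N" for n
    proof -
      have "(norm (Abs_ell2 L - X n))\<^sup>2 \<le> (r / 2)\<^sup>2"
        using bound[OF _ N \<open>n \<ge> N\<close>] \<open>0 < r\<close> by (simp add: norm_ell2_square nth)
      then have "norm (Abs_ell2 L - X n) \<le> r / 2"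
        by (rule power2_le_imp_le) (use \<open>0 < r\<close> in simp)
      with \<open>0 < r\<close> show ?thesis by (simp add: norm_minus_commute)
    qed
    then show "\<exists>N. \<forall>n\<ge>N. norm (X n - Abs_ell2 L) < r" by blast
  qed
  then show "convergent X" by (auto simp: convergent_def)
qed


section \<open>Operators on the Hilbert space\<close>

(* Real-linear bounded operators; the complex-linear ones are singled out by complex_linear_op. *)
type_synonym 'i op = "'i ell2 \<Rightarrow>\<^sub>L 'i ell2"

definition complex_linear_op :: "'i op \<Rightarrow> bool" where
  "complex_linear_op T \<longleftrightarrow> (\<forall>c h. T (cscale c h) = cscale c (T h))"

definition op_scale :: "complex \<Rightarrow> 'i op \<Rightarrow> 'i op" where
  "op_scale c T = Blinfun (cscale c) o\<^sub>L T"

lemma bounded_linear_cscale: "bounded_linear (cscale c)"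
  by (rule bounded_linear_intro[where K = "cmod c"])
    (auto intro!: ell2_eqI simp: algebra_simps norm_cscale)

lemma op_scale_apply [simp]: "op_scale c T h = cscale c (T h)"
  by (simp add: op_scale_def bounded_linear_Blinfun_apply bounded_linear_cscale)

definition is_adjoint :: "'i op \<Rightarrow> 'i op \<Rightarrow> bool" where
  "is_adjoint S T \<longleftrightarrow> (\<forall>h k. cinner (S h) k = cinner h (T k))"


section \<open>Dynamical systems and the correspondence of a dynamical system\<close>

definition dynamical_system :: "('a::t2_space \<Rightarrow> 'a) \<Rightarrow> bool" where
  "dynamical_system \<sigma> \<longleftrightarrow>
     locally_compact_space (euclidean :: 'a topology) \<and>
     (\<exists>K :: nat \<Rightarrow> 'a set. (\<forall>n. compact (K n)) \<and> (\<Union>n. K n) = UNIV) \<and>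
     continuous_on UNIV \<sigma> \<and>
     (\<forall>K. compact K \<longrightarrow> compact (\<sigma> -` K))"

definition periodic :: "('a \<Rightarrow> 'a) \<Rightarrow> 'a \<Rightarrow> bool" where
  "periodic \<sigma> x \<longleftrightarrow> (\<exists>i\<ge>1. (\<sigma> ^^ i) x = x)"

definition eventually_periodic :: "('a \<Rightarrow> 'a) \<Rightarrow> 'a \<Rightarrow> bool" where
  "eventually_periodic \<sigma> x \<longleftrightarrow> \<not> periodic \<sigma> x \<and> (\<exists>i\<ge>1. periodic \<sigma> ((\<sigma> ^^ i) x))"

definition C0 :: "('a::topological_space \<Rightarrow> complex) set" where
  "C0 = {f. continuous_on UNIV f \<and>
            (\<forall>e>0. \<exists>K. compact K \<and> (\<forall>x. x \<notin> K \<longrightarrow> cmod (f x) < e))}"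

definition star_hom_C0 :: "(('a::topological_space \<Rightarrow> complex) \<Rightarrow> 'i op) \<Rightarrow> bool" where
  "star_hom_C0 \<pi> \<longleftrightarrow>
     (\<forall>f\<in>C0. complex_linear_op (\<pi> f)) \<and>
     (\<forall>f\<in>C0. \<forall>g\<in>C0. \<pi> (\<lambda>x. f x + g x) = \<pi> f + \<pi> g) \<and>
     (\<forall>c. \<forall>f\<in>C0. \<pi> (\<lambda>x. c * f x) = op_scale c (\<pi> f)) \<and>
     (\<forall>f\<in>C0. \<forall>g\<in>C0. \<pi> (\<lambda>x. f x * g x) = \<pi> f o\<^sub>L \<pi> g) \<and>
     (\<forall>f\<in>C0. is_adjoint (\<pi> f) (\<pi> (\<lambda>x. cnj (f x))))"

(* Toeplitz representations on a Hilbert space of the correspondence X = C0 over A = C0 with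
   (a \<xi>)(x) = a (\<sigma> x) \<xi> x  and  <\<xi>, \<eta>> = cnj \<xi> \<eta>.  The last clause is t(\<xi>)* t(\<eta>) = \<pi>(<\<xi>, \<eta>>)
   with the adjoint moved to the other side of the inner product. *)
definition toeplitz_rep ::
  "('a::topological_space \<Rightarrow> 'a) \<Rightarrow> (('a \<Rightarrow> complex) \<Rightarrow> 'i op) \<Rightarrow> (('a \<Rightarrow> complex) \<Rightarrow> 'i op) \<Rightarrow> bool"
where
  "toeplitz_rep \<sigma> \<pi> t \<longleftrightarrow>
     star_hom_C0 \<pi> \<and>
     (\<forall>\<xi>\<in>C0. complex_linear_op (t \<xi>)) \<and>
     (\<forall>\<xi>\<in>C0. \<forall>\<eta>\<in>C0. t (\<lambda>x. \<xi> x + \<eta> x) = t \<xi> + t \<eta>) \<and>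
     (\<forall>c. \<forall>\<xi>\<in>C0. t (\<lambda>x. c * \<xi> x) = op_scale c (t \<xi>)) \<and>
     (\<forall>a\<in>C0. \<forall>\<xi>\<in>C0. \<pi> a o\<^sub>L t \<xi> = t (\<lambda>x. a (\<sigma> x) * \<xi> x)) \<and>
     (\<forall>\<xi>\<in>C0. \<forall>\<eta>\<in>C0. \<forall>h k.
        cinner (t \<xi> h) (t \<eta> k) = cinner h (\<pi> (\<lambda>x. cnj (\<xi> x) * \<eta> x) k))"


section \<open>The semicrossed product\<close>

definition slice :: "'r \<Rightarrow> ('r \<times> 'i) ell2 \<Rightarrow> 'i ell2" where
  "slice r x = Abs_ell2 (\<lambda>i. ell2_nth x (r, i))"

(* The block-diagonal operator; meaningful when the family T is norm bounded. *)
definition direct_sum_op :: "('r \<Rightarrow> 'i op) \<Rightarrow> ('r \<times> 'i) op" where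
  "direct_sum_op T = Blinfun (\<lambda>x. Abs_ell2 (\<lambda>(r, i). ell2_nth (T r (slice r x)) i))"

(* HOL cannot quantify over all Hilbert spaces, so the universal Toeplitz representation is taken
   to be the direct sum of all Toeplitz representations on the single Hilbert space with
   orthonormal basis 'a \<Rightarrow> complex.  This loses nothing: a Toeplitz representation in a C*-algebra
   is one on a Hilbert space (Gelfand-Naimark), which splits into a zero representation and cyclic
   summands for the generated C*-algebra.  A cyclic summand has a dense subset indexed by finite
   words over C0 with rational scalars, so its orthonormal bases have at most card ('a \<Rightarrow> complex)
   elements; such a summand, extended by zero, is a representation on this Hilbert space. *)
type_synonym 'a rep_index =
  "(('a \<Rightarrow> complex) \<Rightarrow> ('a \<Rightarrow> complex) op) \<times> (('a \<Rightarrow> complex) \<Rightarrow> ('a \<Rightarrow> complex) op)"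

type_synonym 'a univ_op = "('a rep_index \<times> ('a \<Rightarrow> complex)) op"

definition univ_pi ::
  "('a::topological_space \<Rightarrow> 'a) \<Rightarrow> ('a \<Rightarrow> complex) \<Rightarrow> 'a univ_op" where
  "univ_pi \<sigma> f = direct_sum_op (\<lambda>(\<pi>, t). if toeplitz_rep \<sigma> \<pi> t then \<pi> f else 0)"

definition univ_t ::
  "('a::topological_space \<Rightarrow> 'a) \<Rightarrow> ('a \<Rightarrow> complex) \<Rightarrow> 'a univ_op" where
  "univ_t \<sigma> \<xi> = direct_sum_op (\<lambda>(\<pi>, t). if toeplitz_rep \<sigma> \<pi> t then t \<xi> else 0)"

definition op_subalgebra :: "'i op set \<Rightarrow> bool" where
  "op_subalgebra B \<longleftrightarrow>
     0 \<in> B \<and> (\<forall>S\<in>B. \<forall>T\<in>B. S + T \<in> B) \<and> (\<forall>c. \<forall>T\<in>B. op_scale c T \<in> B) \<and>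
     (\<forall>S\<in>B. \<forall>T\<in>B. S o\<^sub>L T \<in> B)"

definition semicrossed_product :: "('a::topological_space \<Rightarrow> 'a) \<Rightarrow> 'a univ_op set" where
  "semicrossed_product \<sigma> =
     (\<lambda>B. op_subalgebra B \<and> closed B) hull (univ_pi \<sigma> ` C0 \<union> univ_t \<sigma> ` C0)"


section \<open>Derivations and reflexivity\<close>

(* A map on a subspace Y is a HOL function whose values outside Y are irrelevant; all notions
   below depend only on its restriction to Y. *)
definition bounded_op_on :: "'i op set \<Rightarrow> ('i op \<Rightarrow> 'i op) \<Rightarrow> bool" where
  "bounded_op_on Y D \<longleftrightarrow>
     (\<forall>a\<in>Y. D a \<in> Y) \<and>
     (\<forall>a\<in>Y. \<forall>b\<in>Y. D (a + b) = D a + D b) \<and>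
     (\<forall>c. \<forall>a\<in>Y. D (op_scale c a) = op_scale c (D a)) \<and>
     (\<exists>C. \<forall>a\<in>Y. norm (D a) \<le> C * norm a)"

definition derivation_on :: "'i op set \<Rightarrow> ('i op \<Rightarrow> 'i op) \<Rightarrow> bool" where
  "derivation_on A \<delta> \<longleftrightarrow>
     bounded_op_on A \<delta> \<and> (\<forall>a\<in>A. \<forall>b\<in>A. \<delta> (a o\<^sub>L b) = (\<delta> a o\<^sub>L b) + (a o\<^sub>L \<delta> b))"

definition approx_local_derivation_on :: "'i op set \<Rightarrow> ('i op \<Rightarrow> 'i op) \<Rightarrow> bool" where
  "approx_local_derivation_on A \<delta> \<longleftrightarrow>
     bounded_op_on A \<delta> \<and>
     (\<forall>a\<in>A. \<exists>d :: nat \<Rightarrow> 'i op \<Rightarrow> 'i op. (\<forall>k. derivation_on A (d k)) \<and> (\<lambda>k. d k a) \<longlonglongrightarrow> \<delta> a)"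

definition operator_space_on :: "'i op set \<Rightarrow> ('i op \<Rightarrow> 'i op) set \<Rightarrow> bool" where
  "operator_space_on Y S \<longleftrightarrow>
     (\<forall>D\<in>S. bounded_op_on Y D) \<and>
     (\<lambda>_. 0) \<in> S \<and>
     (\<forall>D\<in>S. \<forall>E\<in>S. (\<lambda>a. D a + E a) \<in> S) \<and>
     (\<forall>c. \<forall>D\<in>S. (\<lambda>a. op_scale c (D a)) \<in> S)"

definition reflexive_on :: "'i op set \<Rightarrow> ('i op \<Rightarrow> 'i op) set \<Rightarrow> bool" where
  "reflexive_on Y S \<longleftrightarrow>
     operator_space_on Y S \<and>
     (\<forall>T. bounded_op_on Y T \<longrightarrow> (\<forall>y\<in>Y. T y \<in> closure ((\<lambda>D. D y) ` S)) \<longrightarrow> T \<in> S)"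


section \<open>The universal representation is a Toeplitz representation\<close>

lemma slice_summable: "(\<lambda>i. (cmod (ell2_nth x (r, i)))\<^sup>2) summable_on UNIV"
proof -
  have "(\<lambda>p. norm ((cmod (ell2_nth x p))\<^sup>2)) summable_on (UNIV \<times> UNIV)"
    using ell2_summable[of x] by simp
  from this[THEN Infinite_Sum.abs_summable_on_Sigma_iff[THEN iffD1]] show ?thesis by simp
qed

lemma nth_slice [simp]: "ell2_nth (slice r x) i = ell2_nth x (r, i)"
  by (simp add: slice_def ell2_nth_Abs slice_summable)

lemma slice_add [simp]: "slice r (x + y) = slice r x + slice r y"
  by (intro ell2_eqI) simp

lemma slice_scaleR [simp]: "slice r (c *\<^sub>R x) = c *\<^sub>R slice r x"
  by (intro ell2_eqI) simp

lemma slice_cscale [simp]: "slice r (cscale c x) = cscale c (slice r x)"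
  by (intro ell2_eqI) simp

lemma norm_slice_summable: "(\<lambda>r. (norm (slice r x))\<^sup>2) summable_on UNIV"
  and norm_square_slices: "(norm x)\<^sup>2 = (\<Sum>\<^sub>\<infinity>r. (norm (slice r x))\<^sup>2)"
proof -
  have s: "(\<lambda>(r, i). (cmod (ell2_nth x (r, i)))\<^sup>2) summable_on (UNIV \<times> UNIV)"
    using ell2_summable[of x] by (simp add: case_prod_unfold)
  show "(\<lambda>r. (norm (slice r x))\<^sup>2) summable_on UNIV"
    using summable_on_Sigma_banach[OF s] by (simp add: norm_ell2_square)
  show "(norm x)\<^sup>2 = (\<Sum>\<^sub>\<infinity>r. (norm (slice r x))\<^sup>2)"
    using infsum_Sigma'_banach[OF s] by (simp add: norm_ell2_square case_prod_unfold)
qed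

lemma cinner_slices:
  "(\<lambda>r. cinner (slice r x) (slice r y)) summable_on UNIV"
  "cinner x y = (\<Sum>\<^sub>\<infinity>r. cinner (slice r x) (slice r y))"
proof -
  have s: "(\<lambda>(r, i). cnj (ell2_nth x (r, i)) * ell2_nth y (r, i)) summable_on (UNIV \<times> UNIV)"
    using ell2_prod_summable'[of x y] by (simp add: case_prod_unfold)
  show "(\<lambda>r. cinner (slice r x) (slice r y)) summable_on UNIV"
    using summable_on_Sigma_banach[OF s] by (simp add: cinner_def)
  show "cinner x y = (\<Sum>\<^sub>\<infinity>r. cinner (slice r x) (slice r y))"
    using infsum_Sigma'_banach[OF s] by (simp add: cinner_def case_prod_unfold)
qed

lemma
  assumes T: "\<And>r. norm (T r) \<le> C"
  shows slice_direct_sum_op: "slice r (direct_sum_op T x) = T r (slice r x)"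
    and norm_direct_sum_op: "norm (direct_sum_op T) \<le> C"
proof -
  have C: "0 \<le> C" by (rule order_trans[OF norm_ge_zero T])
  let ?F = "\<lambda>x. \<lambda>(r, i). ell2_nth (T r (slice r x)) i"
  have le: "(norm (T r (slice r x)))\<^sup>2 \<le> C\<^sup>2 * (norm (slice r x))\<^sup>2" for r x
  proof -
    have "norm (T r (slice r x)) \<le> C * norm (slice r x)"
      by (rule order_trans[OF norm_blinfun mult_right_mono[OF T]]) simp
    then show ?thesis by (simp flip: power_mult_distrib) (rule power_mono, simp_all)
  qed
  have sC: "(\<lambda>r. C\<^sup>2 * (norm (slice r x))\<^sup>2) summable_on UNIV" for x :: "('a \<times> 'b) ell2"
    by (rule summable_on_cmult_right) (rule norm_slice_summable)
  have sT: "(\<lambda>r. norm ((norm (T r (slice r x)))\<^sup>2)) summable_on UNIV" for x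
    by (rule Infinite_Sum.abs_summable_on_comparison_test[where
          g = "\<lambda>r. C\<^sup>2 * (norm (slice r x))\<^sup>2"])
      (use sC le in \<open>simp_all add: abs_mult\<close>)
  have "(\<lambda>p. norm ((cmod (?F x p))\<^sup>2)) summable_on (UNIV \<times> UNIV)" for x
    unfolding Infinite_Sum.abs_summable_on_Sigma_iff
    using sT[of x] by (simp add: ell2_summable flip: norm_ell2_square)
  then have s: "(\<lambda>p. (cmod (?F x p))\<^sup>2) summable_on UNIV" for x by simp
  define G where "G = (\<lambda>x. Abs_ell2 (?F x))"
  have nth_G: "ell2_nth (G x) = ?F x" for x
    unfolding G_def by (rule ell2_nth_Abs) (rule s)
  have slice_G: "slice r (G x) = T r (slice r x)" for r x
    by (intro ell2_eqI) (simp add: nth_G)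
  have norm_G: "norm (G x) \<le> C * norm x" for x
  proof (rule power2_le_imp_le)
    have "(norm (G x))\<^sup>2 = (\<Sum>\<^sub>\<infinity>r. (norm (T r (slice r x)))\<^sup>2)"
      by (simp add: norm_square_slices[of "G x"] slice_G)
    also have "\<dots> \<le> (\<Sum>\<^sub>\<infinity>r. C\<^sup>2 * (norm (slice r x))\<^sup>2)"
      by (rule infsum_mono) (use sT sC le in simp_all)
    also have "\<dots> = C\<^sup>2 * (norm x)\<^sup>2"
      unfolding norm_square_slices[of x]
      by (rule infsum_cmult_right) (rule norm_slice_summable)
    finally show "(norm (G x))\<^sup>2 \<le> (C * norm x)\<^sup>2" by (simp add: power_mult_distrib)
  qed (use C in simp)
  have "bounded_linear G"
    by (rule bounded_linear_intro[where K = C])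
      (auto intro!: ell2_eqI simp: nth_G blinfun.bilinear_simps norm_G mult.commute[of _ C])
  then have app: "direct_sum_op T x = G x" for x
    unfolding direct_sum_op_def G_def by (simp add: bounded_linear_Blinfun_apply)
  show "slice r (direct_sum_op T x) = T r (slice r x)" by (simp add: app slice_G)
  show "norm (direct_sum_op T) \<le> C"
    by (rule norm_blinfun_bound) (use C norm_G in \<open>simp_all add: app\<close>)
qed

lemma C0_bounded:
  assumes "f \<in> C0"
  obtains c where "0 \<le> c" "\<And>x. cmod (f x) \<le> c"
proof -
  obtain K where K: "compact K" "\<And>x. x \<notin> K \<Longrightarrow> cmod (f x) < 1"
    using assms zero_less_one unfolding C0_def by blast
  have "continuous_on K f"
    using assms continuous_on_subset[of UNIV f K] by (simp add: C0_def)
  then have "bounded (f ` K)"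
    using K(1) by (intro compact_imp_bounded compact_continuous_image)
  then obtain b where b: "\<And>x. x \<in> K \<Longrightarrow> cmod (f x) \<le> b"
    by (auto simp: bounded_iff)
  show thesis
  proof
    show "cmod (f x) \<le> max 1 b" for x
      using b[of x] K(2)[of x] by (cases "x \<in> K") (auto simp: max_def)
  qed simp
qed

lemma C0_dominated:
  assumes "f \<in> C0" "continuous_on UNIV g" "\<And>x. cmod (g x) \<le> c * cmod (f x)"
  shows "g \<in> C0"
  unfolding C0_def
proof (intro CollectI conjI allI impI assms(2))
  fix e :: real assume "0 < e"
  then have "0 < e / (\<bar>c\<bar> + 1)" by (simp add: add_nonneg_pos)
  then obtain K where K: "compact K" "\<And>x. x \<notin> K \<Longrightarrow> cmod (f x) < e / (\<bar>c\<bar> + 1)"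
    using assms(1) unfolding C0_def by blast
  have "cmod (g x) < e" if "x \<notin> K" for x
  proof -
    have "cmod (g x) \<le> (\<bar>c\<bar> + 1) * cmod (f x)"
      by (rule order_trans[OF assms(3) mult_right_mono]) auto
    also have "\<dots> < (\<bar>c\<bar> + 1) * (e / (\<bar>c\<bar> + 1))"
      by (rule mult_strict_left_mono[OF K(2)[OF that]]) (simp add: add_nonneg_pos)
    also have "\<dots> = e"
      by (simp add: add_nonneg_eq_0_iff)
    finally show ?thesis .
  qed
  with K(1) show "\<exists>K. compact K \<and> (\<forall>x. x \<notin> K \<longrightarrow> cmod (g x) < e)" by blast
qed

lemma C0_continuous: "f \<in> C0 \<Longrightarrow> continuous_on UNIV f"
  by (simp add: C0_def)

lemma C0_scale:
  assumes "f \<in> C0"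
  shows "(\<lambda>x. c * f x) \<in> C0"
  by (rule C0_dominated[OF assms, where c = "cmod c"])
    (auto simp: norm_mult intro!: continuous_intros C0_continuous[OF assms])

lemma C0_cnj:
  assumes "f \<in> C0"
  shows "(\<lambda>x. cnj (f x)) \<in> C0"
  by (rule C0_dominated[OF assms, where c = 1]) (auto intro!: continuous_intros C0_continuous[OF assms])

lemma C0_mult_bounded:
  assumes "f \<in> C0" "continuous_on UNIV g" "\<And>x. cmod (g x) \<le> c"
  shows "(\<lambda>x. g x * f x) \<in> C0"
  by (rule C0_dominated[OF assms(1), where c = c])
    (auto simp: norm_mult intro!: continuous_intros C0_continuous[OF assms(1)] assms mult_right_mono)

lemma C0_mult: "f \<in> C0 \<Longrightarrow> g \<in> C0 \<Longrightarrow> (\<lambda>x. f x * g x) \<in> C0"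
  by (metis C0_bounded C0_continuous C0_mult_bounded)

lemma C0_add:
  assumes f: "f \<in> C0" and g: "g \<in> C0"
  shows "(\<lambda>x. f x + g x) \<in> C0"
  unfolding C0_def
proof (intro CollectI conjI allI impI)
  show "continuous_on UNIV (\<lambda>x. f x + g x)"
    by (intro continuous_on_add C0_continuous f g)
  fix e :: real assume "0 < e"
  then have "0 < e / 2" by simp
  then obtain K L where "compact K" "\<And>x. x \<notin> K \<Longrightarrow> cmod (f x) < e / 2"
    "compact L" "\<And>x. x \<notin> L \<Longrightarrow> cmod (g x) < e / 2"
    using f g unfolding C0_def by blast
  then show "\<exists>K. compact K \<and> (\<forall>x. x \<notin> K \<longrightarrow> cmod (f x + g x) < e)"
    by (intro exI[of _ "K \<union> L"])
      (auto intro!: compact_Un order_le_less_trans[OF norm_triangle_ineq] simp: field_sum_of_halves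
        intro: add_strict_mono[of _ "e/2" _ "e/2", simplified])
qed

lemma cinner_add_right: "cinner x (y + z) = cinner x y + cinner x z"
  by (metis cinner_commute cinner_add_left complex_cnj_add)

lemma cinner_self_norm: "cinner x x = of_real ((norm x)\<^sup>2)"
  by (simp add: cinner_self norm_ell2_square)

lemma star_hom_C0_norm_le:
  assumes \<pi>: "star_hom_C0 \<pi>" and f: "f \<in> C0" and c: "0 \<le> c" "\<And>x. cmod (f x) \<le> c"
  shows "norm (\<pi> f) \<le> c"
proof (rule norm_blinfun_bound[OF c(1)])
  fix h
  define g :: "'a \<Rightarrow> complex" where "g = (\<lambda>x. of_real (c - sqrt (c\<^sup>2 - (cmod (f x))\<^sup>2)))"
  have nonneg: "0 \<le> c\<^sup>2 - (cmod (f x))\<^sup>2" for x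
    using c(2) by (simp add: power_mono)
  have gC0: "g \<in> C0"
  proof (rule C0_dominated[OF f, where c = 1])
    show "continuous_on UNIV g"
      unfolding g_def by (intro continuous_intros C0_continuous[OF f])
    fix x
    let ?a = "cmod (f x)"
    have "c - ?a \<le> sqrt (c\<^sup>2 - ?a\<^sup>2)"
    proof (rule real_le_rsqrt)
      have "(c - ?a) * (c - ?a) \<le> (c - ?a) * (c + ?a)"
        by (rule mult_left_mono) (use c(2)[of x] in auto)
      then show "(c - ?a)\<^sup>2 \<le> c\<^sup>2 - ?a\<^sup>2"
        by (simp add: power2_eq_square algebra_simps)
    qed
    moreover have "sqrt (c\<^sup>2 - ?a\<^sup>2) \<le> c"
      by (rule real_le_lsqrt) (use c(1) in auto)
    ultimately show "cmod (g x) \<le> 1 * ?a"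
      unfolding g_def norm_of_real by simp
  qed
  have g_eq: "cnj (f x) * f x + g x * g x = of_real (2 * c) * g x" for x
  proof -
    have "cnj (f x) * f x = of_real ((cmod (f x))\<^sup>2)"
      using complex_norm_square[of "f x"] by (simp add: mult.commute)
    moreover have "(cmod (f x))\<^sup>2 + (c - sqrt (c\<^sup>2 - (cmod (f x))\<^sup>2)) * (c - sqrt (c\<^sup>2 - (cmod (f x))\<^sup>2))
        = 2 * c * (c - sqrt (c\<^sup>2 - (cmod (f x))\<^sup>2))"
      using real_sqrt_pow2[OF nonneg[of x]] by (simp add: power2_eq_square algebra_simps)
    ultimately show ?thesis
      unfolding g_def by (metis of_real_mult of_real_add)
  qed
  have g_cnj: "(\<lambda>x. cnj (g x)) = g" by (simp add: g_def)
  have adj: "cinner (\<pi> k h) h' = cinner h (\<pi> (\<lambda>x. cnj (k x)) h')" if "k \<in> C0" for k h h'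
    using \<pi> that by (auto simp: star_hom_C0_def is_adjoint_def)
  have mult: "\<pi> (\<lambda>x. k x * l x) h = \<pi> k (\<pi> l h)" if "k \<in> C0" "l \<in> C0" for k l h
    using \<pi> that by (simp add: star_hom_C0_def)
  have add: "\<pi> (\<lambda>x. k x + l x) = \<pi> k + \<pi> l" if "k \<in> C0" "l \<in> C0" for k l
    using \<pi> that by (simp add: star_hom_C0_def)
  have scale: "\<pi> (\<lambda>x. z * k x) = op_scale z (\<pi> k)" if "k \<in> C0" for z k
    using \<pi> that by (simp add: star_hom_C0_def)
  have ff: "(\<lambda>x. cnj (f x) * f x) \<in> C0" and gg: "(\<lambda>x. g x * g x) \<in> C0"
    by (intro C0_mult C0_cnj f gC0)+
  have "\<pi> (\<lambda>x. cnj (f x) * f x + g x * g x) = \<pi> (\<lambda>x. cnj (f x) * f x) + \<pi> (\<lambda>x. g x * g x)"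
    by (rule add[OF ff gg])
  then have "\<pi> (\<lambda>x. cnj (f x) * f x) + \<pi> (\<lambda>x. g x * g x) = \<pi> (\<lambda>x. of_real (2 * c) * g x)"
    unfolding g_eq by (rule sym)
  also have "\<dots> = op_scale (of_real (2 * c)) (\<pi> g)"
    by (rule scale[OF gC0])
  finally have eq: "\<pi> (\<lambda>x. cnj (f x) * f x) h + \<pi> (\<lambda>x. g x * g x) h = cscale (of_real (2 * c)) (\<pi> g h)"
    by (metis op_scale_apply plus_blinfun.rep_eq)
  have "cinner (\<pi> f h) (\<pi> f h) + cinner (\<pi> g h) (\<pi> g h) = of_real (2 * c) * cinner h (\<pi> g h)"
    using arg_cong[OF eq, of "cinner h"]
    by (simp add: cinner_add_right cinner_cscale_right adj f gC0 g_cnj mult C0_cnj)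
  from arg_cong[OF this, of Re]
  have "(norm (\<pi> f h))\<^sup>2 + (norm (\<pi> g h))\<^sup>2 = 2 * c * inner h (\<pi> g h)"
    by (simp add: cinner_self_norm inner_ell2_def)
  moreover have "(norm (c *\<^sub>R h - \<pi> g h))\<^sup>2 = c\<^sup>2 * (norm h)\<^sup>2 - 2 * c * inner h (\<pi> g h) + (norm (\<pi> g h))\<^sup>2"
    unfolding power2_norm_eq_inner
    by (simp add: inner_diff_left inner_diff_right inner_commute power2_eq_square algebra_simps)
  ultimately have "(norm (\<pi> f h))\<^sup>2 = (c * norm h)\<^sup>2 - (norm (c *\<^sub>R h - \<pi> g h))\<^sup>2"
    by (simp add: power_mult_distrib)
  then have "(norm (\<pi> f h))\<^sup>2 \<le> (c * norm h)\<^sup>2" by simp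
  then show "norm (\<pi> f h) \<le> c * norm h"
    by (rule power2_le_imp_le) (use c(1) in simp)
qed

lemma toeplitz_rep_norm_le:
  assumes rep: "toeplitz_rep \<sigma> \<pi> t" and \<xi>: "\<xi> \<in> C0" and c: "0 \<le> c" "\<And>x. cmod (\<xi> x) \<le> c"
  shows "norm (t \<xi>) \<le> c"
proof (rule norm_blinfun_bound[OF c(1)])
  fix h
  let ?g = "\<lambda>x. cnj (\<xi> x) * \<xi> x"
  have "norm (\<pi> ?g) \<le> c * c"
  proof (rule star_hom_C0_norm_le[where \<pi> = \<pi> and f = ?g])
    show "star_hom_C0 \<pi>" using rep by (simp add: toeplitz_rep_def)
    show "?g \<in> C0" by (rule C0_mult[OF C0_cnj[OF \<xi>] \<xi>])
    show "cmod (?g x) \<le> c * c" for x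
      unfolding norm_mult complex_mod_cnj by (rule mult_mono) (use c in auto)
  qed (use c in simp)
  have "(norm (t \<xi> h))\<^sup>2 = inner h (\<pi> ?g h)"
    unfolding power2_norm_eq_inner inner_ell2_def
    using rep \<xi> by (simp add: toeplitz_rep_def)
  also have "\<dots> \<le> norm h * norm (blinfun_apply (\<pi> ?g) h)" by (rule norm_cauchy_schwarz)
  also have "\<dots> \<le> norm h * ((c * c) * norm h)"
    by (rule mult_left_mono[OF order_trans[OF norm_blinfun mult_right_mono]])
      (use \<open>norm (\<pi> ?g) \<le> c * c\<close> in auto)
  finally have "(norm (t \<xi> h))\<^sup>2 \<le> (c * norm h)\<^sup>2" by (simp add: power2_eq_square algebra_simps)
  then show "norm (t \<xi> h) \<le> c * norm h"
    by (rule power2_le_imp_le) (use c(1) in simp)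
qed

lemma slice_univ:
  assumes "f \<in> C0"
  shows "slice (\<pi>, t) (univ_pi \<sigma> f x) = (if toeplitz_rep \<sigma> \<pi> t then \<pi> f (slice (\<pi>, t) x) else 0)"
    and "slice (\<pi>, t) (univ_t \<sigma> f x) = (if toeplitz_rep \<sigma> \<pi> t then t f (slice (\<pi>, t) x) else 0)"
proof -
  obtain c where c: "0 \<le> c" "\<And>x. cmod (f x) \<le> c" using C0_bounded[OF assms] by blast
  have "norm (case r of (\<pi>, t) \<Rightarrow> if toeplitz_rep \<sigma> \<pi> t then \<pi> f else 0) \<le> c" for r :: "'a rep_index"
    using c(1) by (auto split: prod.split simp: toeplitz_rep_def intro!: star_hom_C0_norm_le[OF _ assms c])
  from slice_direct_sum_op[OF this, of "(\<pi>, t)"]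
  show "slice (\<pi>, t) (univ_pi \<sigma> f x) = (if toeplitz_rep \<sigma> \<pi> t then \<pi> f (slice (\<pi>, t) x) else 0)"
    unfolding univ_pi_def by auto
  have "norm (case r of (\<pi>, t) \<Rightarrow> if toeplitz_rep \<sigma> \<pi> t then t f else 0) \<le> c" for r :: "'a rep_index"
    using c(1) by (auto split: prod.split intro!: toeplitz_rep_norm_le[OF _ assms c])
  from slice_direct_sum_op[OF this, of "(\<pi>, t)"]
  show "slice (\<pi>, t) (univ_t \<sigma> f x) = (if toeplitz_rep \<sigma> \<pi> t then t f (slice (\<pi>, t) x) else 0)"
    unfolding univ_t_def by auto
qed

lemma ell2_slices_eqI: "(\<And>r. slice r x = slice r y) \<Longrightarrow> x = y"
  by (rule ell2_eqI) (metis nth_slice prod.exhaust)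

lemma toeplitz_rep_univ:
  fixes \<sigma> :: "'a::t2_space \<Rightarrow> 'a"
  assumes "continuous_on UNIV \<sigma>"
  shows "toeplitz_rep \<sigma> (univ_pi \<sigma>) (univ_t \<sigma>)"
proof -
  have C0_act: "(\<lambda>x. a (\<sigma> x) * \<xi> x) \<in> C0" if a: "a \<in> C0" and \<xi>: "\<xi> \<in> C0" for a \<xi>
  proof -
    obtain c where c: "0 \<le> c" "\<And>x. cmod (a x) \<le> c" using C0_bounded[OF a] by blast
    show ?thesis
      by (rule C0_mult_bounded[OF \<xi> _ c(2)])
        (rule continuous_on_compose2[OF C0_continuous[OF a] assms], simp)
  qed
  have cs0: "cscale c 0 = 0" for c by (rule ell2_eqI) simp
  have ci0: "cinner 0 x = 0" "cinner x 0 = 0" for x by (simp_all add: cinner_def)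
  have ops: "\<pi> (\<lambda>x. f x + g x) = \<pi> f + \<pi> g" "\<pi> (\<lambda>x. c * f x) = op_scale c (\<pi> f)"
      "\<pi> (\<lambda>x. f x * g x) = \<pi> f o\<^sub>L \<pi> g"
      "cinner (\<pi> f h) k = cinner h (\<pi> (\<lambda>x. cnj (f x)) k)"
      "t (\<lambda>x. f x + g x) = t f + t g" "t (\<lambda>x. c * f x) = op_scale c (t f)"
      "\<pi> f (cscale c h) = cscale c (\<pi> f h)" "t f (cscale c h) = cscale c (t f h)"
      "t (\<lambda>x. f (\<sigma> x) * g x) = \<pi> f o\<^sub>L t g"
      "cinner (t f h) (t g k) = cinner h (\<pi> (\<lambda>x. cnj (f x) * g x) k)"
    if "toeplitz_rep \<sigma> \<pi> t" "f \<in> C0" "g \<in> C0"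
    for \<pi> t f g c and h k :: "('a \<Rightarrow> complex) ell2"
    using that by (simp_all add: toeplitz_rep_def star_hom_C0_def complex_linear_op_def is_adjoint_def)
  note mem = C0_add C0_scale C0_mult C0_cnj C0_act
  have eqI: "S = T" if "\<And>\<pi> t x. slice (\<pi>, t) (S x) = slice (\<pi>, t) (T x)" for S T :: "'a univ_op"
    by (rule blinfun_eqI, rule ell2_slices_eqI) (metis prod.exhaust that)
  have cinnerI: "cinner x y = cinner x' y'"
    if "\<And>\<pi> t. cinner (slice (\<pi>, t) x) (slice (\<pi>, t) y) = cinner (slice (\<pi>, t) x') (slice (\<pi>, t) y')"
    for x y x' y' :: "('a rep_index \<times> ('a \<Rightarrow> complex)) ell2"
    unfolding cinner_slices(2) by (rule infsum_cong) (metis prod.exhaust that)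
  have lin: "complex_linear_op (univ_pi \<sigma> f)" "complex_linear_op (univ_t \<sigma> f)" if "f \<in> C0" for f
    unfolding complex_linear_op_def
    by (auto intro!: ell2_slices_eqI simp: slice_univ that split_paired_all ops[OF _ that that] cs0)
  have "star_hom_C0 (univ_pi \<sigma>)"
    unfolding star_hom_C0_def is_adjoint_def
  proof (intro conjI ballI allI)
    fix f g :: "'a \<Rightarrow> complex" and c and h k
    assume f: "f \<in> C0"
    show "complex_linear_op (univ_pi \<sigma> f)" by (rule lin[OF f])
    show "univ_pi \<sigma> (\<lambda>x. c * f x) = op_scale c (univ_pi \<sigma> f)"
      by (rule eqI) (simp add: slice_univ mem f ops[OF _ f f] cs0)
    show "cinner (univ_pi \<sigma> f h) k = cinner h (univ_pi \<sigma> (\<lambda>x. cnj (f x)) k)"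
      by (rule cinnerI) (simp add: slice_univ mem f ops[OF _ f f] ci0)
    assume g: "g \<in> C0"
    show "univ_pi \<sigma> (\<lambda>x. f x + g x) = univ_pi \<sigma> f + univ_pi \<sigma> g"
      by (rule eqI) (simp add: slice_univ mem f g ops[OF _ f g] blinfun.bilinear_simps)
    show "univ_pi \<sigma> (\<lambda>x. f x * g x) = univ_pi \<sigma> f o\<^sub>L univ_pi \<sigma> g"
      by (rule eqI) (simp add: slice_univ mem f g ops[OF _ f g])
  qed
  moreover have "univ_t \<sigma> (\<lambda>x. f x + g x) = univ_t \<sigma> f + univ_t \<sigma> g"
      "univ_t \<sigma> (\<lambda>x. c * f x) = op_scale c (univ_t \<sigma> f)"
      "univ_pi \<sigma> f o\<^sub>L univ_t \<sigma> g = univ_t \<sigma> (\<lambda>x. f (\<sigma> x) * g x)"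
      "cinner (univ_t \<sigma> f h) (univ_t \<sigma> g k) = cinner h (univ_pi \<sigma> (\<lambda>x. cnj (f x) * g x) k)"
    if f: "f \<in> C0" and g: "g \<in> C0" for f g c h k
    by (rule eqI cinnerI,
        simp add: slice_univ mem f g ops[OF _ f g] blinfun.bilinear_simps cs0 ci0)+
  ultimately show ?thesis
    unfolding toeplitz_rep_def using lin by simp
qed

lemma inj_not_eventually_periodic:
  assumes "inj \<sigma>"
  shows "\<not> eventually_periodic \<sigma> x"
proof
  assume "eventually_periodic \<sigma> x"
  then obtain i j where *: "\<not> periodic \<sigma> x" "j \<ge> 1" "(\<sigma> ^^ j) ((\<sigma> ^^ i) x) = (\<sigma> ^^ i) x"
    by (auto simp: eventually_periodic_def periodic_def)
  have "(\<sigma> ^^ i) ((\<sigma> ^^ j) x) = (\<sigma> ^^ i) x"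
    using *(3) by (metis add.commute comp_apply funpow_add)
  then have "(\<sigma> ^^ j) x = x"
    using inj_fn[OF assms, of i] by (simp add: inj_eq)
  with * show False by (auto simp: periodic_def)
qed

end

theory Submission
  imports Defs "HOL-Complex_Analysis.Complex_Analysis"
begin

text \<open>
  An element \<open>a\<close> of the semicrossed product has Fourier coefficients \<open>a\<^sub>n(x)\<close>, read off from the
  orbit representation at \<open>x\<close>; by the maximum modulus principle they determine \<open>a\<close>. For a finite
  set \<open>I\<close> of points of one orbit and \<open>0 < |z| < 1\<close>, the matrices whose \<open>(c, b)\<close> entry
  is the sum of \<open>a\<^sub>n(b) z\<^sup>n\<close> over all \<open>n\<close> with \<open>\<sigma>\<^sup>n b = c\<close> form a representation \<open>\<rho>\<close> onto
  the incidence algebra of the reachability preorder on \<open>I\<close>. If every derivation preserves \<open>ker \<rho>\<close>, an approximately local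
  derivation \<open>\<delta>\<close> induces a linear map \<open>T\<close> on that algebra with \<open>X T(U) Y = 0\<close> whenever
  \<open>X U = U Y = 0\<close> and with \<open>T 1 = 0\<close>, and such a map is a derivation.

  The kernel is preserved in two cases. On a periodic orbit \<open>\<rho>\<close> is onto a full matrix algebra and
  Sinclair's argument applies: if \<open>\<rho>(v) = 0\<close> and \<open>\<rho>(d v)\<close> is idempotent, then
  \<open>\<rho>(d\<^sup>n(v\<^sup>n)) = n! \<rho>(d v)\<close>, which contradicts boundedness of \<open>d\<close>. On an initial segment of an
  infinite orbit every homogeneous element of \<open>ker \<rho>\<close> is a limit of sums of products of two
  elements of \<open>ker \<rho>\<close>. So \<open>\<delta>(a b) - \<delta>(a) b - a \<delta>(b)\<close> has vanishing coefficients at every point that is not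
  eventually periodic, and such points are dense.
\<close>

section \<open>Orbit representations and the gauge action\<close>

lemma cscale_zero [simp]: "cscale c 0 = 0"
  by (rule ell2_eqI) simp

lemma cinner_zero [simp]: "cinner 0 x = 0" "cinner x 0 = 0"
  by (simp_all add: cinner_def)

text \<open>The real inner product only sees the real part of \<open>cinner\<close>. Rotating
  \<open>y\<close> by a unimodular scalar makes \<open>cinner x y\<close> real and nonnegative,
  after which the real Cauchy-Schwarz inequality applies.\<close>

lemma norm_cinner_le: "cmod (cinner x y) \<le> norm x * norm y"
proof (cases "cinner x y = 0")
  case False
  define u where "u = cnj (cinner x y) / cmod (cinner x y)"
  have u: "cmod u = 1"
    using False by (simp add: u_def norm_divide)
  have "cmod (cinner x y) = Re (u * cinner x y)"
    using False by (simp add: u_def complex_norm_square[symmetric] power2_eq_square mult.commute)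
  also have "\<dots> = inner x (cscale u y)"
    by (simp add: inner_ell2_def cinner_cscale_right)
  also have "\<dots> \<le> norm x * norm (cscale u y)"
    by (rule norm_cauchy_schwarz)
  finally show ?thesis by (simp add: norm_cscale u)
qed simp

definition ket :: "'i \<Rightarrow> 'i ell2" where
  "ket j = Abs_ell2 (\<lambda>i. if i = j then 1 else 0)"

lemma nth_ket [simp]: "ell2_nth (ket j) i = (if i = j then 1 else 0)"
proof -
  have "(\<lambda>i. (cmod (if i = j then 1 else 0))\<^sup>2) summable_on UNIV"
    by (rule finite_nonzero_values_imp_summable_on) (rule finite_subset[of _ "{j}"], auto)
  then show ?thesis by (simp add: ket_def ell2_nth_Abs)
qed

lemma norm_ket [simp]: "norm (ket j) = 1"
proof -
  have "(norm (ket j))\<^sup>2 = (\<Sum>\<^sub>\<infinity>i\<in>{j}. (cmod (ell2_nth (ket j) i))\<^sup>2)"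
    unfolding norm_ell2_square by (rule infsum_cong_neutral) auto
  also have "\<dots> = 1\<^sup>2" by simp
  finally show ?thesis by (rule power2_eq_imp_eq) simp_all
qed

lemma slice_ket: "slice r (ket (r', i)) = (if r = r' then ket i else 0)"
  by (rule ell2_eqI) simp

text \<open>One construction serves for diagonal operators, weighted shifts and permutations of
  coordinates. The map \<phi> tells from which coordinate the \<open>i\<close>-th one is taken, so a
  forward shift is given by the predecessor map.\<close>

definition wcomp :: "('i \<Rightarrow> complex) \<Rightarrow> ('i \<Rightarrow> 'i) \<Rightarrow> 'i op" where
  "wcomp w \<phi> = Blinfun (\<lambda>v. Abs_ell2 (\<lambda>i. w i * ell2_nth v (\<phi> i)))"

text \<open>Injectivity of \<phi> on the support of the weight means that no coordinate of
  \<open>v\<close> is used twice there, so the squares of the coordinates used sum to at most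
  \<open>(norm v)\<^sup>2\<close>.\<close>

lemma
  assumes w: "\<And>i. cmod (w i) \<le> C" and inj: "inj_on \<phi> {i. w i \<noteq> 0}"
  shows nth_wcomp: "ell2_nth (wcomp w \<phi> v) i = w i * ell2_nth v (\<phi> i)"
    and norm_wcomp: "norm (wcomp w \<phi>) \<le> C"
proof -
  have C: "0 \<le> C" by (rule order_trans[OF norm_ge_zero w])
  let ?N = "{i. w i \<noteq> 0}"
  have sN: "(\<lambda>i. (cmod (ell2_nth v (\<phi> i)))\<^sup>2) summable_on ?N"
    and leN: "(\<Sum>\<^sub>\<infinity>i\<in>?N. (cmod (ell2_nth v (\<phi> i)))\<^sup>2) \<le> (norm v)\<^sup>2" for v
  proof -
    have s: "(\<lambda>j. (cmod (ell2_nth v j))\<^sup>2) summable_on \<phi> ` ?N"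
      by (rule summable_on_subset_banach[OF ell2_summable]) simp
    show "(\<lambda>i. (cmod (ell2_nth v (\<phi> i)))\<^sup>2) summable_on ?N"
      using s unfolding summable_on_reindex[OF inj] by (simp only: o_def)
    have "(\<Sum>\<^sub>\<infinity>i\<in>?N. (cmod (ell2_nth v (\<phi> i)))\<^sup>2) = (\<Sum>\<^sub>\<infinity>j\<in>\<phi> ` ?N. (cmod (ell2_nth v j))\<^sup>2)"
      using infsum_reindex[OF inj, of "\<lambda>j. (cmod (ell2_nth v j))\<^sup>2"] by (simp add: o_def)
    also have "\<dots> \<le> (\<Sum>\<^sub>\<infinity>j. (cmod (ell2_nth v j))\<^sup>2)"
      by (rule infsum_mono_neutral[OF s ell2_summable]) auto
    finally show "(\<Sum>\<^sub>\<infinity>i\<in>?N. (cmod (ell2_nth v (\<phi> i)))\<^sup>2) \<le> (norm v)\<^sup>2"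
      by (simp add: norm_ell2_square)
  qed
  have le: "(cmod (w i * ell2_nth v (\<phi> i)))\<^sup>2 \<le> C\<^sup>2 * (cmod (ell2_nth v (\<phi> i)))\<^sup>2" for v i
    unfolding norm_mult power_mult_distrib by (intro mult_right_mono power_mono w) auto
  have sC: "(\<lambda>i. C\<^sup>2 * (cmod (ell2_nth v (\<phi> i)))\<^sup>2) summable_on ?N" for v
    by (rule summable_on_cmult_right[OF sN])
  have "(\<lambda>i. norm ((cmod (w i * ell2_nth v (\<phi> i)))\<^sup>2)) summable_on ?N" for v
    by (rule Infinite_Sum.abs_summable_on_comparison_test[where
          g = "\<lambda>i. C\<^sup>2 * (cmod (ell2_nth v (\<phi> i)))\<^sup>2"])
      (use sC le in \<open>simp_all add: abs_mult\<close>)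
  then have sN': "(\<lambda>i. (cmod (w i * ell2_nth v (\<phi> i)))\<^sup>2) summable_on ?N" for v by simp
  have s: "(\<lambda>i. (cmod (w i * ell2_nth v (\<phi> i)))\<^sup>2) summable_on UNIV" for v
    using sN'[of v] by (rule summable_on_cong_neutral[THEN iffD1, rotated -1]) auto
  define G where "G = (\<lambda>v. Abs_ell2 (\<lambda>i. w i * ell2_nth v (\<phi> i)))"
  have nth_G: "ell2_nth (G v) i = w i * ell2_nth v (\<phi> i)" for v i
    unfolding G_def by (simp add: ell2_nth_Abs[OF s])
  have norm_G: "norm (G v) \<le> C * norm v" for v
  proof (rule power2_le_imp_le)
    have "(norm (G v))\<^sup>2 = (\<Sum>\<^sub>\<infinity>i\<in>?N. (cmod (w i * ell2_nth v (\<phi> i)))\<^sup>2)"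
      unfolding norm_ell2_square nth_G by (rule infsum_cong_neutral) auto
    also have "\<dots> \<le> (\<Sum>\<^sub>\<infinity>i\<in>?N. C\<^sup>2 * (cmod (ell2_nth v (\<phi> i)))\<^sup>2)"
      by (rule infsum_mono[OF sN' sC]) (rule le)
    also have "\<dots> = C\<^sup>2 * (\<Sum>\<^sub>\<infinity>i\<in>?N. (cmod (ell2_nth v (\<phi> i)))\<^sup>2)"
      by (rule infsum_cmult_right[OF sN])
    also have "\<dots> \<le> C\<^sup>2 * (norm v)\<^sup>2"
      by (rule mult_left_mono[OF leN]) simp
    finally show "(norm (G v))\<^sup>2 \<le> (C * norm v)\<^sup>2" by (simp add: power_mult_distrib)
  qed (use C in simp)
  have "bounded_linear G"
    by (rule bounded_linear_intro[where K = C])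
      (auto intro!: ell2_eqI simp: nth_G norm_G mult.commute[of _ C] algebra_simps)
  then have app: "wcomp w \<phi> v = G v" for v
    unfolding wcomp_def G_def by (simp add: bounded_linear_Blinfun_apply)
  show "ell2_nth (wcomp w \<phi> v) i = w i * ell2_nth v (\<phi> i)" by (simp add: app nth_G)
  show "norm (wcomp w \<phi>) \<le> C"
    by (rule norm_blinfun_bound) (use C norm_G in \<open>simp_all add: app\<close>)
qed

(* The given Hilbert space has basis 'a => complex; cidx n indexes the n-th vector of an orbit. *)
definition cidx :: "nat \<Rightarrow> 'a \<Rightarrow> complex" where
  "cidx n = (\<lambda>_. of_nat n)"

lemma inj_cidx: "inj cidx"
  by (auto simp: inj_def cidx_def fun_eq_iff)

lemma inv_cidx [simp]: "inv cidx (cidx n) = n"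
  by (rule inv_f_f[OF inj_cidx])

lemma cidx_eq [simp]: "cidx m = cidx n \<longleftrightarrow> m = n"
  by (meson inj_cidx inj_eq)

text \<open>With e_n the basis vector at \<open>cidx n\<close>, this is e_n -> f(\<sigma>^n x) e_n,
  and \<open>orb_t\<close> below is e_n -> \<xi>(\<sigma>^n x) e_(n+1). Both vanish on the
  orthogonal complement of the e_n.\<close>

definition orb_pi :: "('a \<Rightarrow> 'a) \<Rightarrow> 'a \<Rightarrow> ('a \<Rightarrow> complex) \<Rightarrow> ('a \<Rightarrow> complex) op" where
  "orb_pi \<sigma> x f = wcomp (\<lambda>i. if i \<in> range cidx then f ((\<sigma> ^^ inv cidx i) x) else 0) id"

definition orb_t :: "('a \<Rightarrow> 'a) \<Rightarrow> 'a \<Rightarrow> ('a \<Rightarrow> complex) \<Rightarrow> ('a \<Rightarrow> complex) op" where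
  "orb_t \<sigma> x \<xi> =
     wcomp (\<lambda>i. if i \<in> cidx ` {1..} then \<xi> ((\<sigma> ^^ (inv cidx i - 1)) x) else 0)
       (\<lambda>i. cidx (inv cidx i - 1))"

lemma nth_orb_pi:
  assumes "f \<in> C0"
  shows "ell2_nth (orb_pi \<sigma> x f v) i =
    (if i \<in> range cidx then f ((\<sigma> ^^ inv cidx i) x) * ell2_nth v i else 0)"
proof -
  obtain c where "0 \<le> c" "\<And>x. cmod (f x) \<le> c" using C0_bounded[OF assms] by blast
  then show ?thesis
    unfolding orb_pi_def by (subst nth_wcomp[where C = c]) auto
qed

lemma nth_orb_t:
  assumes "f \<in> C0"
  shows "ell2_nth (orb_t \<sigma> x f v) i =
    (if i \<in> cidx ` {1..} then f ((\<sigma> ^^ (inv cidx i - 1)) x) * ell2_nth v (cidx (inv cidx i - 1)) else 0)"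
proof -
  obtain c where "0 \<le> c" "\<And>x. cmod (f x) \<le> c" using C0_bounded[OF assms] by blast
  then show ?thesis
    unfolding orb_t_def by (subst nth_wcomp[where C = c]) (auto simp: inj_on_def split: if_splits)
qed

lemma C0_act:
  assumes "continuous_on UNIV \<sigma>" "a \<in> C0" "\<xi> \<in> C0"
  shows "(\<lambda>x. a (\<sigma> x) * \<xi> x) \<in> C0"
proof -
  obtain c where c: "0 \<le> c" "\<And>x. cmod (a x) \<le> c" using C0_bounded[OF assms(2)] by blast
  show ?thesis
    by (rule C0_mult_bounded[OF assms(3) _ c(2)])
      (rule continuous_on_compose2[OF C0_continuous[OF assms(2)] assms(1)], simp)
qed

lemma toeplitz_rep_orb:
  assumes "continuous_on UNIV \<sigma>"
  shows "toeplitz_rep \<sigma> (orb_pi \<sigma> x) (orb_t \<sigma> x)"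
proof -
  note mem = C0_add C0_scale C0_mult C0_cnj C0_act[OF assms]
  have "star_hom_C0 (orb_pi \<sigma> x)"
    unfolding star_hom_C0_def complex_linear_op_def is_adjoint_def
  proof (intro conjI ballI allI)
    fix f :: "'a \<Rightarrow> complex" and h k assume f: "f \<in> C0"
    show "cinner (orb_pi \<sigma> x f h) k = cinner h (orb_pi \<sigma> x (\<lambda>x. cnj (f x)) k)"
      unfolding cinner_def by (rule infsum_cong) (simp add: nth_orb_pi f mem)
  qed (auto intro!: blinfun_eqI ell2_eqI simp: nth_orb_pi mem blinfun.bilinear_simps algebra_simps)
  moreover have "cinner (orb_t \<sigma> x \<xi> h) (orb_t \<sigma> x \<eta> k) =
      cinner h (orb_pi \<sigma> x (\<lambda>x. cnj (\<xi> x) * \<eta> x) k)"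
    if \<xi>: "\<xi> \<in> C0" and \<eta>: "\<eta> \<in> C0" for \<xi> \<eta> h k
  proof -
    let ?F = "\<lambda>i. cnj (ell2_nth (orb_t \<sigma> x \<xi> h) i) * ell2_nth (orb_t \<sigma> x \<eta> k) i"
    let ?G = "\<lambda>i. cnj (ell2_nth h i) * ell2_nth (orb_pi \<sigma> x (\<lambda>x. cnj (\<xi> x) * \<eta> x) k) i"
    have inj: "inj_on (cidx \<circ> Suc) UNIV" "inj_on cidx UNIV"
      using inj_cidx by (auto simp: inj_def)
    \<comment> \<open>Vectors in the range of \<open>orb_t\<close> have no coordinate at
      \<open>cidx 0\<close>, so only the indices \<open>cidx (Suc n)\<close> contribute. Reindexing
      by them gives the sum for the diagonal operator.\<close>
    have "infsum ?F UNIV = infsum ?F (range (cidx \<circ> Suc))"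
    proof (rule infsum_cong_neutral)
      fix i :: "'a \<Rightarrow> complex" assume i: "i \<in> UNIV - range (cidx \<circ> Suc)"
      have "i \<notin> cidx ` {1..}"
      proof
        assume "i \<in> cidx ` {1..}"
        then obtain n where "n \<ge> 1" "i = cidx n" by auto
        then have "i = (cidx \<circ> Suc) (n - 1)" by simp
        with i show False by blast
      qed
      then show "?F i = 0" by (simp add: nth_orb_t \<xi> \<eta>)
    qed auto
    also have "\<dots> = infsum (?F \<circ> (cidx \<circ> Suc)) UNIV"
      by (rule infsum_reindex[OF inj(1)])
    also have "\<dots> = infsum (?G \<circ> cidx) UNIV"
      by (rule infsum_cong) (simp add: nth_orb_t nth_orb_pi \<xi> \<eta> mem)
    also have "\<dots> = infsum ?G (range cidx)"
      by (rule infsum_reindex[OF inj(2), symmetric])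
    also have "\<dots> = infsum ?G UNIV"
      by (rule infsum_cong_neutral) (auto simp: nth_orb_pi \<xi> \<eta> mem)
    finally show ?thesis by (simp add: cinner_def)
  qed
  moreover have "orb_pi \<sigma> x a o\<^sub>L orb_t \<sigma> x \<xi> = orb_t \<sigma> x (\<lambda>x. a (\<sigma> x) * \<xi> x)"
    if "a \<in> C0" "\<xi> \<in> C0" for a \<xi>
  proof (rule blinfun_eqI, rule ell2_eqI)
    fix v i
    show "ell2_nth ((orb_pi \<sigma> x a o\<^sub>L orb_t \<sigma> x \<xi>) v) i =
        ell2_nth (orb_t \<sigma> x (\<lambda>x. a (\<sigma> x) * \<xi> x) v) i"
    proof (cases "i \<in> cidx ` {1..}")
      case True
      then obtain n where "i = cidx (Suc n)"
        by (metis atLeast_iff imageE Suc_le_D One_nat_def)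
      then show ?thesis using that by (simp add: nth_orb_t nth_orb_pi mem)
    qed (use that in \<open>auto simp: nth_orb_t nth_orb_pi mem\<close>)
  qed
  ultimately show ?thesis
    unfolding toeplitz_rep_def complex_linear_op_def
    by (auto intro!: blinfun_eqI ell2_eqI simp: nth_orb_t mem blinfun.bilinear_simps algebra_simps)
qed

lemma orb_pi_ket:
  assumes "f \<in> C0"
  shows "orb_pi \<sigma> x f (ket (cidx n)) = cscale (f ((\<sigma> ^^ n) x)) (ket (cidx n))"
  by (rule ell2_eqI) (auto simp: nth_orb_pi[OF assms])

lemma orb_t_ket:
  assumes "f \<in> C0"
  shows "orb_t \<sigma> x f (ket (cidx n)) = cscale (f ((\<sigma> ^^ n) x)) (ket (cidx (Suc n)))"
  by (rule ell2_eqI) (auto simp: nth_orb_t[OF assms])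

section \<open>The gauge action\<close>

definition gauge_t :: "complex \<Rightarrow> ('b \<Rightarrow> 'i op) \<Rightarrow> 'b \<Rightarrow> 'i op" where
  "gauge_t z t = (\<lambda>f. op_scale z (t f))"

lemma op_scale_op_scale [simp]: "op_scale c (op_scale d T) = op_scale (c * d) T"
  by (rule blinfun_eqI, rule ell2_eqI) simp

lemma op_scale_one [simp]: "op_scale 1 T = T"
  by (rule blinfun_eqI, rule ell2_eqI) simp

lemma gauge_t_gauge_t [simp]: "gauge_t z (gauge_t w t) = gauge_t (z * w) t"
  by (simp add: gauge_t_def)

lemma gauge_t_one [simp]: "gauge_t 1 t = t"
  by (simp add: gauge_t_def)

lemma toeplitz_rep_gauge_t:
  assumes "toeplitz_rep \<sigma> \<pi> t" "cmod z = 1"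
  shows "toeplitz_rep \<sigma> \<pi> (gauge_t z t)"
proof -
  have z: "z * cnj z = 1"
    using assms(2) by (metis complex_norm_square of_real_1 one_power2)
  have zz: "z * (cnj z * c) = c" for c
    using z by (simp flip: mult.assoc)
  have cov: "\<pi> a o\<^sub>L op_scale z (t \<xi>) = op_scale z (t (\<lambda>x. a (\<sigma> x) * \<xi> x))"
    if "a \<in> C0" "\<xi> \<in> C0" for a \<xi>
  proof -
    have "complex_linear_op (\<pi> a)" "\<pi> a o\<^sub>L t \<xi> = t (\<lambda>x. a (\<sigma> x) * \<xi> x)"
      using assms(1) that by (auto simp: toeplitz_rep_def star_hom_C0_def)
    then show ?thesis
      by (metis (no_types) blinfun_eqI blinfun_apply_blinfun_compose complex_linear_op_def op_scale_apply)
  qed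
  show ?thesis
    using assms(1) cov unfolding toeplitz_rep_def gauge_t_def
    by (auto intro!: blinfun_eqI ell2_eqI simp: complex_linear_op_def blinfun.bilinear_simps
        cinner_cscale_left cinner_cscale_right algebra_simps zz)
qed

text \<open>For unimodular \<open>z\<close> this unitary permutes the summands of the universal
  representation by (\<pi>, t) -> (\<pi>, z t). Conjugation with it is the gauge action, which fixes
  \<open>univ_pi\<close> and multiplies \<open>univ_t\<close> by \<open>z\<close>.\<close>

definition gauge_u :: "complex \<Rightarrow> 'a univ_op" where
  "gauge_u z = wcomp (\<lambda>_. 1) (\<lambda>((\<pi>, t), i). ((\<pi>, gauge_t z t), i))"

lemma
  assumes "cmod z = 1"
  shows nth_gauge_u: "ell2_nth ((gauge_u z :: 'a univ_op) h) ((\<pi>, t), i) = ell2_nth h ((\<pi>, gauge_t z t), i)"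
    and norm_gauge_u: "norm (gauge_u z :: 'a univ_op) \<le> 1"
proof -
  have "z \<noteq> 0" using assms by auto
  then have "gauge_t (1 / z) (gauge_t z t) = t" for t :: "('a \<Rightarrow> complex) \<Rightarrow> ('a \<Rightarrow> complex) op"
    by simp
  then have "inj (\<lambda>((\<pi>, t), i). ((\<pi>, gauge_t z t), i) :: 'a rep_index \<times> ('a \<Rightarrow> complex))"
    by (intro inj_on_inverseI[where g = "\<lambda>((\<pi>, t), i). ((\<pi>, gauge_t (1 / z) t), i)"])
      (auto simp del: gauge_t_gauge_t)
  then have inj: "inj_on (\<lambda>((\<pi>, t), i). ((\<pi>, gauge_t z t), i) :: 'a rep_index \<times> ('a \<Rightarrow> complex))
      {i. (1::complex) \<noteq> 0}" by simp
  show "ell2_nth (gauge_u z h) ((\<pi>, t), i) = ell2_nth h ((\<pi>, gauge_t z t), i)"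
    unfolding gauge_u_def by (subst nth_wcomp[OF _ inj, where C = 1]) auto
  show "norm (gauge_u z :: 'a univ_op) \<le> 1"
    unfolding gauge_u_def by (rule norm_wcomp[OF _ inj]) auto
qed

lemma slice_gauge_u:
  "cmod z = 1 \<Longrightarrow> slice (\<pi>, t) (gauge_u z h) = slice (\<pi>, gauge_t z t) h"
  by (rule ell2_eqI) (simp add: nth_gauge_u)

lemma gauge_u_inverse:
  assumes "cmod z = 1"
  shows "gauge_u z (gauge_u (1 / z) h) = h"
proof (rule ell2_slices_eqI)
  have "z \<noteq> 0" "cmod (1 / z) = 1" using assms by (auto simp: norm_divide)
  then show "slice r (gauge_u z (gauge_u (1 / z) h)) = slice r h" for r
    by (cases r) (simp add: slice_gauge_u assms)
qed

text \<open>The permutation must not mix the summands that are Toeplitz representations with those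
  on which the universal representation acts as zero.\<close>

lemma toeplitz_rep_gauge_t_iff:
  assumes "cmod z = 1"
  shows "toeplitz_rep \<sigma> \<pi> (gauge_t z t) \<longleftrightarrow> toeplitz_rep \<sigma> \<pi> t"
proof
  have "z \<noteq> 0" "cmod (1 / z) = 1" using assms by (auto simp: norm_divide)
  then show "toeplitz_rep \<sigma> \<pi> t" if "toeplitz_rep \<sigma> \<pi> (gauge_t z t)"
    using toeplitz_rep_gauge_t[OF that, of "1 / z"] by simp
qed (rule toeplitz_rep_gauge_t[OF _ assms])

lemma gauge_t_apply: "gauge_t z t f = op_scale z (t f)"
  by (simp add: gauge_t_def)

lemma gauge_u_univ:
  assumes "cmod z = 1" "f \<in> C0"
  shows "gauge_u z (univ_pi \<sigma> f h) = univ_pi \<sigma> f (gauge_u z h)"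
    and "gauge_u z (univ_t \<sigma> f h) = cscale z (univ_t \<sigma> f (gauge_u z h))"
  using assms
  by (auto intro!: ell2_slices_eqI simp: slice_gauge_u slice_univ toeplitz_rep_gauge_t_iff gauge_t_apply
      split_paired_all)

section \<open>Algebra of scalar multiples and compositions\<close>

lemma op_scale_add: "op_scale c (S + T) = op_scale c S + op_scale c T"
  by (rule blinfun_eqI, rule ell2_eqI) (simp add: blinfun.bilinear_simps algebra_simps)

lemma op_scale_zero [simp]: "op_scale c 0 = 0" "op_scale 0 T = 0"
  by (rule blinfun_eqI, rule ell2_eqI, simp)+

lemma op_scale_of_real: "op_scale (of_real r) T = r *\<^sub>R T"
  by (rule blinfun_eqI, rule ell2_eqI) (simp add: blinfun.bilinear_simps)

lemma op_scale_minus_one: "op_scale (-1) T = - T"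
  using op_scale_of_real[of "-1" T] by simp

lemma op_scale_compose_left: "op_scale c S o\<^sub>L T = op_scale c (S o\<^sub>L T)"
  by (rule blinfun_eqI) simp

lemma op_scale_compose_right: "complex_linear_op S \<Longrightarrow> S o\<^sub>L op_scale c T = op_scale c (S o\<^sub>L T)"
  by (rule blinfun_eqI) (simp add: complex_linear_op_def)

lemma norm_op_scale_le: "norm (op_scale c T) \<le> cmod c * norm T"
  by (rule norm_blinfun_bound) (simp_all add: norm_cscale mult.assoc mult_left_mono norm_blinfun)

lemma compose_add_left: "(S + S') o\<^sub>L T = (S o\<^sub>L T) + (S' o\<^sub>L T)"
  by (rule blinfun_eqI) (simp add: blinfun.bilinear_simps)

lemma compose_add_right: "S o\<^sub>L (T + T') = (S o\<^sub>L T) + (S o\<^sub>L T')"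
  by (rule blinfun_eqI) (simp add: blinfun.bilinear_simps)

lemma compose_assoc: "(S o\<^sub>L T) o\<^sub>L U = S o\<^sub>L (T o\<^sub>L U)"
  by (rule blinfun_eqI) simp

lemma compose_zero [simp]: "0 o\<^sub>L T = 0" "S o\<^sub>L 0 = 0"
  by (rule blinfun_eqI, simp)+

lemma complex_linear_op_add:
  assumes "complex_linear_op S" "complex_linear_op T"
  shows "complex_linear_op (S + T)"
  unfolding complex_linear_op_def
proof (intro allI ell2_eqI)
  fix c h i
  have "S (cscale c h) = cscale c (S h)" "T (cscale c h) = cscale c (T h)"
    using assms by (simp_all add: complex_linear_op_def)
  then show "ell2_nth ((S + T) (cscale c h)) i = ell2_nth (cscale c ((S + T) h)) i"
    by (simp add: plus_blinfun.rep_eq distrib_left)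
qed

lemma bounded_linear_op_scale: "bounded_linear (op_scale c)"
proof (rule bounded_linear_intro[where K = "cmod c"])
  show "op_scale c (r *\<^sub>R S) = r *\<^sub>R op_scale c S" for r :: real and S :: "'i op"
    by (metis op_scale_of_real op_scale_op_scale mult.commute)
  show "norm (op_scale c S) \<le> norm S * cmod c" for S :: "'i op"
    using norm_op_scale_le[of c S] by (simp add: mult.commute)
qed (simp add: op_scale_add)

lemmas tendsto_op_scale = bounded_linear.tendsto[OF bounded_linear_op_scale]

section \<open>Homogeneous elements\<close>

(* homog n f a stands for a = V^n f. *)
inductive homog :: "('a::topological_space \<Rightarrow> 'a) \<Rightarrow> nat \<Rightarrow> ('a \<Rightarrow> complex) \<Rightarrow> 'a univ_op \<Rightarrow> bool"
  for \<sigma> where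
  homog_pi: "f \<in> C0 \<Longrightarrow> homog \<sigma> 0 f (univ_pi \<sigma> f)"
| homog_t: "\<xi> \<in> C0 \<Longrightarrow> homog \<sigma> n f a \<Longrightarrow>
    homog \<sigma> (Suc n) (\<lambda>x. \<xi> ((\<sigma> ^^ n) x) * f x) (univ_t \<sigma> \<xi> o\<^sub>L a)"
| homog_add: "homog \<sigma> n f a \<Longrightarrow> homog \<sigma> n g b \<Longrightarrow> homog \<sigma> n (\<lambda>x. f x + g x) (a + b)"

lemma gauge_u_homog:
  fixes \<sigma> :: "'a::t2_space \<Rightarrow> 'a"
  assumes cont: "continuous_on UNIV \<sigma>" and a: "homog \<sigma> n f a" and z: "cmod z = 1"
  shows "gauge_u z (a h) = cscale (z ^ n) (a (gauge_u z h))"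
  using a
proof (induction arbitrary: h)
  case (homog_t \<xi> n f a)
  have "gauge_u z (univ_t \<sigma> \<xi> (a h)) = cscale z (univ_t \<sigma> \<xi> (cscale (z ^ n) (a (gauge_u z h))))"
    by (simp add: gauge_u_univ z homog_t)
  also have "\<dots> = cscale z (cscale (z ^ n) (univ_t \<sigma> \<xi> (a (gauge_u z h))))"
    using toeplitz_rep_univ[OF cont] homog_t.hyps(1)
    by (simp add: toeplitz_rep_def complex_linear_op_def)
  also have "\<dots> = cscale (z ^ Suc n) (univ_t \<sigma> \<xi> (a (gauge_u z h)))"
    by (rule ell2_eqI) simp
  finally show ?case by simp
qed (use z in \<open>auto intro!: ell2_eqI simp: gauge_u_univ blinfun.bilinear_simps algebra_simps\<close>)

locale lch_system =
  fixes \<sigma> :: "'a::t2_space \<Rightarrow> 'a"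
  assumes cont: "continuous_on UNIV \<sigma>"
    and lc: "locally_compact_space (euclidean :: 'a topology)"
begin

abbreviation "upi \<equiv> univ_pi \<sigma>"
abbreviation "ut \<equiv> univ_t \<sigma>"
abbreviation "alg \<equiv> semicrossed_product \<sigma>"

lemma rep: "toeplitz_rep \<sigma> upi ut"
  by (rule toeplitz_rep_univ[OF cont])

lemma star_hom: "star_hom_C0 upi"
  using rep by (simp add: toeplitz_rep_def)

lemma
  assumes "f \<in> C0"
  shows upi_scale: "upi (\<lambda>x. c * f x) = op_scale c (upi f)"
    and upi_linear: "complex_linear_op (upi f)"
    and upi_adj: "cinner (upi f h) k = cinner h (upi (\<lambda>x. cnj (f x)) k)"
    and ut_linear: "complex_linear_op (ut f)"
  using rep assms by (simp_all add: toeplitz_rep_def star_hom_C0_def is_adjoint_def)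

lemma
  assumes "f \<in> C0" "g \<in> C0"
  shows upi_add: "upi (\<lambda>x. f x + g x) = upi f + upi g"
    and upi_mult: "upi (\<lambda>x. f x * g x) = upi f o\<^sub>L upi g"
    and upi_ut: "upi f o\<^sub>L ut g = ut (\<lambda>x. f (\<sigma> x) * g x)"
    and cinner_ut: "cinner (ut f h) (ut g k) = cinner h (upi (\<lambda>x. cnj (f x) * g x) k)"
  using rep assms by (simp_all add: toeplitz_rep_def star_hom_C0_def)

lemma continuous_iterate: "continuous_on UNIV (\<sigma> ^^ n)"
proof (induction n)
  case (Suc n)
  show ?case
    using continuous_on_compose2[OF cont Suc] by (simp add: o_def)
qed (simp add: id_def)

lemma C0_act_iterate:
  assumes "a \<in> C0" "\<xi> \<in> C0"
  shows "(\<lambda>x. a ((\<sigma> ^^ n) x) * \<xi> x) \<in> C0"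
  by (rule C0_act[OF continuous_iterate assms])

lemma homog_C0: "homog \<sigma> n f a \<Longrightarrow> f \<in> C0"
  by (induction rule: homog.induct) (auto intro: C0_act_iterate C0_add)

lemma homog_linear: "homog \<sigma> n f a \<Longrightarrow> complex_linear_op a"
proof (induction rule: homog.induct)
  case (homog_t \<xi> n f a)
  then show ?case using ut_linear[of \<xi>] by (simp add: complex_linear_op_def)
next
  case (homog_add n f a g b)
  then show ?case by (auto intro!: ell2_eqI simp: complex_linear_op_def blinfun.bilinear_simps algebra_simps)
qed (rule upi_linear)

lemma zero_C0: "(\<lambda>_. 0) \<in> C0"
proof -
  have "\<exists>K::'a set. compact K" by (rule exI[of _ "{}"]) simp
  then show ?thesis by (auto simp: C0_def)
qed

lemma homog_scale: "homog \<sigma> n f a \<Longrightarrow> homog \<sigma> n (\<lambda>x. c * f x) (op_scale c a)"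
proof (induction rule: homog.induct)
  case (homog_pi f)
  then show ?case using homog.homog_pi[OF C0_scale] by (metis upi_scale)
next
  case (homog_t \<xi> n f a)
  show ?case
    using homog.homog_t[OF homog_t.hyps(1) homog_t.IH]
    by (simp add: op_scale_compose_right[OF ut_linear] homog_t.hyps mult.left_commute)
next
  case (homog_add n f a g b)
  show ?case using homog.homog_add[OF homog_add.IH] by (simp add: op_scale_add distrib_left)
qed

lemma homog_zero: "homog \<sigma> n (\<lambda>_. 0) 0"
proof (induction n)
  case 0
  show ?case using homog_scale[OF homog_pi[OF zero_C0], of 0] by simp
next
  case (Suc n)
  show ?case using homog_t[OF zero_C0 Suc] by simp
qed

lemma homog_diff:
  assumes "homog \<sigma> n f a" "homog \<sigma> n g b"
  shows "homog \<sigma> n (\<lambda>x. f x - g x) (a - b)"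
  using homog_add[OF assms(1) homog_scale[OF assms(2), of "-1"]] by (simp add: op_scale_minus_one)

lemma homog_pi_left:
  "homog \<sigma> n f a \<Longrightarrow> g \<in> C0 \<Longrightarrow> homog \<sigma> n (\<lambda>x. g ((\<sigma> ^^ n) x) * f x) (upi g o\<^sub>L a)"
proof (induction arbitrary: g rule: homog.induct)
  case (homog_pi f)
  then show ?case
    using homog.homog_pi[OF C0_mult[of g f], where \<sigma> = \<sigma>] by (simp add: upi_mult)
next
  case (homog_t \<xi> n f a)
  show ?case
    using homog.homog_t[OF C0_act[OF cont homog_t.prems homog_t.hyps(1)] homog_t.hyps(2)]
    by (simp add: upi_ut[symmetric] homog_t.hyps homog_t.prems compose_assoc mult.assoc)
next
  case (homog_add n f a g' b)
  show ?case
    using homog.homog_add[OF homog_add.IH(1)[OF homog_add.prems] homog_add.IH(2)[OF homog_add.prems]]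
    by (simp add: compose_add_right distrib_left)
qed

lemma homog_mult:
  assumes "homog \<sigma> m f a" "homog \<sigma> n g b"
  shows "homog \<sigma> (m + n) (\<lambda>x. f ((\<sigma> ^^ n) x) * g x) (a o\<^sub>L b)"
  using assms(1)
proof (induction rule: homog.induct)
  case (homog_pi f)
  then show ?case using homog_pi_left[OF assms(2)] by simp
next
  case (homog_t \<xi> m f a)
  show ?case
    using homog.homog_t[OF homog_t.hyps(1) homog_t.IH]
    by (simp add: compose_assoc mult.assoc funpow_add)
next
  case (homog_add m f a f' a')
  show ?case
    using homog.homog_add[OF homog_add.IH] by (simp add: compose_add_left distrib_right)
qed

lemma homog_pi_right:
  "homog \<sigma> n f a \<Longrightarrow> g \<in> C0 \<Longrightarrow> homog \<sigma> n (\<lambda>x. f x * g x) (a o\<^sub>L upi g)"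
  using homog_mult[OF _ homog_pi] by fastforce

text \<open>The adjoint of V^n f times V^n g is the function conj(f) g. The left degree is lowered
  by \<open>cinner_ut\<close>, one factor \<open>ut\<close> at a time, and a second induction takes
  the right element apart.\<close>

lemma cinner_homog:
  "homog \<sigma> n f a \<Longrightarrow> homog \<sigma> n g b \<Longrightarrow>
    cinner (a h) (b k) = cinner h (upi (\<lambda>x. cnj (f x) * g x) k)"
proof (induction arbitrary: g b h k rule: homog.induct)
  case (homog_pi f)
  then have f: "f \<in> C0" and b: "homog \<sigma> 0 g b" by auto
  have "b = upi g \<and> g \<in> C0"
    using b by (induction "0::nat" g b rule: homog.induct) (auto simp: upi_add C0_add)
  then show ?case
    by (simp add: upi_adj[OF f] upi_mult C0_cnj f)
next
  case (homog_t \<xi> n f a)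
  from homog_t.prems show ?case
  proof (induction "Suc n" g b rule: homog.induct)
    case (homog_t \<eta> g b)
    note \<xi> = homog_t.prems
    have m: "(\<lambda>x. cnj (\<xi> x) * \<eta> x) \<in> C0"
      by (intro C0_mult C0_cnj \<open>\<xi> \<in> C0\<close> homog_t.hyps)
    \<comment> \<open>The function produced by \<open>cinner_ut\<close> is absorbed into
      \<open>b\<close>, which keeps its degree \<open>n\<close>, so the outer induction hypothesis
      applies.\<close>
    have "cinner (a h) ((upi (\<lambda>x. cnj (\<xi> x) * \<eta> x) o\<^sub>L b) k) =
        cinner h (upi (\<lambda>x. cnj (f x) * (cnj (\<xi> ((\<sigma> ^^ n) x)) * \<eta> ((\<sigma> ^^ n) x) * g x)) k)"
      by (rule \<open>\<And>g b h k. homog \<sigma> n g b \<Longrightarrow> cinner (a h) (b k) = cinner h (upi (\<lambda>x. cnj (f x) * g x) k)\<close>)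
        (rule homog_pi_left[OF homog_t.hyps(2) m])
    then show ?case
      by (simp add: cinner_ut \<open>\<xi> \<in> C0\<close> homog_t.hyps mult_ac)
  next
    case (homog_add g b g' b')
    have mem: "(\<lambda>x. cnj (\<xi> ((\<sigma> ^^ n) x) * f x) * g x) \<in> C0" "(\<lambda>x. cnj (\<xi> ((\<sigma> ^^ n) x) * f x) * g' x) \<in> C0"
      by (intro C0_mult C0_cnj C0_act_iterate homog_t.hyps(1) homog_C0[OF homog_t.hyps(2)]
          homog_C0[OF homog_add.hyps(1)] homog_C0[OF homog_add.hyps(3)])+
    show ?case
      using upi_add[OF mem] homog_add.hyps
      by (simp add: blinfun.bilinear_simps cinner_add_right distrib_left)
  qed
next
  case (homog_add n f a f' a')
  have mem: "(\<lambda>x. cnj (f x) * g x) \<in> C0" "(\<lambda>x. cnj (f' x) * g x) \<in> C0"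
    by (intro C0_mult C0_cnj homog_C0[OF homog_add.hyps(1)] homog_C0[OF homog_add.hyps(2)]
        homog_C0[OF homog_add.prems])+
  show ?case
    using upi_add[OF mem] homog_add.IH[OF homog_add.prems]
    by (simp add: blinfun.bilinear_simps cinner_add_left cinner_add_right distrib_right)
qed

text \<open>By \<open>cinner_homog\<close> the adjoint of \<open>a\<close> times \<open>a\<close> is
  the image of |f|^2, and star homomorphisms of \<open>C0\<close> are contractive.\<close>

lemma homog_norm_le:
  assumes a: "homog \<sigma> n f a" and c: "0 \<le> c" "\<And>x. cmod (f x) \<le> c"
  shows "norm a \<le> c"
proof (rule norm_blinfun_bound[OF c(1)])
  fix h
  let ?g = "\<lambda>x. cnj (f x) * f x"
  have "norm (upi ?g) \<le> c * c"
  proof (rule star_hom_C0_norm_le[OF star_hom, where f = ?g])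
    show "?g \<in> C0" by (rule C0_mult[OF C0_cnj]) (rule homog_C0[OF a])+
    show "cmod (?g x) \<le> c * c" for x
      unfolding norm_mult complex_mod_cnj by (rule mult_mono) (use c in auto)
  qed (use c in simp)
  have "(norm (a h))\<^sup>2 = inner h (upi ?g h)"
    unfolding power2_norm_eq_inner inner_ell2_def by (simp add: cinner_homog[OF a a])
  also have "\<dots> \<le> norm h * norm (blinfun_apply (upi ?g) h)" by (rule norm_cauchy_schwarz)
  also have "\<dots> \<le> norm h * ((c * c) * norm h)"
    by (rule mult_left_mono[OF order_trans[OF norm_blinfun mult_right_mono]])
      (use \<open>norm (upi ?g) \<le> c * c\<close> in auto)
  finally have "(norm (a h))\<^sup>2 \<le> (c * norm h)\<^sup>2" by (simp add: power2_eq_square algebra_simps)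
  then show "norm (a h) \<le> c * norm h"
    by (rule power2_le_imp_le) (use c(1) in simp)
qed

section \<open>Functions in \<open>C0\<close> and homogeneous elements with prescribed
  values\<close>

lemma C0_bump:
  fixes y :: 'a
  assumes "finite F" "y \<notin> F"
  shows "\<exists>f\<in>C0. f y = 1 \<and> (\<forall>w\<in>F. f w = 0)"
proof -
  have "Hausdorff_space (euclidean :: 'a topology)"
    unfolding Hausdorff_space_def
  proof (intro allI impI)
    fix x y :: 'a assume "x \<in> topspace euclidean \<and> y \<in> topspace euclidean \<and> x \<noteq> y"
    then obtain U V where "open U" "open V" "x \<in> U" "y \<in> V" "U \<inter> V = {}"
      using hausdorff[of x y] by blast
    then show "\<exists>U V. openin euclidean U \<and> openin euclidean V \<and> x \<in> U \<and> y \<in> V \<and> disjnt U V"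
      by (intro exI[of _ U] exI[of _ V]) (simp add: disjnt_def)
  qed
  then have reg: "completely_regular_space (euclidean :: 'a topology)"
    by (intro locally_compact_regular_imp_completely_regular_space[OF lc] disjI1)
  \<comment> \<open>\<open>K\<close> provides the compact set outside which the bump vanishes, and
    removing \<open>F\<close> from \<open>U\<close> forces the zeros on \<open>F\<close>.\<close>
  obtain U K where UK: "open U" "compact K" "y \<in> U" "U \<subseteq> K"
    using lc[unfolded locally_compact_space_def, rule_format, of y] by (auto simp flip: open_openin)
  have "closed (- (U - F))"
    by (rule closed_Compl[OF open_Diff[OF UK(1) finite_imp_closed[OF assms(1)]]])
  moreover have "y \<notin> - (U - F)" using UK(3) assms(2) by simp
  ultimately obtain g :: "'a \<Rightarrow> real" where g: "continuous_map euclidean (top_of_set {0..1}) g"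
      "g y = 0" "g ` (- (U - F)) \<subseteq> {1}"
    using reg unfolding completely_regular_space_def
    by (metis DiffI UNIV_I closed_closedin topspace_euclidean)
  have cg: "continuous_on UNIV g"
    using g(1) by (simp add: continuous_map_in_subtopology)
  let ?f = "\<lambda>x. complex_of_real (1 - g x)"
  have 0: "?f x = 0" if "x \<notin> U - F" for x
    using g(3) that by auto
  have "?f \<in> C0"
    unfolding C0_def
  proof (intro CollectI conjI allI impI)
    show "continuous_on UNIV ?f" by (intro continuous_intros cg)
    show "\<exists>K. compact K \<and> (\<forall>x. x \<notin> K \<longrightarrow> cmod (?f x) < e)" if "0 < e" for e
      using UK(2,4) 0 that by (intro exI[of _ K]) (metis (no_types, lifting) DiffD1 norm_zero subsetD)
  qed
  then show ?thesis
    by (intro bexI[of _ ?f]) (use g(2) 0 in auto)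
qed

lemma C0_diff: "f \<in> C0 \<Longrightarrow> g \<in> C0 \<Longrightarrow> (\<lambda>x. f x - g x) \<in> C0"
  using C0_add[OF _ C0_scale, of f g "-1"] by simp

text \<open>The factor |f|^2 / (|f|^2 + e^2) leaves the error |f| e^2 / (|f|^2 + e^2), which is at
  most \<open>e\<close> because |f| e \<le> |f|^2 + e^2. That \<open>h\<close> vanishes where
  \<open>f\<close> does later places \<open>upi h\<close> in the kernel of a matrix
  representation.\<close>

lemma C0_approx_unit:
  assumes f: "f \<in> C0" and "0 < e"
  shows "\<exists>h\<in>C0. (\<forall>x. cmod (f x - f x * h x) \<le> e) \<and> (\<forall>x. f x = 0 \<longrightarrow> h x = 0)"
proof (intro bexI conjI allI impI)
  let ?h = "\<lambda>x. complex_of_real ((cmod (f x))\<^sup>2 / ((cmod (f x))\<^sup>2 + e\<^sup>2))"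
  have pos: "0 < (cmod (f x))\<^sup>2 + e\<^sup>2" for x
    using \<open>0 < e\<close> by (simp add: add_nonneg_pos)
  show "?h \<in> C0"
  proof (rule C0_dominated[OF C0_mult[OF f f], where c = "1 / e\<^sup>2"])
    show "continuous_on UNIV ?h"
      by (intro continuous_intros C0_continuous[OF f]) (use pos in \<open>auto simp: less_le\<close>)
    show "cmod (?h x) \<le> 1 / e\<^sup>2 * cmod (f x * f x)" for x
    proof -
      have "cmod (?h x) = (cmod (f x))\<^sup>2 / ((cmod (f x))\<^sup>2 + e\<^sup>2)"
        unfolding norm_of_real using pos[of x] by simp
      also have "\<dots> \<le> (cmod (f x))\<^sup>2 / e\<^sup>2"
        by (rule divide_left_mono) (use \<open>0 < e\<close> pos[of x] in auto)
      finally show ?thesis by (simp add: norm_mult power2_eq_square)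
    qed
  qed
  show "?h x = 0" if "f x = 0" for x using that by simp
  show "cmod (f x - f x * ?h x) \<le> e" for x
  proof -
    have "f x - f x * ?h x = f x * of_real (e\<^sup>2 / ((cmod (f x))\<^sup>2 + e\<^sup>2))"
    proof -
      have "e\<^sup>2 / ((cmod (f x))\<^sup>2 + e\<^sup>2) = 1 - (cmod (f x))\<^sup>2 / ((cmod (f x))\<^sup>2 + e\<^sup>2)"
        using pos[of x] by (metis add_diff_cancel_left' diff_divide_distrib divide_self less_irrefl)
      then show ?thesis by (simp only: of_real_diff of_real_1 right_diff_distrib mult_1_right)
    qed
    moreover have "0 \<le> e\<^sup>2 / ((cmod (f x))\<^sup>2 + e\<^sup>2)"
      by (rule divide_nonneg_pos[OF _ pos]) simp
    ultimately have "cmod (f x - f x * ?h x) = cmod (f x) * (e\<^sup>2 / ((cmod (f x))\<^sup>2 + e\<^sup>2))"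
      by (simp only: norm_mult norm_of_real abs_of_nonneg)
    also have "\<dots> \<le> e"
    proof -
      have "2 * cmod (f x) * e \<le> (cmod (f x))\<^sup>2 + e\<^sup>2" "0 \<le> cmod (f x) * e"
        using sum_squares_bound[of "cmod (f x)" e] \<open>0 < e\<close> by auto
      then have "cmod (f x) * e \<le> (cmod (f x))\<^sup>2 + e\<^sup>2" by linarith
      then have "cmod (f x) * e * e \<le> ((cmod (f x))\<^sup>2 + e\<^sup>2) * e"
        using \<open>0 < e\<close> by (intro mult_right_mono) auto
      then have "cmod (f x) * e\<^sup>2 / ((cmod (f x))\<^sup>2 + e\<^sup>2) \<le> e"
        using pos[of x] by (simp add: pos_divide_le_eq power2_eq_square mult.assoc mult.commute)
      then show ?thesis by simp
    qed
    finally show ?thesis .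
  qed
qed

lemma ut_add: "f \<in> C0 \<Longrightarrow> g \<in> C0 \<Longrightarrow> ut (\<lambda>x. f x + g x) = ut f + ut g"
  using rep by (simp add: toeplitz_rep_def)

text \<open>This right module relation is not an axiom of \<open>toeplitz_rep\<close>. By
  \<open>cinner_ut\<close> the difference of the two vectors is orthogonal to the range of every
  \<open>ut k\<close>, and it is itself a difference of two vectors from such ranges, so it is
  zero.\<close>

lemma ut_upi:
  assumes f: "f \<in> C0" and g: "g \<in> C0"
  shows "ut f o\<^sub>L upi g = ut (\<lambda>x. f x * g x)"
proof (rule blinfun_eqI)
  fix h
  let ?d = "ut f (upi g h) - ut (\<lambda>x. f x * g x) h"
  have fg: "(\<lambda>x. f x * g x) \<in> C0" by (rule C0_mult[OF f g])
  have 0: "cinner (ut k v) ?d = 0" if k: "k \<in> C0" for k v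
  proof -
    have "upi (\<lambda>x. cnj (k x) * (f x * g x)) = upi (\<lambda>x. cnj (k x) * f x) o\<^sub>L upi g"
      using upi_mult[OF C0_mult[OF C0_cnj[OF k] f] g] by (simp add: mult.assoc)
    then have "cinner (ut k v) (ut (\<lambda>x. f x * g x) h) = cinner (ut k v) (ut f (upi g h))"
      by (simp add: cinner_ut k f fg)
    then show ?thesis
      using cinner_add_right[of "ut k v" ?d "ut (\<lambda>x. f x * g x) h"] by simp
  qed
  have "inner ?d ?d = 0"
    using 0[OF f, of "upi g h"] 0[OF fg, of h]
    by (simp add: inner_diff_left) (simp add: inner_ell2_def)
  then show "(ut f o\<^sub>L upi g) h = ut (\<lambda>x. f x * g x) h" by simp
qed

lemma C0_sum: "(\<And>i. i \<in> I \<Longrightarrow> f i \<in> C0) \<Longrightarrow> (\<lambda>x. \<Sum>i\<in>I. f i x) \<in> C0"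
proof (induction I rule: infinite_finite_induct)
  case (insert i I)
  then show ?case by (simp add: C0_add)
qed (simp_all add: zero_C0)

lemma C0_interpolate:
  fixes F :: "'a set"
  assumes "finite F"
  shows "\<exists>f\<in>C0. \<forall>w\<in>F. f w = v w"
proof -
  have "\<exists>f\<in>C0. f y = 1 \<and> (\<forall>w\<in>F - {y}. f w = 0)" for y
    by (rule C0_bump) (use assms in auto)
  then obtain b where b: "\<And>y. b y \<in> C0" "\<And>y. b y y = 1" "\<And>y w. w \<in> F \<Longrightarrow> w \<noteq> y \<Longrightarrow> b y w = 0"
    by (metis Diff_iff singletonD)
  show ?thesis
  proof (intro bexI ballI)
    show "(\<lambda>x. \<Sum>y\<in>F. v y * b y x) \<in> C0"
      by (intro C0_sum C0_scale b)
    fix w assume w: "w \<in> F"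
    have "(\<Sum>y\<in>F. v y * b y w) = (\<Sum>y\<in>F. if w = y then v w else 0)"
      by (rule sum.cong) (use w b in auto)
    then show "(\<Sum>y\<in>F. v y * b y w) = v w"
      using assms w by simp
  qed
qed

lemma homog_bump:
  assumes "finite F" "y \<notin> F"
  shows "\<exists>f a. homog \<sigma> n f a \<and> f y = c \<and> (\<forall>w\<in>F. f w = 0)"
proof -
  have "\<exists>f a. homog \<sigma> n f a \<and> f y = 1 \<and> (\<forall>w\<in>F. f w = 0)"
  proof (induction n)
    case 0
    show ?case using C0_bump[OF assms] homog_pi by blast
  next
    case (Suc n)
    then obtain f a where fa: "homog \<sigma> n f a" "f y = 1" "\<forall>w\<in>F. f w = 0" by blast
    obtain \<xi> where "\<xi> \<in> C0" "\<xi> ((\<sigma> ^^ n) y) = 1"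
      using C0_bump[of "{}"] by blast
    then show ?case using homog_t[OF _ fa(1), of \<xi>] fa by fastforce
  qed
  then obtain f a where fa: "homog \<sigma> n f a" "f y = 1" "\<forall>w\<in>F. f w = 0" by blast
  then show ?thesis using homog_scale[OF fa(1), of c] by fastforce
qed

section \<open>Polynomials and their density in the semicrossed product\<close>

lemma alg_closed: "closed alg" and alg_subalgebra: "op_subalgebra alg"
proof -
  have "op_subalgebra alg \<and> closed alg"
    unfolding semicrossed_product_def
    by (rule hull_in) (auto simp: op_subalgebra_def)
  then show "closed alg" "op_subalgebra alg" by auto
qed

lemma
  shows alg_zero: "0 \<in> alg"
    and alg_add: "a \<in> alg \<Longrightarrow> b \<in> alg \<Longrightarrow> a + b \<in> alg"
    and alg_scale: "a \<in> alg \<Longrightarrow> op_scale c a \<in> alg"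
    and alg_mult: "a \<in> alg \<Longrightarrow> b \<in> alg \<Longrightarrow> a o\<^sub>L b \<in> alg"
  using alg_subalgebra by (auto simp: op_subalgebra_def)

lemma alg_diff: "a \<in> alg \<Longrightarrow> b \<in> alg \<Longrightarrow> a - b \<in> alg"
  using alg_add[of a "op_scale (-1) b"] alg_scale[of b "-1"] by (simp add: op_scale_minus_one)

lemma alg_generators: "f \<in> C0 \<Longrightarrow> upi f \<in> alg" "f \<in> C0 \<Longrightarrow> ut f \<in> alg"
  unfolding semicrossed_product_def by (rule subsetD[OF hull_subset], blast)+

lemma homog_alg: "homog \<sigma> n f a \<Longrightarrow> a \<in> alg"
  by (induction rule: homog.induct) (auto intro: alg_generators alg_mult alg_add)

definition polys :: "'a univ_op set" where
  "polys = {p. \<exists>K f a. (\<forall>n. homog \<sigma> n (f n) (a n)) \<and> p = (\<Sum>n<K. a n)}"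

lemma polysI: "(\<And>n. homog \<sigma> n (f n) (a n)) \<Longrightarrow> (\<Sum>n<K. a n) \<in> polys"
  unfolding polys_def by blast

text \<open>Padding with zeros beyond \<open>K\<close> allows every larger length, so that two
  polynomials can be written with a common one.\<close>

lemma polysE:
  assumes "p \<in> polys"
  obtains K f a where "\<And>n. homog \<sigma> n (f n) (a n)" "\<And>L. K \<le> L \<Longrightarrow> p = (\<Sum>n<L. a n)"
proof -
  obtain K f a where fa: "\<And>n. homog \<sigma> n (f n) (a n)" "p = (\<Sum>n<K. a n)"
    using assms unfolding polys_def by blast
  let ?f = "\<lambda>n. if n < K then f n else (\<lambda>_. 0)" and ?a = "\<lambda>n. if n < K then a n else 0"
  have "p = (\<Sum>n<L. ?a n)" if "K \<le> L" for L
    unfolding fa(2) by (rule sum.mono_neutral_cong_left) (use that in auto)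
  then show thesis
    using that[of ?f ?a K] fa(1) homog_zero by simp
qed

lemma homog_polys:
  assumes "homog \<sigma> n f a"
  shows "a \<in> polys"
proof -
  have "(\<Sum>m<Suc n. if m = n then a else 0) \<in> polys"
    by (rule polysI[where f = "\<lambda>m. if m = n then f else (\<lambda>_. 0)"]) (use assms homog_zero in simp)
  then show ?thesis by simp
qed

lemma polys_zero: "0 \<in> polys"
  by (rule homog_polys[OF homog_zero])

lemma polys_add:
  assumes "p \<in> polys" "q \<in> polys"
  shows "p + q \<in> polys"
proof -
  obtain K f a where p: "\<And>n. homog \<sigma> n (f n) (a n)" "\<And>L. K \<le> L \<Longrightarrow> p = (\<Sum>n<L. a n)"
    by (rule polysE[OF assms(1)]) (rule that)
  obtain K' f' a' where q: "\<And>n. homog \<sigma> n (f' n) (a' n)" "\<And>L. K' \<le> L \<Longrightarrow> q = (\<Sum>n<L. a' n)"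
    by (rule polysE[OF assms(2)]) (rule that)
  have "p + q = (\<Sum>n<max K K'. a n + a' n)"
    using p(2)[of "max K K'"] q(2)[of "max K K'"] by (simp add: sum.distrib)
  also have "\<dots> \<in> polys"
    by (rule polysI[OF homog_add[OF p(1) q(1)]])
  finally show ?thesis .
qed

lemma polys_sum: "(\<And>i. i \<in> I \<Longrightarrow> p i \<in> polys) \<Longrightarrow> (\<Sum>i\<in>I. p i) \<in> polys"
  by (induction I rule: infinite_finite_induct) (auto intro: polys_add polys_zero)

lemma polys_induct [consumes 1, case_names homog add]:
  assumes "p \<in> polys" "\<And>n f a. homog \<sigma> n f a \<Longrightarrow> Q a" "\<And>a b. a \<in> polys \<Longrightarrow> b \<in> polys \<Longrightarrow> Q a \<Longrightarrow> Q b \<Longrightarrow> Q (a + b)"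
  shows "Q p"
proof -
  obtain K f a where fa: "\<And>n. homog \<sigma> n (f n) (a n)" and p: "p = (\<Sum>n<K. a n)"
    using assms(1) unfolding polys_def by blast
  have "(\<Sum>n<K. a n) \<in> polys \<and> Q (\<Sum>n<K. a n)"
  proof (induction K)
    case 0
    show ?case using assms(2)[OF homog_zero] polys_zero by simp
  next
    case (Suc K)
    then show ?case
      using assms(2)[OF fa] assms(3) homog_polys[OF fa] by (auto intro: polys_add)
  qed
  then show ?thesis using p by simp
qed

lemma polys_alg: "p \<in> polys \<Longrightarrow> p \<in> alg"
  by (induction rule: polys_induct) (auto intro: homog_alg alg_add)

lemma polys_scale: "p \<in> polys \<Longrightarrow> op_scale c p \<in> polys"
  by (induction rule: polys_induct) (auto intro: homog_polys homog_scale polys_add simp: op_scale_add)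

lemma polys_diff: "p \<in> polys \<Longrightarrow> q \<in> polys \<Longrightarrow> p - q \<in> polys"
  using polys_add[of p "op_scale (-1) q"] polys_scale[of q "-1"] by (simp add: op_scale_minus_one)

lemma polys_mult:
  assumes "p \<in> polys" "q \<in> polys"
  shows "p o\<^sub>L q \<in> polys"
  using assms(1)
proof (induction rule: polys_induct)
  case (homog m f a)
  show ?case
    using assms(2)
    by (induction rule: polys_induct)
      (auto intro: homog_polys homog_mult[OF homog] polys_add simp: compose_add_right)
qed (auto intro: polys_add simp: compose_add_left)

text \<open>The closure of the polynomials is a closed subalgebra, so only the generators are in
  question. Since \<open>homog\<close> builds products that end in some \<open>upi\<close>, the
  generator \<open>ut f\<close> is obtained as the limit of \<open>ut f o\<^sub>L upi h\<close> with
  \<open>h\<close> from an approximate unit.\<close>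

lemma alg_eq_closure: "alg = closure polys"
proof
  have cl: "a \<in> closure polys" if "\<And>k. p k \<in> polys" "p \<longlonglongrightarrow> a" for p a
    unfolding closure_sequential using that by (intro exI[of _ p]) simp
  have lim: "thesis" if "a \<in> closure polys"
    "\<And>p. (\<And>k. p k \<in> polys) \<Longrightarrow> p \<longlonglongrightarrow> a \<Longrightarrow> thesis" for a thesis
    using that(1) unfolding closure_sequential by (elim exE conjE) (rule that(2), simp_all)
  have "op_subalgebra (closure polys)"
    unfolding op_subalgebra_def
  proof (intro conjI ballI allI)
    show "0 \<in> closure polys" using polys_zero closure_subset by blast
  next
    fix c a assume a: "a \<in> closure polys"
    obtain p where p: "\<And>k. p k \<in> polys" "p \<longlonglongrightarrow> a" by (rule lim[OF a]) (rule that)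
    show "op_scale c a \<in> closure polys"
      by (rule cl[OF _ tendsto_op_scale[OF p(2)]]) (rule polys_scale[OF p(1)])
  next
    fix a b assume a: "a \<in> closure polys" and b: "b \<in> closure polys"
    obtain p where p: "\<And>k. p k \<in> polys" "p \<longlonglongrightarrow> a" by (rule lim[OF a]) (rule that)
    obtain q where q: "\<And>k. q k \<in> polys" "q \<longlonglongrightarrow> b" by (rule lim[OF b]) (rule that)
    show "a + b \<in> closure polys"
      by (rule cl[OF _ tendsto_add[OF p(2) q(2)]]) (intro polys_add p q)
  next
    fix a b assume a: "a \<in> closure polys" and b: "b \<in> closure polys"
    obtain p where p: "\<And>k. p k \<in> polys" "p \<longlonglongrightarrow> a" by (rule lim[OF a]) (rule that)
    obtain q where q: "\<And>k. q k \<in> polys" "q \<longlonglongrightarrow> b" by (rule lim[OF b]) (rule that)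
    show "a o\<^sub>L b \<in> closure polys"
      by (rule cl[OF _ bounded_bilinear.tendsto[OF bounded_bilinear_blinfun_compose p(2) q(2)]])
        (intro polys_mult p q)
  qed
  moreover have "upi f \<in> closure polys" if "f \<in> C0" for f
    using homog_polys[OF homog_pi[OF that]] closure_subset by blast
  moreover have "ut f \<in> closure polys" if f: "f \<in> C0" for f
    unfolding closure_approachable
  proof (intro allI impI)
    fix e :: real assume e: "0 < e"
    obtain h where h: "h \<in> C0" "\<And>x. cmod (f x - f x * h x) \<le> e / 2"
      using C0_approx_unit[OF f, of "e / 2"] e by auto
    have "ut f = ut (\<lambda>x. (f x - f x * h x) + f x * h x)" by simp
    also have "\<dots> = ut (\<lambda>x. f x - f x * h x) + (ut f o\<^sub>L upi h)"
      unfolding ut_upi[OF f h(1)] by (intro ut_add C0_diff C0_mult f h)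
    finally have eq: "ut f - (ut f o\<^sub>L upi h) = ut (\<lambda>x. f x - f x * h x)"
      by (rule iffD2[OF diff_eq_eq])
    have "norm (ut f - (ut f o\<^sub>L upi h)) \<le> e / 2"
      unfolding eq
      by (rule toeplitz_rep_norm_le[OF rep]) (use f h e in \<open>auto intro: C0_diff C0_mult\<close>)
    moreover have "ut f o\<^sub>L upi h \<in> polys"
      using homog_t[OF f homog_pi[OF h(1)]] by (rule homog_polys)
    ultimately show "\<exists>y\<in>polys. dist y (ut f) < e"
      using e by (intro bexI[of _ "ut f o\<^sub>L upi h"]) (auto simp: dist_norm norm_minus_commute)
  qed
  ultimately show "alg \<subseteq> closure polys"
    unfolding semicrossed_product_def by (intro hull_minimal) auto
  show "closure polys \<subseteq> alg"
    by (rule closure_minimal[OF _ alg_closed]) (use polys_alg in blast)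
qed

lemma alg_induct [consumes 1, case_names closed homog add]:
  assumes "a \<in> alg" "closed {x. Q x}" "\<And>n f a. homog \<sigma> n f a \<Longrightarrow> Q a"
    "\<And>a b. a \<in> polys \<Longrightarrow> b \<in> polys \<Longrightarrow> Q a \<Longrightarrow> Q b \<Longrightarrow> Q (a + b)"
  shows "Q a"
proof -
  have "Q x" if "x \<in> polys" for x
    using that by (induction rule: polys_induct) (auto intro: assms(3,4))
  then have "polys \<subseteq> {x. Q x}" by blast
  then have "closure polys \<subseteq> {x. Q x}"
    by (rule closure_minimal[OF _ assms(2)])
  then show ?thesis using assms(1) by (auto simp: alg_eq_closure)
qed

lemma alg_linear: "a \<in> alg \<Longrightarrow> complex_linear_op a"
proof (induction rule: alg_induct)
  case closed
  have "closed (\<Inter>c. \<Inter>h. {a :: 'a univ_op. a (cscale c h) = cscale c (a h)})"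
    by (intro closed_INT ballI closed_Collect_eq continuous_intros
        bounded_linear.continuous_on[OF bounded_linear_cscale])
  then show ?case by (simp add: complex_linear_op_def INTER_eq)
next
  case (add a b)
  then show ?case by (intro complex_linear_op_add)
qed (rule homog_linear)

section \<open>Fourier coefficients\<close>

definition orb :: "'a \<Rightarrow> 'a rep_index" where
  "orb x = (orb_pi \<sigma> x, orb_t \<sigma> x)"

text \<open>The value at \<open>x\<close> of the \<open>n\<close>-th Fourier coefficient, written as
  an entry of the orbit representation: V^n f sends basis vector 0 to f(x) times basis vector
  \<open>n\<close>. Being an entry, it is bounded by the norm.\<close>

definition coef :: "nat \<Rightarrow> 'a \<Rightarrow> 'a univ_op \<Rightarrow> complex" where
  "coef n x T = ell2_nth (T (ket (orb x, cidx 0))) (orb x, cidx n)"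

lemma coef_add: "coef n x (S + T) = coef n x S + coef n x T"
  by (simp add: coef_def plus_blinfun.rep_eq)

lemma coef_sum: "coef n x (\<Sum>i\<in>I. T i) = (\<Sum>i\<in>I. coef n x (T i))"
  by (induction I rule: infinite_finite_induct) (simp_all add: coef_add, simp_all add: coef_def)

lemma coef_diff: "coef n x (S - T) = coef n x S - coef n x T"
  by (simp add: coef_def minus_blinfun.rep_eq)

lemma coef_scale: "coef n x (op_scale c T) = c * coef n x T"
  by (simp add: coef_def)

lemma norm_coef_le: "cmod (coef n x T) \<le> norm T"
  unfolding coef_def using norm_blinfun[of T "ket (orb x, cidx 0)"]
  by (intro order_trans[OF norm_nth_le]) simp

lemma coef_homog:
  assumes "homog \<sigma> n f a"
  shows "coef m x a = (if m = n then f x else 0)"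
proof -
  have "slice (orb x) (a (ket (orb x, cidx 0))) = cscale (f x) (ket (cidx n))"
    using assms
  proof (induction rule: homog.induct)
    case (homog_pi f)
    then show ?case
      using toeplitz_rep_orb[OF cont, of x] orb_pi_ket[of f \<sigma> x 0]
      by (simp add: slice_univ orb_def slice_ket)
  next
    case (homog_t \<xi> n f a)
    have "slice (orb x) (ut \<xi> (a (ket (orb x, cidx 0)))) = orb_t \<sigma> x \<xi> (cscale (f x) (ket (cidx n)))"
      using toeplitz_rep_orb[OF cont, of x] homog_t by (simp add: slice_univ orb_def)
    also have "\<dots> = cscale (f x) (orb_t \<sigma> x \<xi> (ket (cidx n)))"
      using toeplitz_rep_orb[OF cont, of x] homog_t by (simp add: toeplitz_rep_def complex_linear_op_def)
    finally show ?case
      by (simp add: orb_t_ket homog_t) (rule ell2_eqI, simp)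
  next
    case (homog_add n f a g b)
    then show ?case by (intro ell2_eqI) (simp add: plus_blinfun.rep_eq)
  qed
  then have "ell2_nth (slice (orb x) (a (ket (orb x, cidx 0)))) (cidx m) = f x * (if m = n then 1 else 0)"
    by simp
  then show ?thesis by (simp add: coef_def)
qed

text \<open>The bound \<open>norm_coef_le\<close> is uniform in \<open>x\<close>, so norm limits of
  elements give uniform limits of coefficients.\<close>

lemma coef_continuous:
  assumes "a \<in> alg"
  shows "continuous_on UNIV (\<lambda>x. coef n x a)"
  using assms
proof (induction rule: alg_induct)
  case closed
  show ?case
    unfolding closed_sequential_limits
  proof (intro allI impI CollectI)
    fix s l assume s: "(\<forall>k. s k \<in> {a. continuous_on UNIV (\<lambda>x. coef n x a)}) \<and> s \<longlonglongrightarrow> l"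
    have "uniform_limit UNIV (\<lambda>k x. coef n x (s k)) (\<lambda>x. coef n x l) sequentially"
    proof (rule uniform_limitI)
      fix e :: real assume "0 < e"
      then have "\<forall>\<^sub>F k in sequentially. dist (s k) l < e" using s by (auto dest: tendstoD)
      then show "\<forall>\<^sub>F k in sequentially. \<forall>x\<in>UNIV. dist (coef n x (s k)) (coef n x l) < e"
        by eventually_elim
          (auto simp: dist_norm simp flip: coef_diff intro: order_le_less_trans[OF norm_coef_le])
    qed
    then show "continuous_on UNIV (\<lambda>x. coef n x l)"
      by (rule uniform_limit_theorem[rotated]) (use s in auto)
  qed
next
  case (homog m f a)
  then show ?case
    using C0_continuous[OF homog_C0[OF homog]] by (cases "n = m") (simp_all add: coef_homog[OF homog])
next
  case (add a b)
  then show ?case by (simp add: coef_add continuous_on_add)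
qed

text \<open>Gauge invariance bounds the polynomial in \<open>z\<close> on the unit circle, and the maximum modulus
  principle carries the bound over to the disc.\<close>

lemma norm_dilate_le:
  assumes a: "\<And>n. homog \<sigma> n (f n) (a n)" and z: "cmod z \<le> 1"
  shows "norm (\<Sum>n<K. op_scale (z ^ n) (a n)) \<le> norm (\<Sum>n<K. a n)"
proof (rule norm_blinfun_bound)
  let ?p = "\<Sum>n<K. a n" and ?D = "\<lambda>z. \<Sum>n<K. op_scale (z ^ n) (a n)"
  have circle: "norm (?D w h) \<le> norm ?p * norm h" if w: "cmod w = 1" for w h
  proof -
    \<comment> \<open>Writing \<open>h\<close> as \<open>gauge_u w h'\<close> trades all the scalars
      w^n for a single outer contraction.\<close>
    define h' where "h' = gauge_u (1 / w) h"
    have w': "cmod (1 / w) = 1" using w by (simp add: norm_divide)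
    have "?D w (gauge_u w h') = gauge_u w (?p h')"
      by (simp add: blinfun.sum_left blinfun.sum_right gauge_u_homog[OF cont a w])
    moreover have "gauge_u w h' = h" unfolding h'_def by (rule gauge_u_inverse[OF w])
    ultimately have "norm (?D w h) = norm (gauge_u w (?p h'))" by simp
    also have "\<dots> \<le> norm (?p h')"
      using norm_blinfun[of "gauge_u w" "?p h'"] norm_gauge_u[OF w, where ?'a = 'a]
      by (meson mult_left_le_one_le norm_ge_zero order_trans)
    also have "\<dots> \<le> norm ?p * norm h'" by (rule norm_blinfun)
    also have "\<dots> \<le> norm ?p * norm h"
      using norm_blinfun[of "gauge_u (1 / w)" h] norm_gauge_u[OF w', where ?'a = 'a] unfolding h'_def
      by (intro mult_left_mono) (meson mult_left_le_one_le norm_ge_zero order_trans, simp)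
    finally show ?thesis .
  qed
  fix h
  let ?k = "?D z h"
  \<comment> \<open>Pairing with \<open>?k\<close> itself makes the value of this polynomial at
    \<open>z\<close> equal to \<open>(norm ?k)\<^sup>2\<close>.\<close>
  let ?G = "\<lambda>w. \<Sum>n<K. w ^ n * cinner ?k (a n h)"
  have sum_right: "cinner k (\<Sum>n<L. v n) = (\<Sum>n<L. cinner k (v n))"
    for k :: "('a rep_index \<times> ('a \<Rightarrow> complex)) ell2" and v and L :: nat
    by (induction L) (simp_all add: cinner_add_right)
  have G: "?G w = cinner ?k (?D w h)" for w
    by (simp add: blinfun.sum_left sum_right cinner_cscale_right)
  have "cmod (?G z) \<le> norm ?k * (norm ?p * norm h)"
  proof (rule maximum_modulus_frontier[of ?G "cball 0 1"])
    show "cmod (?G w) \<le> norm ?k * (norm ?p * norm h)" if "w \<in> frontier (cball 0 1)" for w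
      unfolding G using that
      by (intro order_trans[OF norm_cinner_le] mult_left_mono circle) (simp_all add: sphere_def)
  qed (use z in \<open>auto intro!: holomorphic_intros continuous_intros\<close>)
  then have "norm ?k * norm ?k \<le> norm ?k * (norm ?p * norm h)"
    unfolding G cinner_self_norm norm_of_real by (simp add: power2_eq_square)
  then show "norm (?D z h) \<le> norm ?p * norm h"
    by (cases "norm ?k = 0") (simp_all add: mult_le_cancel_left_pos)
qed simp

text \<open>Abel summation. Let D_r multiply the part of degree n by r^n. For p close to a and r
  close to 1, D_r p is close to a. A second approximation q has tiny coefficients because those of a
  vanish, so D_r q has norm at most e, while D_r (p - q) is bounded by the norm of p - q. The errors
  e, e, 2e and e add up to 5e.\<close>

lemma coef_zero_imp_zero:
  assumes a: "a \<in> alg" and coef: "\<And>n x. coef n x a = 0"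
  shows "a = 0"
proof -
  have "norm a \<le> 5 * e" if e: "0 < e" for e
  proof -
    obtain p where p: "p \<in> polys" "dist p a < e"
      using a e unfolding alg_eq_closure closure_approachable by blast
    obtain K f b where fb: "\<And>n. homog \<sigma> n (f n) (b n)" "\<And>L. K \<le> L \<Longrightarrow> p = (\<Sum>n<L. b n)"
      by (rule polysE[OF p(1)]) (rule that)
    let ?D = "\<lambda>L b r. \<Sum>n<L. op_scale (complex_of_real r ^ n) (b n)"
    have D: "(\<lambda>r. ?D K b r) = (\<lambda>r. \<Sum>n<K. (r ^ n) *\<^sub>R b n)"
      by (simp add: op_scale_of_real flip: of_real_power)
    have "((\<lambda>r. ?D K b r) \<longlongrightarrow> (\<Sum>n<K. (1 ^ n) *\<^sub>R b n)) (at_left 1)"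
      unfolding D by (intro tendsto_intros)
    then have "((\<lambda>r. ?D K b r) \<longlongrightarrow> p) (at_left 1)"
      using fb(2)[of K] by simp
    then have "\<forall>\<^sub>F r in at_left 1. dist (?D K b r) p < e"
      using e by (rule tendstoD)
    moreover have "\<forall>\<^sub>F r::real in at_left 1. 0 < r \<and> r < 1"
      using eventually_at_left_real[of 0 1] by auto
    ultimately obtain r where r: "0 < r" "r < 1" "dist (?D K b r) p < e"
      using eventually_happens[OF eventually_conj] by (metis (mono_tags, lifting) trivial_limit_at_left_real)
    \<comment> \<open>The number \<open>r\<close> is fixed before \<open>q\<close> is chosen; the
      factor 1 - r in the tolerance cancels the geometric sum of the r^n.\<close>
    have "0 < e * (1 - r)" using e r by simp
    then obtain q where q: "q \<in> polys" "dist q a < min e (e * (1 - r))"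
      using a e unfolding alg_eq_closure closure_approachable
      by (metis min_less_iff_conj)
    obtain K' g c where gc: "\<And>n. homog \<sigma> n (g n) (c n)" "\<And>L. K' \<le> L \<Longrightarrow> q = (\<Sum>n<L. c n)"
      by (rule polysE[OF q(1)]) (rule that)
    define L where "L = max K K'"
    have pq: "p - q = (\<Sum>n<L. b n - c n)"
      using fb(2)[of L] gc(2)[of L] by (simp add: L_def sum_subtractf)
    have "norm (?D L (\<lambda>n. b n - c n) r) \<le> norm (p - q)"
      unfolding pq by (rule norm_dilate_le[OF homog_diff[OF fb(1) gc(1)]]) (use r in auto)
    also have "\<dots> \<le> 2 * e"
      using p(2) q(2) dist_triangle2[of p q a] by (simp add: dist_norm)
    finally have 1: "norm (?D L (\<lambda>n. b n - c n) r) \<le> 2 * e" .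
    have c: "norm (c n) \<le> e * (1 - r)" if "n < L" for n
    proof (rule homog_norm_le[OF gc(1)])
      fix x
      have "coef n x q = (\<Sum>m<L. coef n x (c m))"
        using gc(2)[of L] by (simp add: L_def coef_sum)
      also have "\<dots> = g n x"
        using that by (simp add: coef_homog[OF gc(1)])
      finally have "g n x = coef n x (q - a)" using coef by (simp add: coef_diff)
      then show "cmod (g n x) \<le> e * (1 - r)"
        using norm_coef_le[of n x "q - a"] q(2) by (simp add: dist_norm)
    qed (use \<open>0 < e * (1 - r)\<close> in simp)
    have "norm (?D L c r) \<le> (\<Sum>n<L. r ^ n * (e * (1 - r)))"
    proof (rule sum_norm_le)
      fix n assume "n \<in> {..<L}"
      then show "norm (op_scale (complex_of_real r ^ n) (c n)) \<le> r ^ n * (e * (1 - r))"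
        using norm_op_scale_le[of "complex_of_real r ^ n" "c n"] c[of n] r
        by (intro order_trans[OF norm_op_scale_le] mult_mono) (auto simp: norm_power)
    qed
    also have "\<dots> = e * ((1 - r) * (\<Sum>n<L. r ^ n))"
      by (simp add: sum_distrib_left sum_distrib_right mult_ac)
    also have "\<dots> = e * (1 - r ^ L)"
      using r by (simp add: one_diff_power_eq)
    also have "\<dots> \<le> e" using e r by simp
    finally have 2: "norm (?D L c r) \<le> e" .
    have DL: "?D L b r = ?D L (\<lambda>n. b n - c n) r + ?D L c r"
      by (simp flip: op_scale_add sum.distrib)
    have "b n = 0" if "K \<le> n" for n
      using fb(2)[of n] fb(2)[of "Suc n"] that by simp
    then have "?D L b r = ?D K b r"
      by (intro sum.mono_neutral_right) (auto simp: L_def)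
    then have 3: "norm (?D L b r - p) < e"
      using r(3) by (simp add: dist_norm)
    have eq: "(a - p) - (?D L b r - p) + ?D L (\<lambda>n. b n - c n) r + ?D L c r = a"
      unfolding DL by simp
    have tri: "norm (u - v + w + y) \<le> norm u + norm v + norm w + norm y" for u v w y :: "'a univ_op"
      using norm_triangle_ineq[of "u - v + w" y] norm_triangle_ineq[of "u - v" w]
        norm_triangle_ineq4[of u v] by linarith
    moreover have "norm a \<le> norm (a - p) + norm (?D L b r - p) + norm (?D L (\<lambda>n. b n - c n) r) + norm (?D L c r)"
      using tri[of "a - p" "?D L b r - p" "?D L (\<lambda>n. b n - c n) r" "?D L c r"] unfolding eq .
    moreover have "norm (a - p) < e"
      using p(2) by (simp add: dist_norm norm_minus_commute)
    ultimately show ?thesis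
      using 1 2 3 by linarith
  qed
  from this[of "e / 5" for e] have "norm a \<le> 0 + e" if "0 < e" for e
    using that by simp
  then have "norm a \<le> 0" by (rule field_le_epsilon)
  then show ?thesis by simp
qed

end

section \<open>Zero-product preserving maps on incidence algebras\<close>

definition unit_mat :: "'i \<Rightarrow> 'i \<Rightarrow> 'i \<Rightarrow> 'i \<Rightarrow> complex" where
  "unit_mat i j = (\<lambda>k l. if k = i \<and> l = j then 1 else 0)"

definition id_mat :: "'i set \<Rightarrow> 'i \<Rightarrow> 'i \<Rightarrow> complex" where
  "id_mat I = (\<lambda>k l. if k = l \<and> k \<in> I then 1 else 0)"

definition mat_mult :: "'i set \<Rightarrow> ('i \<Rightarrow> 'i \<Rightarrow> complex) \<Rightarrow> ('i \<Rightarrow> 'i \<Rightarrow> complex) \<Rightarrow> 'i \<Rightarrow> 'i \<Rightarrow> complex" where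
  "mat_mult I A B = (\<lambda>i j. \<Sum>k\<in>I. A i k * B k j)"

definition incidence :: "('i \<times> 'i) set \<Rightarrow> ('i \<Rightarrow> 'i \<Rightarrow> complex) set" where
  "incidence R = {M. \<forall>i j. M i j \<noteq> 0 \<longrightarrow> (i, j) \<in> R}"

(* zero_prod is X T(U) Y = 0 whenever X U = U Y = 0, for the elementary X = E_ii - s E_ij and
   Y = E_ll - t E_kl. *)
locale zero_product_map =
  fixes I :: "'i set" and R :: "('i \<times> 'i) set"
    and T :: "('i \<Rightarrow> 'i \<Rightarrow> complex) \<Rightarrow> 'i \<Rightarrow> 'i \<Rightarrow> complex"
  assumes finite_I: "finite I" and R_subset: "R \<subseteq> I \<times> I"
    and R_refl: "i \<in> I \<Longrightarrow> (i, i) \<in> R" and R_trans: "trans R"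
    and T_add: "A \<in> incidence R \<Longrightarrow> B \<in> incidence R \<Longrightarrow>
      i \<in> I \<Longrightarrow> j \<in> I \<Longrightarrow> T (\<lambda>i j. A i j + B i j) i j = T A i j + T B i j"
    and T_scale: "A \<in> incidence R \<Longrightarrow> i \<in> I \<Longrightarrow> j \<in> I \<Longrightarrow> T (\<lambda>i j. c * A i j) i j = c * T A i j"
    and T_id: "i \<in> I \<Longrightarrow> j \<in> I \<Longrightarrow> T (id_mat I) i j = 0"
    and zero_prod: "U \<in> incidence R \<Longrightarrow> (i, j) \<in> R \<Longrightarrow> (k, l) \<in> R \<Longrightarrow>
      (\<And>c. c \<in> I \<Longrightarrow> U i c = s * U j c) \<Longrightarrow> (\<And>r. r \<in> I \<Longrightarrow> U r l = t * U r k) \<Longrightarrow>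
      T U i l - s * T U j l - t * T U i k + s * t * T U j k = 0"
begin

lemma incidence_add: "A \<in> incidence R \<Longrightarrow> B \<in> incidence R \<Longrightarrow> (\<lambda>i j. A i j + B i j) \<in> incidence R"
  unfolding incidence_def by (simp, metis add_0)

lemma incidence_scale: "A \<in> incidence R \<Longrightarrow> (\<lambda>i j. c * A i j) \<in> incidence R"
  unfolding incidence_def by simp

lemma incidence_unit: "(i, j) \<in> R \<Longrightarrow> unit_mat i j \<in> incidence R"
  by (simp add: incidence_def unit_mat_def)

lemma incidence_id: "id_mat I \<in> incidence R"
  using R_refl by (simp add: incidence_def id_mat_def)

lemma incidence_mult:
  assumes "A \<in> incidence R" "B \<in> incidence R"
  shows "mat_mult I A B \<in> incidence R"
  unfolding incidence_def
proof (intro CollectI allI impI)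
  fix i j assume "mat_mult I A B i j \<noteq> 0"
  then obtain k where "A i k * B k j \<noteq> 0"
    unfolding mat_mult_def by (meson sum.neutral)
  then have "(i, k) \<in> R" "(k, j) \<in> R"
    using assms by (auto simp: incidence_def)
  then show "(i, j) \<in> R" by (rule transD[OF R_trans])
qed

text \<open>Column \<open>l\<close> is the off-diagonal part of column \<open>l\<close> of T(E_ll).
  The commutator with this matrix reproduces those entries, so subtracting it makes
  \<open>reduced\<close> vanish on the diagonal matrix units.\<close>

definition inner_mat :: "'i \<Rightarrow> 'i \<Rightarrow> complex" where
  "inner_mat k l = (if k = l then 0 else T (unit_mat l l) k l)"

definition inner_der :: "('i \<Rightarrow> 'i \<Rightarrow> complex) \<Rightarrow> 'i \<Rightarrow> 'i \<Rightarrow> complex" where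
  "inner_der M = (\<lambda>k l. mat_mult I inner_mat M k l - mat_mult I M inner_mat k l)"

definition reduced :: "('i \<Rightarrow> 'i \<Rightarrow> complex) \<Rightarrow> 'i \<Rightarrow> 'i \<Rightarrow> complex" where
  "reduced M = (\<lambda>k l. T M k l - inner_der M k l)"

lemma inner_der_add: "inner_der (\<lambda>i j. A i j + B i j) i j = inner_der A i j + inner_der B i j"
  by (simp add: inner_der_def mat_mult_def distrib_left distrib_right sum.distrib)

lemma inner_der_scale: "inner_der (\<lambda>i j. c * A i j) i j = c * inner_der A i j"
  by (simp add: inner_der_def mat_mult_def sum_distrib_left right_diff_distrib mult_ac)

lemma reduced_add: "A \<in> incidence R \<Longrightarrow> B \<in> incidence R \<Longrightarrow>
    i \<in> I \<Longrightarrow> j \<in> I \<Longrightarrow> reduced (\<lambda>i j. A i j + B i j) i j = reduced A i j + reduced B i j"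
  by (simp add: reduced_def T_add inner_der_add)

lemma reduced_scale: "A \<in> incidence R \<Longrightarrow> i \<in> I \<Longrightarrow> j \<in> I \<Longrightarrow> reduced (\<lambda>i j. c * A i j) i j = c * reduced A i j"
  by (simp add: reduced_def T_scale inner_der_scale right_diff_distrib)

lemma inner_der_unit:
  "i \<in> I \<Longrightarrow> j \<in> I \<Longrightarrow> inner_der (unit_mat i j) k l = (if l = j then inner_mat k i else 0) - (if k = i then inner_mat j l else 0)"
proof -
  assume i: "i \<in> I" and j: "j \<in> I"
  have "(\<Sum>r\<in>I. inner_mat k r * unit_mat i j r l) = (\<Sum>r\<in>I. if r = i then (if l = j then inner_mat k i else 0) else 0)"
    by (rule sum.cong) (auto simp: unit_mat_def)
  moreover have "(\<Sum>r\<in>I. unit_mat i j k r * inner_mat r l) = (\<Sum>r\<in>I. if r = j then (if k = i then inner_mat j l else 0) else 0)"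
    by (rule sum.cong) (auto simp: unit_mat_def)
  ultimately show ?thesis
    using i j finite_I by (simp add: inner_der_def mat_mult_def)
qed

text \<open>A commutator N U - U N satisfies X (N U - U N) Y = 0 whenever X U = U Y = 0, so
  subtracting one preserves the zero-product condition.\<close>

lemma reduced_zero_prod:
  assumes U: "U \<in> incidence R" and ij: "(i, j) \<in> R" and kl: "(k, l) \<in> R"
    and row: "\<And>c. c \<in> I \<Longrightarrow> U i c = s * U j c" and col: "\<And>r. r \<in> I \<Longrightarrow> U r l = t * U r k"
  shows "reduced U i l - s * reduced U j l - t * reduced U i k + s * t * reduced U j k = 0"
proof -
  have "mat_mult I inner_mat U p l = t * mat_mult I inner_mat U p k" for p
    unfolding mat_mult_def sum_distrib_left by (rule sum.cong) (simp_all add: col)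
  moreover have "mat_mult I U inner_mat i q = s * mat_mult I U inner_mat j q" for q
    unfolding mat_mult_def sum_distrib_left by (rule sum.cong) (simp_all add: row)
  ultimately have "inner_der U i l - s * inner_der U j l - t * inner_der U i k + s * t * inner_der U j k = 0"
    unfolding inner_der_def by (simp add: algebra_simps)
  with zero_prod[OF assms] show ?thesis
    unfolding reduced_def by (simp add: algebra_simps)
qed

lemma T_zero_entry:
  assumes "U \<in> incidence R" "i \<in> I" "l \<in> I" "\<And>c. c \<in> I \<Longrightarrow> U i c = 0" "\<And>r. r \<in> I \<Longrightarrow> U r l = 0"
  shows "T U i l = 0"
  using zero_prod[OF assms(1) R_refl R_refl, of i l 0 0] assms by simp

lemma reduced_unit_diag:
  assumes "i \<in> I" "k \<in> I" "l \<in> I"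
  shows "reduced (unit_mat i i) k l = 0"
proof -
  note inc = incidence_unit[OF R_refl] incidence_scale[OF incidence_id, of "-1"]
  consider "k \<noteq> i" "l \<noteq> i" | "k \<noteq> i" "l = i" | "k = i" "l \<noteq> i" | "k = i" "l = i" by blast
  then show ?thesis
  proof cases
    case 1
    then have "T (unit_mat i i) k l = 0"
      by (intro T_zero_entry) (use assms inc in \<open>auto simp: unit_mat_def\<close>)
    with 1 show ?thesis by (simp add: reduced_def inner_der_unit assms)
  next
    case 2
    then show ?thesis by (simp add: reduced_def inner_der_unit assms inner_mat_def)
  next
    case 3
    \<comment> \<open>Row \<open>i\<close> and column \<open>l\<close> of E_ii + E_ll - 1 are zero.
      With T 1 = 0 this gives T(E_ii) = - T(E_ll) at the entry (i, l), where the right side is an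
      entry of \<open>inner_mat\<close> up to sign.\<close>
    let ?U = "\<lambda>a b. unit_mat i i a b + (unit_mat l l a b + - 1 * id_mat I a b)"
    have inc': "(\<lambda>a b. unit_mat l l a b + - 1 * id_mat I a b) \<in> incidence R"
      by (intro incidence_add inc assms)
    have "T ?U i l = 0"
      by (intro T_zero_entry incidence_add inc' inc assms)
        (use 3 assms in \<open>auto simp: unit_mat_def id_mat_def\<close>)
    then have "T (unit_mat i i) i l = - T (unit_mat l l) i l"
      using T_add[OF inc(1)[OF assms(1)] inc', of i l] T_add[OF inc(1)[OF assms(3)] inc(2), of i l]
        T_scale[OF incidence_id, of i l "-1"] assms 3
      by (simp add: T_id eq_neg_iff_add_eq_0)
    with 3 show ?thesis by (simp add: reduced_def inner_der_unit assms inner_mat_def)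
  next
    case 4
    let ?U = "\<lambda>a b. unit_mat i i a b + - 1 * id_mat I a b"
    have "T ?U i i = 0"
      by (intro T_zero_entry incidence_add inc assms)
        (use assms in \<open>auto simp: unit_mat_def id_mat_def\<close>)
    then show ?thesis
      using T_add[OF inc(1)[OF assms(1)] inc(2), of i i] T_scale[OF incidence_id, of i i "-1"] assms 4
      by (simp add: T_id reduced_def inner_der_unit)
  qed
qed

text \<open>Outside row \<open>i\<close> and column \<open>j\<close> the entry is killed directly.
  In column \<open>j\<close> one uses E_ii + E_ij, whose columns i and j agree: the entry equals one
  in column i, already known to be zero. Row \<open>i\<close> is dual, with E_jj + E_ij.\<close>

lemma reduced_unit_off:
  assumes ij: "(i, j) \<in> R" "i \<noteq> j" and kl: "k \<in> I" "l \<in> I" "\<not> (k = i \<and> l = j)"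
  shows "reduced (unit_mat i j) k l = 0"
proof -
  have I: "i \<in> I" "j \<in> I" using ij R_subset by auto
  note inc = incidence_unit[OF ij(1)] incidence_unit[OF R_refl]
  have 1: "reduced (unit_mat i j) k l = 0" if "k \<noteq> i" "l \<noteq> j" "k \<in> I" "l \<in> I" for k l
    using reduced_zero_prod[OF inc(1) R_refl R_refl, of k l 0 0] that by (auto simp: unit_mat_def)
  consider "k \<noteq> i" "l \<noteq> j" | "k \<noteq> i" "l = j" | "k = i" "l \<noteq> j" using kl by blast
  then show ?thesis
  proof cases
    case 2
    let ?U = "\<lambda>a b. unit_mat i i a b + unit_mat i j a b"
    have U: "?U \<in> incidence R" by (intro incidence_add inc I)
    have "reduced ?U k j - 0 * reduced ?U k j - 1 * reduced ?U k i + 0 * 1 * reduced ?U k i = 0"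
      by (rule reduced_zero_prod[OF U R_refl[OF kl(1)] ij(1)]) (use 2 ij in \<open>auto simp: unit_mat_def\<close>)
    then show ?thesis
      using 2 ij kl I 1[of k i] by (simp add: reduced_add inc reduced_unit_diag)
  next
    case 3
    let ?U = "\<lambda>a b. unit_mat j j a b + unit_mat i j a b"
    have U: "?U \<in> incidence R" by (intro incidence_add inc I)
    have "reduced ?U i l - 1 * reduced ?U j l - 0 * reduced ?U i l + 1 * 0 * reduced ?U j l = 0"
      by (rule reduced_zero_prod[OF U ij(1) R_refl[OF kl(2)]]) (use 3 ij in \<open>auto simp: unit_mat_def\<close>)
    then show ?thesis
      using 3 ij kl I 1[of j l] by (simp add: reduced_add inc reduced_unit_diag)
  qed (use 1 kl in blast)
qed

definition scaling :: "'i \<Rightarrow> 'i \<Rightarrow> complex" where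
  "scaling i j = reduced (unit_mat i j) i j"

lemma reduced_unit:
  assumes "(i, j) \<in> R" "k \<in> I" "l \<in> I"
  shows "reduced (unit_mat i j) k l = (if k = i \<and> l = j then scaling i j else 0)"
  using assms R_subset reduced_unit_diag[of i k l] reduced_unit_off[of i j k l]
  by (cases "i = j") (auto simp: scaling_def)

text \<open>The matrix E_ij + E_ik + E_jj + E_jk has equal rows i, j and equal columns j, k. The
  zero-product condition with s = t = 1 therefore relates the four entries of its image, of which
  the one at (j, j) is zero.\<close>

lemma scaling_cocycle:
  assumes ij: "(i, j) \<in> R" and jk: "(j, k) \<in> R"
  shows "scaling i k = scaling i j + scaling j k"
proof -
  have I: "i \<in> I" "j \<in> I" "k \<in> I" using ij jk R_subset by auto
  have diag: "scaling a a = 0" if "a \<in> I" for a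
    using that by (simp add: scaling_def reduced_unit_diag)
  consider "i = j" | "j = k" | "i \<noteq> j" "j \<noteq> k" by blast
  then show ?thesis
  proof cases
    case 3
    have ik: "(i, k) \<in> R" by (rule transD[OF R_trans ij jk])
    note inc = incidence_unit[OF ij] incidence_unit[OF jk] incidence_unit[OF ik] incidence_unit[OF R_refl[OF I(2)]]
    let ?U1 = "\<lambda>a b. unit_mat i k a b + unit_mat j j a b"
    let ?U2 = "\<lambda>a b. unit_mat j k a b + (unit_mat i k a b + unit_mat j j a b)"
    let ?U = "\<lambda>a b. unit_mat i j a b + (unit_mat j k a b + (unit_mat i k a b + unit_mat j j a b))"
    have U1: "?U1 \<in> incidence R" by (intro incidence_add inc)
    have U2: "?U2 \<in> incidence R" by (intro incidence_add inc)
    have U: "?U \<in> incidence R" by (intro incidence_add inc)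
    have reduced_U: "reduced ?U a b = reduced (unit_mat i j) a b + (reduced (unit_mat j k) a b + (reduced (unit_mat i k) a b + reduced (unit_mat j j) a b))"
      if "a \<in> I" "b \<in> I" for a b
      using that by (simp add: reduced_add[OF inc(1) U2] reduced_add[OF inc(2) U1] reduced_add[OF inc(3,4)])
    have "reduced ?U i k - 1 * reduced ?U j k - 1 * reduced ?U i j + 1 * 1 * reduced ?U j j = 0"
      by (rule reduced_zero_prod[OF U ij jk]) (use 3 in \<open>auto simp: unit_mat_def\<close>)
    then have "scaling i k - scaling j k - scaling i j = 0"
      unfolding reduced_U[OF I(1,3)] reduced_U[OF I(2,3)] reduced_U[OF I(1,2)] reduced_U[OF I(2,2)]
      using 3 I by (simp add: reduced_unit ij jk ik reduced_unit_diag)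
    then show ?thesis by (simp add: algebra_simps)
  qed (use diag I in auto)
qed

lemma reduced_eq:
  assumes M: "M \<in> incidence R" and ij: "i \<in> I" "j \<in> I"
  shows "reduced M i j = scaling i j * M i j"
proof -
  have zero: "(\<lambda>_ _. 0) \<in> incidence R" by (simp add: incidence_def)
  have "finite R" using R_subset finite_I by (meson finite_SigmaI finite_subset)
  have "reduced (\<lambda>a b. \<Sum>p\<in>F. M (fst p) (snd p) * unit_mat (fst p) (snd p) a b) i j =
      (\<Sum>p\<in>F. M (fst p) (snd p) * (if i = fst p \<and> j = snd p then scaling (fst p) (snd p) else 0)) \<and>
      (\<lambda>a b. \<Sum>p\<in>F. M (fst p) (snd p) * unit_mat (fst p) (snd p) a b) \<in> incidence R"
    if "finite F" "F \<subseteq> R" for F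
    using that
  proof (induction F)
    case empty
    show ?case using reduced_scale[OF zero ij, of 0] zero by simp
  next
    case (insert p F)
    then have p: "(fst p, snd p) \<in> R" by simp
    show ?case
      using insert ij reduced_add[OF incidence_scale[OF incidence_unit[OF p]], of _ i j "M (fst p) (snd p)"]
        incidence_add[OF incidence_scale[OF incidence_unit[OF p]], of _ "M (fst p) (snd p)"]
      by (simp add: reduced_scale incidence_unit p reduced_unit)
  qed
  from this[OF \<open>finite R\<close> order_refl]
  have "reduced (\<lambda>a b. \<Sum>p\<in>R. M (fst p) (snd p) * unit_mat (fst p) (snd p) a b) i j =
      (\<Sum>p\<in>R. if p = (i, j) then scaling i j * M i j else 0)"
    by (simp, intro sum.cong) (auto simp: prod_eq_iff)
  moreover have "(\<Sum>p\<in>R. M (fst p) (snd p) * unit_mat (fst p) (snd p) a b) = M a b" for a b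
  proof -
    have "(\<Sum>p\<in>R. M (fst p) (snd p) * unit_mat (fst p) (snd p) a b) = (\<Sum>p\<in>R. if p = (a, b) then M a b else 0)"
      by (rule sum.cong) (auto simp: unit_mat_def)
    then show ?thesis using M \<open>finite R\<close> by (auto simp: incidence_def)
  qed
  ultimately show ?thesis
    using M \<open>finite R\<close> by (auto simp: incidence_def)
qed

lemma inner_der_mult:
  "inner_der (mat_mult I A B) i j = mat_mult I (inner_der A) B i j + mat_mult I A (inner_der B) i j"
proof -
  have assoc: "mat_mult I (mat_mult I X Y) Z a b = mat_mult I X (mat_mult I Y Z) a b" for X Y Z a b
    unfolding mat_mult_def sum_distrib_left sum_distrib_right
    by (subst sum.swap) (simp add: mult.assoc)
  show ?thesis
    using assoc[of A inner_mat B i j] assoc[of inner_mat A B i j] assoc[of A B inner_mat i j]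
    by (simp add: inner_der_def mat_mult_def left_diff_distrib right_diff_distrib sum_subtractf)
qed

text \<open>By \<open>reduced_eq\<close>, \<open>T\<close> is the entrywise product with
  \<open>scaling\<close> plus a commutator. The first is a derivation because \<open>scaling\<close>
  is additive along composable pairs of \<open>R\<close>, the second always is.\<close>

lemma mat_mult_derivation:
  assumes A: "A \<in> incidence R" and B: "B \<in> incidence R" and ij: "i \<in> I" "j \<in> I"
  shows "T (mat_mult I A B) i j = mat_mult I (T A) B i j + mat_mult I A (T B) i j"
proof -
  have T: "T M a b = scaling a b * M a b + inner_der M a b" if "M \<in> incidence R" "a \<in> I" "b \<in> I" for M a b
    using reduced_eq[OF that] by (simp add: reduced_def diff_eq_eq)
  have "scaling i j * (A i k * B k j) = scaling i k * A i k * B k j + A i k * (scaling k j * B k j)" for k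
  proof (cases "(i, k) \<in> R \<and> (k, j) \<in> R")
    case True
    then show ?thesis using scaling_cocycle[of i k j] by (simp add: algebra_simps)
  next
    case False
    then have "A i k = 0 \<or> B k j = 0" using A B by (auto simp: incidence_def)
    then show ?thesis by auto
  qed
  then have "scaling i j * mat_mult I A B i j =
      (\<Sum>k\<in>I. scaling i k * A i k * B k j) + (\<Sum>k\<in>I. A i k * (scaling k j * B k j))"
    by (simp add: mat_mult_def sum_distrib_left sum.distrib)
  moreover have "mat_mult I (T A) B i j = (\<Sum>k\<in>I. scaling i k * A i k * B k j) + mat_mult I (inner_der A) B i j"
    unfolding mat_mult_def sum.distrib[symmetric]
    by (rule sum.cong) (simp_all add: T A ij distrib_right)
  moreover have "mat_mult I A (T B) i j = (\<Sum>k\<in>I. A i k * (scaling k j * B k j)) + mat_mult I A (inner_der B) i j"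
    unfolding mat_mult_def sum.distrib[symmetric]
    by (rule sum.cong) (simp_all add: T B ij distrib_left)
  ultimately show ?thesis
    by (simp add: T[OF incidence_mult[OF A B] ij] inner_der_mult)
qed

end

section \<open>Finite-dimensional representations along orbits\<close>

context lch_system
begin

text \<open>The weights z^n are multiplicative in the degree, so products stay products. With |z| <
  1 they make the series converge for bounded coefficients, and varying \<open>z\<close> separates
  the degrees that lead to the same point.\<close>

definition mat :: "'a set \<Rightarrow> complex \<Rightarrow> 'a univ_op \<Rightarrow> 'a \<Rightarrow> 'a \<Rightarrow> complex" where
  "mat I z T c b = (if b \<in> I \<and> c \<in> I then \<Sum>n. if (\<sigma> ^^ n) b = c then coef n b T * z ^ n else 0 else 0)"

lemma
  assumes z: "cmod z < 1"
  shows mat_summable: "summable (\<lambda>n. if (\<sigma> ^^ n) b = c then coef n b T * z ^ n else 0)"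
    and norm_mat_le: "cmod (mat I z T c b) \<le> norm T * (1 / (1 - cmod z))"
proof -
  let ?s = "\<lambda>n. if (\<sigma> ^^ n) b = c then coef n b T * z ^ n else 0"
  have g: "summable (\<lambda>n. norm T * cmod z ^ n)"
    using z by (intro summable_mult summable_geometric) simp
  have le: "norm (?s n) \<le> norm T * cmod z ^ n" for n
    using norm_coef_le[of n b T] by (auto simp: norm_mult norm_power intro!: mult_right_mono)
  show "summable ?s"
    by (rule summable_comparison_test'[OF g, of 0]) (rule le)
  have "norm (suminf ?s) \<le> (\<Sum>n. norm T * cmod z ^ n)"
    by (rule norm_suminf_le[OF le g])
  also have "\<dots> = norm T * (1 / (1 - cmod z))"
    using z by (subst suminf_mult) (auto intro!: summable_geometric simp: suminf_geometric)
  finally show "cmod (mat I z T c b) \<le> norm T * (1 / (1 - cmod z))"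
    using z by (auto simp: mat_def)
qed

lemma mat_outside: "c \<notin> I \<or> b \<notin> I \<Longrightarrow> mat I z T c b = 0"
  by (auto simp: mat_def)

lemma mat_add:
  assumes "cmod z < 1"
  shows "mat I z (S + T) c b = mat I z S c b + mat I z T c b"
  using suminf_add[OF mat_summable[OF assms, of b c S] mat_summable[OF assms, of b c T]]
  by (auto simp: mat_def coef_add distrib_right intro!: arg_cong[where f = suminf])

lemma mat_scale:
  assumes "cmod z < 1"
  shows "mat I z (op_scale k T) c b = k * mat I z T c b"
proof -
  have "(\<Sum>n. if (\<sigma> ^^ n) b = c then coef n b (op_scale k T) * z ^ n else 0) =
      (\<Sum>n. k * (if (\<sigma> ^^ n) b = c then coef n b T * z ^ n else 0))"
    by (rule arg_cong[where f = suminf]) (auto simp: coef_scale mult.assoc)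
  then show ?thesis
    using suminf_mult[OF mat_summable[OF assms, of b c T], of k] by (auto simp: mat_def)
qed

lemma bounded_linear_mat:
  assumes z: "cmod z < 1"
  shows "bounded_linear (\<lambda>T. mat I z T c b)"
proof (rule bounded_linear_intro)
  show "mat I z (r *\<^sub>R T) c b = r *\<^sub>R mat I z T c b" for r T
    unfolding op_scale_of_real[symmetric] mat_scale[OF z] by (simp add: scaleR_conv_of_real)
qed (rule mat_add[OF z] norm_mat_le[OF z])+

lemma mat_homog:
  assumes "homog \<sigma> n f a"
  shows "mat I z a c b = (if b \<in> I \<and> c \<in> I \<and> (\<sigma> ^^ n) b = c then f b * z ^ n else 0)"
proof -
  have "(\<Sum>m. if (\<sigma> ^^ m) b = c then coef m b a * z ^ m else 0) =
      (\<Sum>m\<in>{n}. if (\<sigma> ^^ m) b = c then coef m b a * z ^ m else 0)"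
    by (rule suminf_finite) (auto simp: coef_homog[OF assms])
  then show ?thesis by (simp add: mat_def coef_homog[OF assms])
qed

end

text \<open>The assumption \<open>path_convex\<close> makes the compression to \<open>I\<close>
  multiplicative: the intermediate point in a product of two homogeneous elements cannot leave
  \<open>I\<close> when both end points lie in it.\<close>

locale matrix_rep = lch_system \<sigma> for \<sigma> :: "'a::t2_space \<Rightarrow> 'a" +
  fixes I :: "'a set" and z :: complex
  assumes finite_I: "finite I" and z: "z \<noteq> 0" "cmod z < 1"
    and path_convex: "b \<in> I \<Longrightarrow> (\<sigma> ^^ n) b \<in> I \<Longrightarrow> k \<le> n \<Longrightarrow> (\<sigma> ^^ k) b \<in> I"
begin

abbreviation "\<rho> \<equiv> mat I z"

lemmas rho_linear = bounded_linear_mat[OF z(2), of I]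

lemmas rho_add = mat_add[OF z(2), of I] and rho_scale = mat_scale[OF z(2), of I]
  and rho_diff = linear_diff[OF bounded_linear.linear[OF rho_linear]]
  and rho_sum = linear_sum[OF bounded_linear.linear[OF rho_linear]]

definition R :: "('a \<times> 'a) set" where
  "R = {(c, b). b \<in> I \<and> c \<in> I \<and> (\<exists>n. (\<sigma> ^^ n) b = c)}"

lemma R_trans: "trans R"
proof (rule transI)
  fix a b c assume "(a, b) \<in> R" "(b, c) \<in> R"
  then obtain m n where mn: "a \<in> I" "c \<in> I" "(\<sigma> ^^ m) b = a" "(\<sigma> ^^ n) c = b"
    by (auto simp: R_def)
  then have "(\<sigma> ^^ (m + n)) c = a" by (simp add: funpow_add)
  with mn show "(a, c) \<in> R" by (auto simp: R_def)
qed

lemma R_refl: "b \<in> I \<Longrightarrow> (b, b) \<in> R"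
  unfolding R_def by (auto intro: exI[of _ 0])

lemma rho_incidence: "\<rho> T \<in> incidence R"
proof -
  have "\<rho> T c b = 0" if "(c, b) \<notin> R" for c b
    using that by (auto simp: mat_def R_def)
  then show ?thesis by (auto simp: incidence_def)
qed

text \<open>Both sides are continuous and additive in each factor, so the identity passes from
  homogeneous elements to the whole algebra, first in \<open>b\<close> and then in
  \<open>a\<close>.\<close>

lemma rho_mult:
  assumes a: "a \<in> alg" and b: "b \<in> alg"
  shows "\<rho> (a o\<^sub>L b) = mat_mult I (\<rho> a) (\<rho> b)"
proof (intro ext)
  fix c d
  have cont_rho: "continuous_on UNIV (\<lambda>x. \<rho> (F x) c' d')" if "continuous_on UNIV F" for F c' d'
    by (rule bounded_linear.continuous_on[OF rho_linear that])
  have homog: "\<rho> (a o\<^sub>L b) c d = mat_mult I (\<rho> a) (\<rho> b) c d"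
    if a: "homog \<sigma> m f a" and b: "homog \<sigma> n g b" for m f a n g b
  proof -
    have "mat_mult I (\<rho> a) (\<rho> b) c d =
        (\<Sum>w\<in>I. if w = (\<sigma> ^^ n) d then
          (if d \<in> I \<and> c \<in> I \<and> (\<sigma> ^^ m) w = c then f w * z ^ m * (g d * z ^ n) else 0) else 0)"
      unfolding mat_mult_def by (rule sum.cong) (auto simp: mat_homog[OF a] mat_homog[OF b])
    also have "\<dots> = (if (\<sigma> ^^ n) d \<in> I \<and> d \<in> I \<and> c \<in> I \<and> (\<sigma> ^^ (m + n)) d = c
        then f ((\<sigma> ^^ n) d) * z ^ m * (g d * z ^ n) else 0)"
      using finite_I by (simp add: funpow_add)
    also have "\<dots> = \<rho> (a o\<^sub>L b) c d"
      using path_convex[of d "m + n" n]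
      by (auto simp: mat_homog[OF homog_mult[OF a b]] power_add mult_ac)
    finally show ?thesis ..
  qed
  have "\<rho> (a o\<^sub>L b) c d = mat_mult I (\<rho> a) (\<rho> b) c d" if a: "homog \<sigma> m f a" for m f a
    using b
  proof (induction rule: alg_induct)
    case closed
    show ?case
      unfolding mat_mult_def
      by (intro closed_Collect_eq cont_rho continuous_intros)
  next
    case (add b b')
    then show ?case
      by (simp add: compose_add_right rho_add mat_mult_def distrib_left sum.distrib)
  qed (rule homog[OF a])
  note hom = this
  show "\<rho> (a o\<^sub>L b) c d = mat_mult I (\<rho> a) (\<rho> b) c d"
    using a
  proof (induction rule: alg_induct)
    case closed
    show ?case
      unfolding mat_mult_def
      by (intro closed_Collect_eq cont_rho continuous_intros)
  next
    case (add b b')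
    then show ?case
      by (simp add: compose_add_left rho_add mat_mult_def distrib_right sum.distrib)
  qed (rule hom)
qed

lemma rho_onto_unit:
  assumes "(c, b) \<in> R"
  shows "\<exists>p\<in>polys. \<rho> p = unit_mat c b"
proof -
  obtain n where n: "b \<in> I" "c \<in> I" "(\<sigma> ^^ n) b = c" using assms by (auto simp: R_def)
  \<comment> \<open>The value 1 / z^n cancels the weight in \<rho>, and the zeros on the rest of
    \<open>I\<close> clear all other columns.\<close>
  obtain f a where fa: "homog \<sigma> n f a" "f b = 1 / z ^ n" "\<forall>w\<in>I - {b}. f w = 0"
    using homog_bump[of "I - {b}" b n "1 / z ^ n"] finite_I by auto
  have "\<rho> a = unit_mat c b"
  proof (intro ext)
    fix k l
    show "\<rho> a k l = unit_mat c b k l"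
      using n fa z(1) by (cases "l = b") (auto simp: mat_homog[OF fa(1)] unit_mat_def)
  qed
  then show ?thesis using homog_polys[OF fa(1)] by blast
qed

lemma rho_onto:
  assumes "M \<in> incidence R"
  shows "\<exists>p\<in>polys. \<rho> p = M"
proof -
  obtain e where e: "\<And>q. q \<in> R \<Longrightarrow> e q \<in> polys" "\<And>q. q \<in> R \<Longrightarrow> \<rho> (e q) = unit_mat (fst q) (snd q)"
  proof -
    have "\<forall>q\<in>R. \<exists>p. p \<in> polys \<and> \<rho> p = unit_mat (fst q) (snd q)"
      using rho_onto_unit by fastforce
    from bchoice[OF this] show ?thesis using that by blast
  qed
  have "finite R" by (rule finite_subset[of _ "I \<times> I"]) (auto simp: R_def finite_I)
  show ?thesis
  proof (intro bexI ext)
    show "(\<Sum>q\<in>R. op_scale (M (fst q) (snd q)) (e q)) \<in> polys"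
      by (intro polys_sum polys_scale e)
    fix a b
    have "\<rho> (\<Sum>q\<in>R. op_scale (M (fst q) (snd q)) (e q)) a b =
        (\<Sum>q\<in>R. if q = (a, b) then M a b else 0)"
      unfolding rho_sum rho_scale by (rule sum.cong) (auto simp: e unit_mat_def)
    then show "\<rho> (\<Sum>q\<in>R. op_scale (M (fst q) (snd q)) (e q)) a b = M a b"
      using assms \<open>finite R\<close> by (auto simp: incidence_def)
  qed
qed

end

section \<open>Rules for derivations and their descent to incidence algebras\<close>

context lch_system
begin

context
  fixes d assumes d: "derivation_on alg d"
begin

lemma
  shows der_alg: "a \<in> alg \<Longrightarrow> d a \<in> alg"
    and der_add: "a \<in> alg \<Longrightarrow> b \<in> alg \<Longrightarrow> d (a + b) = d a + d b"
    and der_scale: "a \<in> alg \<Longrightarrow> d (op_scale c a) = op_scale c (d a)"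
    and der_mult: "a \<in> alg \<Longrightarrow> b \<in> alg \<Longrightarrow> d (a o\<^sub>L b) = (d a o\<^sub>L b) + (a o\<^sub>L d b)"
  using d by (simp_all add: derivation_on_def bounded_op_on_def)

lemma der_bound: "\<exists>C\<ge>0. \<forall>a\<in>alg. norm (d a) \<le> C * norm a"
proof -
  obtain C where C: "\<forall>a\<in>alg. norm (d a) \<le> C * norm a"
    using d by (auto simp: derivation_on_def bounded_op_on_def)
  have "\<forall>a\<in>alg. norm (d a) \<le> max C 0 * norm a"
    using C by (meson max.cobounded1 mult_right_mono norm_ge_zero order_trans)
  then show ?thesis by (intro exI[of _ "max C 0"]) auto
qed

lemma der_zero: "d 0 = 0"
  using der_add[OF alg_zero alg_zero] by simp

lemma der_diff: "a \<in> alg \<Longrightarrow> b \<in> alg \<Longrightarrow> d (a - b) = d a - d b"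
  using der_add[of a "op_scale (-1) b"] der_scale[of b "-1"] alg_scale[of b "-1"]
  by (simp add: op_scale_minus_one)

lemma der_sum: "(\<And>i. i \<in> F \<Longrightarrow> a i \<in> polys) \<Longrightarrow> d (\<Sum>i\<in>F. a i) = (\<Sum>i\<in>F. d (a i))"
  by (induction F rule: infinite_finite_induct) (auto simp: der_zero der_add polys_alg polys_sum)

end

end

text \<open>The condition lets every derivation, and then every approximately local one, descend to
  the incidence algebra. It is placed on \<open>polys\<close> because these already map onto that
  algebra.\<close>

locale kernel_invariant_rep = matrix_rep +
  assumes kernel_invariant: "derivation_on alg d \<Longrightarrow> u \<in> polys \<Longrightarrow> (\<And>c b. \<rho> u c b = 0) \<Longrightarrow> \<rho> (d u) c b = 0"
begin

text \<open>The induced map \<open>T\<close> sends \<rho>(p) to \<rho>(\<delta> p). Its identity and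
  zero-product conditions are closed linear conditions on the value \<delta> u for one
  \<open>u\<close>, met by every derivation, so they survive approximation and
  \<open>mat_mult_derivation\<close> applies.\<close>

lemma approx_local_derivation_rho:
  assumes \<delta>: "approx_local_derivation_on alg \<delta>" and a: "a \<in> polys" and b: "b \<in> polys"
  shows "\<rho> (\<delta> (a o\<^sub>L b)) c e = \<rho> ((\<delta> a o\<^sub>L b) + (a o\<^sub>L \<delta> b)) c e"
proof (cases "c \<in> I \<and> e \<in> I")
  case True
  note polys_alg [intro]
  have \<delta>_alg: "\<delta> u \<in> alg" if "u \<in> alg" for u
    using \<delta> that by (simp add: approx_local_derivation_on_def bounded_op_on_def)
  have \<delta>_add: "\<delta> (u + v) = \<delta> u + \<delta> v" if "u \<in> alg" "v \<in> alg" for u v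
    using \<delta> that by (simp add: approx_local_derivation_on_def bounded_op_on_def)
  have \<delta>_scale: "\<delta> (op_scale k u) = op_scale k (\<delta> u)" if "u \<in> alg" for u k
    using \<delta> that by (simp add: approx_local_derivation_on_def bounded_op_on_def)
  \<comment> \<open>The approximating derivations depend on \<open>u\<close>, but a bounded
    functional that kills \<open>d u\<close> for every derivation \<open>d\<close> also kills the
    limit.\<close>
  have lim: "\<phi> (\<delta> u) = 0" if u: "u \<in> alg" and "\<And>d. derivation_on alg d \<Longrightarrow> \<phi> (d u) = 0"
    "bounded_linear \<phi>" for u and \<phi> :: "'a univ_op \<Rightarrow> complex"
  proof -
    obtain D where D: "\<And>k. derivation_on alg (D k)" "(\<lambda>k. D k u) \<longlonglongrightarrow> \<delta> u"
      using \<delta> u unfolding approx_local_derivation_on_def by blast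
    have "(\<lambda>k. \<phi> (D k u)) \<longlonglongrightarrow> \<phi> (\<delta> u)"
      by (rule bounded_linear.tendsto[OF that(3) D(2)])
    then show ?thesis using that(2)[OF D(1)] by (simp add: LIMSEQ_const_iff)
  qed
  have ker: "\<rho> (\<delta> u) i j = 0" if "u \<in> polys" "\<And>i j. \<rho> u i j = 0" for u i j
    using lim[of u "\<lambda>T. \<rho> T i j", OF _ _ rho_linear] kernel_invariant[OF _ that] that by blast
  \<comment> \<open>Any polynomial preimage will do: two of them differ by a kernel element, which
    \<delta> sends into the kernel.\<close>
  define T where "T M = \<rho> (\<delta> (SOME p. p \<in> polys \<and> \<rho> p = M))" for M
  have T: "T (\<rho> p) i j = \<rho> (\<delta> p) i j" if p: "p \<in> polys" for p i j
  proof -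
    define q where "q = (SOME q. q \<in> polys \<and> \<rho> q = \<rho> p)"
    have q: "q \<in> polys" "\<rho> q = \<rho> p"
      using someI[of "\<lambda>q. q \<in> polys \<and> \<rho> q = \<rho> p" p] p unfolding q_def by auto
    have "q = (q - p) + p" by simp
    then have "\<delta> q = \<delta> (q - p) + \<delta> p"
      using \<delta>_add[of "q - p" p] polys_diff[OF q(1) p] p by auto
    moreover have "\<rho> (\<delta> (q - p)) i j = 0"
      by (rule ker[OF polys_diff[OF q(1) p]]) (simp add: rho_diff q)
    ultimately show ?thesis
      unfolding T_def q_def[symmetric] by (simp add: rho_add)
  qed
  interpret zero_product_map I R T
  proof
    fix A B i j assume A: "A \<in> incidence R" and B: "B \<in> incidence R"
    obtain p q where pq: "p \<in> polys" "\<rho> p = A" "q \<in> polys" "\<rho> q = B"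
      using rho_onto[OF A] rho_onto[OF B] by blast
    have "(\<lambda>i j. A i j + B i j) = \<rho> (p + q)"
      by (intro ext) (simp add: rho_add pq)
    then show "T (\<lambda>i j. A i j + B i j) i j = T A i j + T B i j"
      using T[OF pq(1)] T[OF pq(3)] T[OF polys_add[OF pq(1,3)]] pq
      by (simp add: \<delta>_add polys_alg rho_add)
  next
    fix A i j k assume A: "A \<in> incidence R"
    obtain p where p: "p \<in> polys" "\<rho> p = A" using rho_onto[OF A] by blast
    have "(\<lambda>i j. k * A i j) = \<rho> (op_scale k p)"
      by (intro ext) (simp add: rho_scale p)
    then show "T (\<lambda>i j. k * A i j) i j = k * T A i j"
      using T[OF p(1)] T[OF polys_scale[OF p(1)]] p by (simp add: \<delta>_scale polys_alg rho_scale)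
  next
    fix i j assume ij: "i \<in> I" "j \<in> I"
    have "id_mat I \<in> incidence R" using R_refl by (simp add: incidence_def id_mat_def)
    then obtain u where u: "u \<in> polys" "\<rho> u = id_mat I" using rho_onto by blast
    have id: "mat_mult I (id_mat I) M i j = M i j" "mat_mult I M (id_mat I) i j = M i j"
      if "i \<in> I" "j \<in> I" for M i j
    proof -
      have "(\<Sum>k\<in>I. id_mat I i k * M k j) = (\<Sum>k\<in>I. if k = i then M k j else 0)"
        "(\<Sum>k\<in>I. M i k * id_mat I k j) = (\<Sum>k\<in>I. if k = j then M i k else 0)"
        by (rule sum.cong, auto simp: id_mat_def)+
      then show "mat_mult I (id_mat I) M i j = M i j" "mat_mult I M (id_mat I) i j = M i j"
        using that finite_I by (simp_all add: mat_mult_def)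
    qed
    \<comment> \<open>Since \<open>u\<close> is idempotent modulo the kernel and maps to the
      identity, the Leibniz rule gives \<rho>(d u) = \<rho>(d u) + \<rho>(d u).\<close>
    have "\<rho> (d u) i j = 0" if d: "derivation_on alg d" for d
    proof -
      have uu: "u o\<^sub>L u \<in> polys" by (rule polys_mult[OF u(1) u(1)])
      have "\<rho> ((u o\<^sub>L u) - u) k l = 0" for k l
      proof (cases "k \<in> I \<and> l \<in> I")
        case True
        then show ?thesis by (simp add: rho_diff rho_mult u polys_alg id)
      next
        case False
        then show ?thesis by (intro mat_outside) blast
      qed
      then have "\<rho> (d ((u o\<^sub>L u) - u)) i j = 0"
        by (rule kernel_invariant[OF d polys_diff[OF uu u(1)]])
      then show ?thesis
        using ij u by (simp add: der_diff[OF d] der_mult[OF d] der_alg[OF d] alg_mult polys_alg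
            rho_diff rho_add rho_mult id)
    qed
    then have "\<rho> (\<delta> u) i j = 0"
      using lim[of u "\<lambda>T. \<rho> T i j", OF _ _ rho_linear] u(1) by blast
    then show "T (id_mat I) i j = 0" using T[OF u(1)] u(2) by simp
  next
    fix U i j k l and s t :: complex
    assume U: "U \<in> incidence R" and ij: "(i, j) \<in> R" and kl: "(k, l) \<in> R"
      and row: "\<And>c. c \<in> I \<Longrightarrow> U i c = s * U j c" and col: "\<And>r. r \<in> I \<Longrightarrow> U r l = t * U r k"
    have I: "i \<in> I" "j \<in> I" "k \<in> I" "l \<in> I" using ij kl by (auto simp: R_def)
    obtain u where u: "u \<in> polys" "\<rho> u = U" using rho_onto[OF U] by blast
    \<comment> \<open>These are X = E_ii - s E_ij and Y = E_ll - t E_kl, which satisfy X U = U Y =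
      0; \<open>x\<close> and \<open>y\<close> are lifts of them.\<close>
    have inc: "(\<lambda>a b. unit_mat i i a b - s * unit_mat i j a b) \<in> incidence R"
      "(\<lambda>a b. unit_mat l l a b - t * unit_mat k l a b) \<in> incidence R"
      using ij kl R_refl I by (auto simp: incidence_def unit_mat_def)
    obtain x where x: "x \<in> polys" "\<rho> x = (\<lambda>a b. unit_mat i i a b - s * unit_mat i j a b)"
      using rho_onto[OF inc(1)] by blast
    obtain y where y: "y \<in> polys" "\<rho> y = (\<lambda>a b. unit_mat l l a b - t * unit_mat k l a b)"
      using rho_onto[OF inc(2)] by blast
    have mx: "mat_mult I (\<rho> x) M a b = (if a = i then M i b - s * M j b else 0)" for M a b
    proof -
      have "mat_mult I (\<rho> x) M a b = (\<Sum>r\<in>I. if r = i then (if a = i then M i b else 0) else 0) -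
          (\<Sum>r\<in>I. if r = j then (if a = i then s * M j b else 0) else 0)"
        unfolding mat_mult_def x(2) sum_subtractf[symmetric]
        by (rule sum.cong) (auto simp: unit_mat_def left_diff_distrib)
      then show ?thesis using I finite_I by simp
    qed
    have my: "mat_mult I M (\<rho> y) a b = (if b = l then M a l - t * M a k else 0)" for M a b
    proof -
      have "mat_mult I M (\<rho> y) a b = (\<Sum>r\<in>I. if r = l then (if b = l then M a l else 0) else 0) -
          (\<Sum>r\<in>I. if r = k then (if b = l then t * M a k else 0) else 0)"
        unfolding mat_mult_def y(2) sum_subtractf[symmetric]
        by (rule sum.cong) (auto simp: unit_mat_def right_diff_distrib)
      then show ?thesis using I finite_I by simp
    qed
    have xu: "\<rho> (x o\<^sub>L u) a b = 0" for a b
      using row[of b] u(2) mat_outside[of i I b z u] mat_outside[of j I b z u]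
      by (cases "b \<in> I") (auto simp: rho_mult x(1) u(1) polys_alg mx)
    have uy: "\<rho> (u o\<^sub>L y) a b = 0" for a b
      using col[of a] u(2) mat_outside[of a I l z u] mat_outside[of a I k z u]
      by (cases "a \<in> I") (auto simp: rho_mult y(1) u(1) polys_alg my)
    have "\<rho> (d u) i l - s * \<rho> (d u) j l - t * \<rho> (d u) i k + s * t * \<rho> (d u) j k = 0"
      if d: "derivation_on alg d" for d
    proof -
      have "\<rho> (d ((x o\<^sub>L u) o\<^sub>L y)) i l = 0"
        by (rule kernel_invariant[OF d polys_mult[OF polys_mult[OF x(1) u(1)] y(1)]])
          (use xu in \<open>auto simp: rho_mult alg_mult polys_alg x u y mat_mult_def\<close>)
      \<comment> \<open>The outer two Leibniz terms contain \<open>u o\<^sub>L y\<close> or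
        \<open>x o\<^sub>L u\<close>, which lie in the kernel, so X \<rho>(d u) Y = 0
        remains.\<close>
      moreover have "d ((x o\<^sub>L u) o\<^sub>L y) =
          (d x o\<^sub>L (u o\<^sub>L y)) + ((x o\<^sub>L d u) o\<^sub>L y) + ((x o\<^sub>L u) o\<^sub>L d y)"
        by (simp add: der_mult[OF d] alg_mult polys_alg x u y compose_add_left compose_add_right compose_assoc)
      moreover have "\<rho> (d x o\<^sub>L (u o\<^sub>L y)) i l = 0"
        using uy by (subst rho_mult) (auto simp: der_alg[OF d] alg_mult polys_alg x u y mat_mult_def)
      moreover have "\<rho> ((x o\<^sub>L u) o\<^sub>L d y) i l = 0"
        using xu by (subst rho_mult) (auto simp: der_alg[OF d] alg_mult polys_alg x u y mat_mult_def)
      ultimately have "\<rho> ((x o\<^sub>L d u) o\<^sub>L y) i l = 0" by (simp add: rho_add)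
      moreover have "\<rho> ((x o\<^sub>L d u) o\<^sub>L y) = mat_mult I (mat_mult I (\<rho> x) (\<rho> (d u))) (\<rho> y)"
        using x(1) u(1) y(1) by (simp add: rho_mult alg_mult der_alg[OF d] polys_alg)
      ultimately show ?thesis by (simp add: my mx algebra_simps)
    qed
    then have "\<rho> (\<delta> u) i l - s * \<rho> (\<delta> u) j l - t * \<rho> (\<delta> u) i k + s * t * \<rho> (\<delta> u) j k = 0"
      by (intro lim[of u "\<lambda>T. \<rho> T i l - s * \<rho> T j l - t * \<rho> T i k + s * t * \<rho> T j k"]
          polys_alg u(1) bounded_linear_add bounded_linear_sub bounded_linear_const_mult rho_linear)
    then show "T U i l - s * T U j l - t * T U i k + s * t * T U j k = 0"
      using T[OF u(1)] u(2) by simp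
  qed (use finite_I R_refl R_trans in \<open>auto simp: R_def\<close>)
  have "T (mat_mult I (\<rho> a) (\<rho> b)) c e = mat_mult I (T (\<rho> a)) (\<rho> b) c e + mat_mult I (\<rho> a) (T (\<rho> b)) c e"
    using True by (intro mat_mult_derivation rho_incidence) auto
  moreover have "T (mat_mult I (\<rho> a) (\<rho> b)) c e = \<rho> (\<delta> (a o\<^sub>L b)) c e"
    using T[OF polys_mult[OF a b]] a b by (simp add: rho_mult polys_alg)
  moreover have "T (\<rho> a) = \<rho> (\<delta> a)" "T (\<rho> b) = \<rho> (\<delta> b)"
    by (intro ext T a b)+
  ultimately show ?thesis
    using a b by (simp add: rho_add rho_mult \<delta>_alg polys_alg)
qed (simp add: mat_outside)

end

section \<open>Kernel invariance from the growth of iterated derivations\<close>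

context matrix_rep
begin

(* The order filtration and Leibniz rule behind Sinclair's argument: vanishing n consists of the
   elements whose image under exp(s d) has a zero of order n at s = 0 modulo the kernel. *)
context
  fixes d assumes d: "derivation_on alg d"
begin

lemma iter_alg: "a \<in> alg \<Longrightarrow> (d ^^ k) a \<in> alg"
  by (induction k) (auto intro: der_alg[OF d])

lemma iter_add: "a \<in> alg \<Longrightarrow> b \<in> alg \<Longrightarrow> (d ^^ k) (a + b) = (d ^^ k) a + (d ^^ k) b"
  by (induction k) (auto simp: der_add[OF d] iter_alg)

lemma iter_Suc: "(d ^^ Suc k) a = (d ^^ k) (d a)"
  by (simp add: funpow_swap1)

definition vanishing :: "nat \<Rightarrow> 'a univ_op set" where
  "vanishing n = {a \<in> alg. \<forall>k<n. \<rho> ((d ^^ k) a) = (\<lambda>_ _. 0)}"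

lemma vanishing_der: "b \<in> vanishing (Suc n) \<Longrightarrow> d b \<in> vanishing n"
  unfolding vanishing_def using der_alg[OF d] by (auto simp flip: iter_Suc)

lemma vanishing_rho: "b \<in> vanishing (Suc n) \<Longrightarrow> \<rho> b = (\<lambda>_ _. 0)"
  unfolding vanishing_def by (auto dest: spec[of _ 0])

lemma vanishing_mono: "b \<in> vanishing n \<Longrightarrow> m \<le> n \<Longrightarrow> b \<in> vanishing m"
  unfolding vanishing_def by auto

lemma mat_mult_zero [simp]: "mat_mult I (\<lambda>_ _. 0) M = (\<lambda>_ _. 0)" "mat_mult I M (\<lambda>_ _. 0) = (\<lambda>_ _. 0)"
  by (auto simp: mat_mult_def)

text \<open>In the Leibniz expansion of d^n(c b), every term with fewer than \<open>n\<close>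
  derivatives on \<open>b\<close> is killed by \<rho>; only c d^n(b) survives. Splitting off one
  derivative at a time avoids binomial coefficients.\<close>

lemma vanishing_ideal:
  assumes "c \<in> alg" "b \<in> vanishing n"
  shows "c o\<^sub>L b \<in> vanishing n \<and> \<rho> ((d ^^ n) (c o\<^sub>L b)) = mat_mult I (\<rho> c) (\<rho> ((d ^^ n) b))"
  using assms
proof (induction n arbitrary: b c)
  case 0
  then show ?case by (simp add: vanishing_def rho_mult alg_mult)
next
  case (Suc n)
  have b: "b \<in> alg" "b \<in> vanishing n" "d b \<in> vanishing n" and bn: "\<rho> ((d ^^ n) b) = (\<lambda>_ _. 0)"
    using Suc.prems(2) vanishing_der[OF Suc.prems(2)] vanishing_mono[OF Suc.prems(2)]
    by (auto simp: vanishing_def)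
  have c: "c \<in> alg" "d c \<in> alg" using Suc.prems(1) der_alg[OF d] by auto
  have *: "(d ^^ Suc k) (c o\<^sub>L b) = (d ^^ k) (d c o\<^sub>L b) + (d ^^ k) (c o\<^sub>L d b)" for k
    unfolding iter_Suc using b c by (simp add: der_mult[OF d] iter_add alg_mult der_alg[OF d])
  have IH1: "d c o\<^sub>L b \<in> vanishing n" "\<rho> ((d ^^ n) (d c o\<^sub>L b)) = (\<lambda>_ _. 0)"
    using Suc.IH[OF c(2) b(2)] bn by simp_all
  have IH2: "c o\<^sub>L d b \<in> vanishing n"
    "\<rho> ((d ^^ n) (c o\<^sub>L d b)) = mat_mult I (\<rho> c) (\<rho> ((d ^^ Suc n) b))"
    using Suc.IH[OF c(1) b(3)] unfolding iter_Suc by simp_all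
  have "\<rho> ((d ^^ Suc n) (c o\<^sub>L b)) = mat_mult I (\<rho> c) (\<rho> ((d ^^ Suc n) b))"
    unfolding * by (intro ext) (simp only: rho_add IH1(2) IH2(2) add_0)
  moreover have "\<rho> ((d ^^ k) (c o\<^sub>L b)) = (\<lambda>_ _. 0)" if "k < Suc n" for k
  proof (cases k)
    case 0
    then show ?thesis using vanishing_rho[OF Suc.prems(2)] c b by (simp add: rho_mult)
  next
    case (Suc m)
    then have "\<rho> ((d ^^ m) (d c o\<^sub>L b)) = (\<lambda>_ _. 0)" "\<rho> ((d ^^ m) (c o\<^sub>L d b)) = (\<lambda>_ _. 0)"
      using IH1(1) IH2(1) that by (auto simp: vanishing_def)
    then show ?thesis unfolding Suc * by (intro ext) (simp only: rho_add add_0)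
  qed
  ultimately show ?case using b c by (auto simp: vanishing_def alg_mult)
qed

text \<open>To survive under \<rho>, a term needs at least one derivative on \<open>v\<close> and
  \<open>n\<close> on \<open>b\<close>, so the order rises by one. The factor n + 1 counts the
  choices of the derivative that falls on \<open>v\<close>.\<close>

lemma vanishing_mult:
  assumes v: "v \<in> alg" "\<rho> v = (\<lambda>_ _. 0)" and "b \<in> vanishing n"
  shows "v o\<^sub>L b \<in> vanishing (Suc n) \<and>
    \<rho> ((d ^^ Suc n) (v o\<^sub>L b)) = (\<lambda>i j. of_nat (Suc n) * mat_mult I (\<rho> (d v)) (\<rho> ((d ^^ n) b)) i j)"
  using assms(3)
proof (induction n arbitrary: b)
  case 0
  then have "b \<in> alg" by (simp add: vanishing_def)
  then show ?case
    using v by (auto simp: vanishing_def rho_mult rho_add alg_mult der_mult[OF d] der_alg[OF d])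
next
  case (Suc n)
  have b: "b \<in> alg" "d b \<in> vanishing n" "d b \<in> alg"
    using Suc.prems vanishing_der[OF Suc.prems] der_alg[OF d] by (auto simp: vanishing_def)
  have dv: "d v \<in> alg" using v(1) by (rule der_alg[OF d])
  have *: "(d ^^ Suc k) (v o\<^sub>L b) = (d ^^ k) (d v o\<^sub>L b) + (d ^^ k) (v o\<^sub>L d b)" for k
    unfolding iter_Suc using b v dv by (simp add: der_mult[OF d] iter_add alg_mult)
  note I1 = vanishing_ideal[OF dv Suc.prems] and I2 = Suc.IH[OF b(2)]
  have "\<rho> ((d ^^ Suc (Suc n)) (v o\<^sub>L b)) i j =
      of_nat (Suc (Suc n)) * mat_mult I (\<rho> (d v)) (\<rho> ((d ^^ Suc n) b)) i j" for i j
  proof -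
    have "\<rho> ((d ^^ Suc n) (d v o\<^sub>L b)) i j = mat_mult I (\<rho> (d v)) (\<rho> ((d ^^ Suc n) b)) i j"
      using I1 by metis
    moreover have "\<rho> ((d ^^ Suc n) (v o\<^sub>L d b)) i j =
        of_nat (Suc n) * mat_mult I (\<rho> (d v)) (\<rho> ((d ^^ Suc n) b)) i j"
      using I2 unfolding iter_Suc by metis
    ultimately show ?thesis
      unfolding *[of "Suc n"] rho_add by (simp add: algebra_simps)
  qed
  moreover have "\<rho> ((d ^^ k) (v o\<^sub>L b)) = (\<lambda>_ _. 0)" if "k < Suc (Suc n)" for k
  proof (cases k)
    case 0
    then show ?thesis using v b by (simp add: rho_mult)
  next
    case (Suc m)
    then have "\<rho> ((d ^^ m) (d v o\<^sub>L b)) = (\<lambda>_ _. 0)" "\<rho> ((d ^^ m) (v o\<^sub>L d b)) = (\<lambda>_ _. 0)"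
      using I1 I2 that by (auto simp: vanishing_def)
    then show ?thesis unfolding Suc * by (intro ext) (simp only: rho_add add_0)
  qed
  ultimately show ?case using b v by (auto simp: vanishing_def alg_mult)
qed

text \<open>As E_rr is idempotent, repeated multiplication by \<open>v\<close> gives
  \<rho>(d^(n+1)(v^(n+1))) = (n+1)! E_rr. Boundedness of \<open>d\<close> allows only geometric
  growth on the left, so the factorial is impossible.\<close>

lemma no_idempotent_derivative:
  assumes v: "v \<in> alg" "\<rho> v = (\<lambda>_ _. 0)" and r: "r \<in> I"
  shows "\<rho> (d v) \<noteq> unit_mat r r"
proof
  assume dv: "\<rho> (d v) = unit_mat r r"
  obtain C where C: "0 \<le> C" "\<And>a. a \<in> alg \<Longrightarrow> norm (d a) \<le> C * norm a"
    using der_bound[OF d] by blast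
  have iter_norm: "norm ((d ^^ k) a) \<le> C ^ k * norm a" if "a \<in> alg" for k a
  proof (induction k)
    case (Suc k)
    have "norm ((d ^^ Suc k) a) \<le> C * norm ((d ^^ k) a)"
      using C(2)[OF iter_alg[OF that]] by simp
    also have "\<dots> \<le> C * (C ^ k * norm a)" by (rule mult_left_mono[OF Suc C(1)])
    finally show ?case by (simp add: mult.assoc)
  qed simp
  \<comment> \<open>\<open>w n\<close> is the power v^(n+1), hence of order n + 1.\<close>
  define w where "w n = ((\<lambda>x. v o\<^sub>L x) ^^ n) v" for n
  have w_Suc: "w (Suc n) = v o\<^sub>L w n" for n by (simp add: w_def)
  have w_alg: "w n \<in> alg" for n
    by (induction n) (auto simp: w_Suc v alg_mult, simp add: w_def v)
  have w_norm: "norm (w n) \<le> norm v ^ Suc n" for n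
  proof (induction n)
    case (Suc n)
    have "norm (w (Suc n)) \<le> norm v * norm (w n)" unfolding w_Suc by (rule norm_blinfun_compose)
    also have "\<dots> \<le> norm v * norm v ^ Suc n" by (rule mult_left_mono[OF Suc]) simp
    finally show ?case by simp
  qed (simp add: w_def)
  have "w n \<in> vanishing (Suc n) \<and> \<rho> ((d ^^ Suc n) (w n)) = (\<lambda>i j. fact (Suc n) * unit_mat r r i j)" for n
  proof (induction n)
    case 0
    then show ?case using v dv by (simp add: w_def vanishing_def)
  next
    case (Suc n)
    have "mat_mult I (unit_mat r r) (\<lambda>i j. fact (Suc n) * unit_mat r r i j) i j =
        (\<Sum>k\<in>I. if k = r then fact (Suc n) * unit_mat r r i j else 0)" for i j
      unfolding mat_mult_def by (rule sum.cong) (auto simp: unit_mat_def)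
    then have E: "mat_mult I (unit_mat r r) (\<lambda>i j. fact (Suc n) * unit_mat r r i j) i j =
        fact (Suc n) * unit_mat r r i j" for i j
      using finite_I r by simp
    have w: "w n \<in> vanishing (Suc n)"
      and wn: "\<rho> ((d ^^ Suc n) (w n)) = (\<lambda>i j. fact (Suc n) * unit_mat r r i j)"
      using Suc by auto
    have "\<rho> ((d ^^ Suc (Suc n)) (w (Suc n))) = (\<lambda>i j. of_nat (Suc (Suc n)) * (fact (Suc n) * unit_mat r r i j))"
      using vanishing_mult[OF v w] unfolding w_Suc dv wn E by (rule conjunct2)
    then show ?case
      using vanishing_mult[OF v w] by (simp only: w_Suc fact_Suc mult.assoc)
  qed
  then have "fact (Suc n) = \<rho> ((d ^^ Suc n) (w n)) r r" for n
    by (simp add: unit_mat_def)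
  then have "cmod (fact (Suc n)) \<le> norm ((d ^^ Suc n) (w n)) * (1 / (1 - cmod z))" for n
    using norm_mat_le[OF z(2), of I "(d ^^ Suc n) (w n)" r r] by simp
  moreover have "norm ((d ^^ Suc n) (w n)) \<le> (C * norm v) ^ Suc n" for n
    using iter_norm[OF w_alg, of "Suc n" n] w_norm[of n] C(1)
    unfolding power_mult_distrib by (meson mult_left_mono order_trans zero_le_power)
  ultimately have "cmod (fact (Suc n)) \<le> (C * norm v) ^ Suc n * (1 / (1 - cmod z))" for n
    by (rule order_trans[OF _ mult_right_mono]) (use z(2) in simp)
  then have le: "fact (Suc n) \<le> (C * norm v) ^ Suc n * (1 / (1 - cmod z))" for n
    by (simp only: norm_fact)
  \<comment> \<open>The terms of the exponential series tend to zero, which contradicts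
    \<open>le\<close> for large \<open>n\<close>.\<close>
  have "(\<lambda>n. (C * norm v) ^ n / fact n) \<longlonglongrightarrow> 0"
    using summable_LIMSEQ_zero[OF summable_exp[of "C * norm v"]] by (simp add: divide_inverse mult.commute)
  then have "(\<lambda>n. (C * norm v) ^ Suc n / fact (Suc n)) \<longlonglongrightarrow> 0"
    by (rule LIMSEQ_Suc)
  moreover have "0 < 1 - cmod z" using z(2) by simp
  ultimately have "\<forall>\<^sub>F n in sequentially. (C * norm v) ^ Suc n / fact (Suc n) < 1 - cmod z"
    by (rule order_tendstoD(2))
  then obtain n where n: "(C * norm v) ^ Suc n / fact (Suc n) < 1 - cmod z"
    using eventually_happens trivial_limit_sequentially by blast
  then have "(C * norm v) ^ Suc n < (1 - cmod z) * fact (Suc n)"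
    by (simp add: divide_less_eq del: fact_Suc)
  moreover have "(1 - cmod z) * fact (Suc n) \<le> (C * norm v) ^ Suc n"
    using le[of n] z(2) by (simp add: field_simps del: fact_Suc)
  ultimately show False by linarith
qed

text \<open>A nonzero entry (r, c) of \<rho>(d u) can be cut out. Take \<open>x\<close> over E_rr
  and \<open>y\<close> over E_cr divided by that entry, where E_cr is available because
  \<open>R\<close> is full. Then x u y is in the kernel, but its derivative maps to E_rr, which
  \<open>no_idempotent_derivative\<close> excludes.\<close>

lemma kernel_invariant_full:
  assumes full: "R = I \<times> I" and u: "u \<in> alg" "\<And>c b. \<rho> u c b = 0"
  shows "\<rho> (d u) r c = 0"
proof (rule ccontr)
  assume nz: "\<rho> (d u) r c \<noteq> 0"
  then have rc: "r \<in> I" "c \<in> I" using mat_outside by blast+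
  have u0: "\<rho> u = (\<lambda>_ _. 0)" using u(2) by (intro ext)
  obtain x where x: "x \<in> polys" "\<rho> x = unit_mat r r"
    using rho_onto_unit[of r r] full rc by blast
  obtain y' where y': "y' \<in> polys" "\<rho> y' = unit_mat c r"
    using rho_onto_unit[of c r] full rc by blast
  define y where "y = op_scale (1 / \<rho> (d u) r c) y'"
  have y: "y \<in> alg" "\<rho> y a b = 1 / \<rho> (d u) r c * unit_mat c r a b" for a b
    using y' by (simp_all add: y_def rho_scale polys_alg alg_scale)
  have xa: "x \<in> alg" using x(1) by (rule polys_alg)
  note mem = u(1) y(1) xa alg_mult der_alg[OF d]
  let ?v = "(x o\<^sub>L u) o\<^sub>L y"
  have "\<rho> ?v = (\<lambda>_ _. 0)" by (simp add: rho_mult mem u0)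
  moreover have "\<rho> (d ?v) = unit_mat r r"
  proof (intro ext)
    fix i j
    have "d ?v = ((d x o\<^sub>L u) o\<^sub>L y) + ((x o\<^sub>L d u) o\<^sub>L y) + ((x o\<^sub>L u) o\<^sub>L d y)"
      by (simp add: der_mult[OF d] mem compose_add_left)
    then have "\<rho> (d ?v) i j = mat_mult I (mat_mult I (\<rho> x) (\<rho> (d u))) (\<rho> y) i j"
      by (simp add: rho_add rho_mult mem u0)
    also have "mat_mult I (\<rho> x) (\<rho> (d u)) = (\<lambda>i j. if i = r then \<rho> (d u) r j else 0)"
    proof (intro ext)
      fix i j
      have "mat_mult I (\<rho> x) (\<rho> (d u)) i j = (\<Sum>k\<in>I. if k = r then (if i = r then \<rho> (d u) r j else 0) else 0)"
        unfolding mat_mult_def x(2) by (rule sum.cong) (auto simp: unit_mat_def)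
      then show "mat_mult I (\<rho> x) (\<rho> (d u)) i j = (if i = r then \<rho> (d u) r j else 0)"
        using finite_I rc by simp
    qed
    also have "mat_mult I (\<lambda>i j. if i = r then \<rho> (d u) r j else 0) (\<rho> y) i j =
        (\<Sum>k\<in>I. if k = c then unit_mat r r i j else 0)"
      unfolding mat_mult_def y(2) by (rule sum.cong) (use nz in \<open>auto simp: unit_mat_def\<close>)
    also have "\<dots> = unit_mat r r i j" using finite_I rc by simp
    finally show "\<rho> (d ?v) i j = unit_mat r r i j" .
  qed
  ultimately show False
    using no_idempotent_derivative[of ?v r] rc mem by blast
qed

end

end

section \<open>Kernel invariance on the two kinds of orbit\<close>

context lch_system
begin

lemma periodic_rep:
  assumes "periodic \<sigma> x" and z: "z \<noteq> 0" "cmod z < 1"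
  shows "kernel_invariant_rep \<sigma> (range (\<lambda>k. (\<sigma> ^^ k) x)) z"
proof -
  obtain p where p: "p \<ge> 1" "(\<sigma> ^^ p) x = x" using assms by (auto simp: periodic_def)
  define I where "I = range (\<lambda>k. (\<sigma> ^^ k) x)"
  have mult: "(\<sigma> ^^ (p * k)) x = x" for k
    by (induction k) (simp_all add: funpow_add p)
  have mod: "(\<sigma> ^^ (k mod p)) x = (\<sigma> ^^ k) x" for k
  proof -
    have "(\<sigma> ^^ k) x = (\<sigma> ^^ (k mod p + p * (k div p))) x" by simp
    also have "\<dots> = (\<sigma> ^^ (k mod p)) x" by (simp only: funpow_add o_apply mult)
    finally show ?thesis ..
  qed
  have "I \<subseteq> (\<lambda>k. (\<sigma> ^^ k) x) ` {..<p}"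
  proof
    fix y assume "y \<in> I"
    then obtain k where "y = (\<sigma> ^^ k) x" by (auto simp: I_def)
    then have "y = (\<sigma> ^^ (k mod p)) x" by (simp add: mod)
    then show "y \<in> (\<lambda>k. (\<sigma> ^^ k) x) ` {..<p}" using p by (intro image_eqI[of _ _ "k mod p"]) auto
  qed
  then have fin: "finite I" by (rule finite_subset) simp
  have invariant: "(\<sigma> ^^ n) b \<in> I" if b: "b \<in> I" for n b
  proof -
    obtain k where "b = (\<sigma> ^^ k) x" using b by (auto simp: I_def)
    then have "(\<sigma> ^^ n) b = (\<sigma> ^^ (n + k)) x" by (simp add: funpow_add)
    then show ?thesis by (auto simp: I_def)
  qed
  interpret matrix_rep \<sigma> I z
    by unfold_locales (use fin z invariant in auto)
  have "\<exists>n. (\<sigma> ^^ n) b = c" if b: "b \<in> I" and c: "c \<in> I" for b c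
  proof -
    obtain k l where kl: "b = (\<sigma> ^^ k) x" "c = (\<sigma> ^^ l) x" using b c by (auto simp: I_def)
    \<comment> \<open>From \<sigma>^k x, p k - k steps lead back to \<open>x\<close>, and
      \<open>l\<close> more to \<sigma>^l x; p \<ge> 1 keeps the subtraction exact.\<close>
    have "p * k - k + k = p * k" using p by (cases p) auto
    then have "(\<sigma> ^^ (l + (p * k - k))) b = (\<sigma> ^^ l) ((\<sigma> ^^ (p * k)) x)"
      unfolding kl by (metis add.assoc comp_apply funpow_add)
    then show ?thesis using mult kl by auto
  qed
  then have full: "R = I \<times> I" by (auto simp: R_def)
  have "kernel_invariant_rep \<sigma> I z"
    by unfold_locales (use kernel_invariant_full[OF _ full] polys_alg in blast)
  then show ?thesis by (simp only: I_def)
qed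

text \<open>No two degrees join the same pair of points, so the homogeneous components of a kernel
  polynomial lie in the kernel separately. For one component the Leibniz rule applies to products of
  two kernel elements, and boundedness of \<open>d\<close> handles their limits.\<close>

lemma aperiodic_rep:
  assumes inj: "inj (\<lambda>k. (\<sigma> ^^ k) x)" and z: "z \<noteq> 0" "cmod z < 1"
  shows "kernel_invariant_rep \<sigma> ((\<lambda>k. (\<sigma> ^^ k) x) ` {..N}) z"
proof -
  define I where "I = (\<lambda>k. (\<sigma> ^^ k) x) ` {..N}"
  have mem: "(\<sigma> ^^ k) x \<in> I \<longleftrightarrow> k \<le> N" for k
    using inj unfolding I_def by (auto dest: injD)
  have iter: "(\<sigma> ^^ n) ((\<sigma> ^^ k) x) = (\<sigma> ^^ (n + k)) x" for n k
    by (simp add: funpow_add)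
  have path: "(\<sigma> ^^ k) b \<in> I" if b: "b \<in> I" "(\<sigma> ^^ n) b \<in> I" "k \<le> n" for b n k
  proof -
    obtain j where j: "b = (\<sigma> ^^ j) x" using b(1) by (auto simp: I_def)
    show ?thesis using b unfolding j iter mem by simp
  qed
  interpret matrix_rep \<sigma> I z
    by unfold_locales (use z path in \<open>auto simp: I_def\<close>)
  have uniq: "m = n" if b: "b \<in> I" "(\<sigma> ^^ m) b = (\<sigma> ^^ n) b" for b m n
  proof -
    obtain j where j: "b = (\<sigma> ^^ j) x" using b(1) by (auto simp: I_def)
    then have "m + j = n + j" using b(2) injD[OF inj, of "m + j" "n + j"] by (simp add: iter)
    then show ?thesis by simp
  qed
  have homog_kernel: "\<rho> (d a) c b = 0"
    if d: "derivation_on alg d" and a: "homog \<sigma> n f a" and ker: "\<And>c b. \<rho> a c b = 0" for d n f a c b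
  proof -
    note alg = homog_alg alg_generators alg_mult alg_diff der_alg[OF d]
    have mm: "mat_mult I M M' c b = 0" if "(\<forall>c b. M c b = 0) \<or> (\<forall>c b. M' c b = 0)" for M M' c b
      using that by (auto simp: mat_mult_def)
    have pi_zero: "\<rho> (upi h) c b = 0" if "h \<in> C0" "\<And>y. y \<in> I \<Longrightarrow> h y = 0" for h c b
      using that by (simp add: mat_homog[OF homog_pi])
    have f0: "f b = 0" if "b \<in> I" "(\<sigma> ^^ n) b \<in> I" for b
      using ker[of "(\<sigma> ^^ n) b" b] that z(1) by (simp add: mat_homog[OF a])
    \<comment> \<open>\<open>h\<close> is 0 on \<open>I\<close> and 1 at the points outside
      \<open>I\<close> that \<sigma>^n reaches from it, whose index is at most N + n. So
      \<open>upi h\<close> is in the kernel, and subtracting \<open>upi h o\<^sub>L a\<close> from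
      \<open>a\<close> leaves a coefficient function that vanishes on \<open>I\<close>.\<close>
    obtain h where h: "h \<in> C0" "\<And>k. k \<le> N + n \<Longrightarrow> h ((\<sigma> ^^ k) x) = (if k \<le> N then 0 else 1)"
    proof -
      obtain h where "h \<in> C0" "\<forall>w\<in>(\<lambda>k. (\<sigma> ^^ k) x) ` {..N + n}. h w = (if w \<in> I then 0 else 1)"
        using C0_interpolate[of "(\<lambda>k. (\<sigma> ^^ k) x) ` {..N + n}" "\<lambda>w. if w \<in> I then 0 else 1"] by auto
      then show thesis using that[of h] mem by auto
    qed
    have h0: "\<rho> (upi h) c b = 0" for c b
      by (rule pi_zero[OF h(1)]) (use h(2) in \<open>auto simp: I_def\<close>)
    define g where "g = (\<lambda>y. f y - h ((\<sigma> ^^ n) y) * f y)"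
    define a' where "a' = a - (upi h o\<^sub>L a)"
    have a': "homog \<sigma> n g a'"
      unfolding g_def a'_def by (rule homog_diff[OF a homog_pi_left[OF a h(1)]])
    have g0: "g y = 0" if y: "y \<in> I" for y
    proof (cases "(\<sigma> ^^ n) y \<in> I")
      case True
      then show ?thesis using f0[OF y] by (simp add: g_def)
    next
      case False
      obtain j where j: "j \<le> N" "y = (\<sigma> ^^ j) x" using y by (auto simp: I_def)
      then show ?thesis using False h(2)[of "n + j"] mem by (simp add: g_def iter)
    qed
    have "\<rho> (d (upi h o\<^sub>L a)) c b = 0"
      using h(1) a ker h0
      by (simp add: der_mult[OF d] rho_add rho_mult alg mm)
    moreover have "\<rho> (d a') c b = 0"
    proof -
      obtain C where C: "0 \<le> C" "\<And>u. u \<in> alg \<Longrightarrow> norm (d u) \<le> C * norm u"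
        using der_bound[OF d] by blast
      let ?B = "C * (1 / (1 - cmod z))"
      have B: "0 \<le> ?B" using C(1) z(2) by simp
      have le: "cmod (\<rho> (d a') c b) \<le> e * ?B" if e: "0 < e" for e
      proof -
        \<comment> \<open>\<open>k\<close> vanishes wherever \<open>g\<close> does, hence on
          \<open>I\<close>, so \<open>a' o\<^sub>L upi k\<close> is a product of two kernel elements
          at distance at most \<open>e\<close> from \<open>a'\<close>.\<close>
        obtain k where k: "k \<in> C0" "\<And>y. cmod (g y - g y * k y) \<le> e" "\<And>y. g y = 0 \<Longrightarrow> k y = 0"
          using C0_approx_unit[OF homog_C0[OF a'] e] by blast
        have k0: "\<rho> (upi k) c b = 0" for c b
          by (rule pi_zero[OF k(1)]) (use g0 k(3) in blast)
        have a'0: "\<rho> a' c b = 0" for c b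
          using g0 by (simp add: mat_homog[OF a'])
        have k_alg: "upi k \<in> alg" "a' \<in> alg" "a' o\<^sub>L upi k \<in> alg"
          using k(1) a' by (auto intro: alg)
        have "\<rho> (d (a' o\<^sub>L upi k)) c b = 0"
          using k0 a'0 by (simp add: der_mult[OF d] rho_add rho_mult k_alg der_alg[OF d] mm)
        then have "\<rho> (d a') c b = \<rho> (d (a' - (a' o\<^sub>L upi k))) c b"
          by (simp add: der_diff[OF d] k_alg rho_diff)
        also have "cmod \<dots> \<le> norm (d (a' - (a' o\<^sub>L upi k))) * (1 / (1 - cmod z))"
          by (rule norm_mat_le[OF z(2)])
        also have "\<dots> \<le> (C * norm (a' - (a' o\<^sub>L upi k))) * (1 / (1 - cmod z))"
          by (intro mult_right_mono C(2) alg_diff k_alg) (use z(2) in simp)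
        also have "\<dots> \<le> (C * e) * (1 / (1 - cmod z))"
          by (intro mult_right_mono mult_left_mono C(1)
              homog_norm_le[OF homog_diff[OF a' homog_pi_right[OF a' k(1)]]] k(2))
            (use z(2) e in simp_all)
        finally show ?thesis by (simp add: mult_ac)
      qed
      have "cmod (\<rho> (d a') c b) \<le> 0 + e" if e: "0 < e" for e
      proof -
        \<comment> \<open>Dividing by \<open>?B + 1\<close> instead of \<open>?B\<close> covers the
          case that \<open>?B\<close> is 0.\<close>
        have "e * ?B \<le> e * (?B + 1)" using e by (intro mult_left_mono) auto
        then have "e / (?B + 1) * ?B \<le> e" using B by (simp only: times_divide_eq_left pos_divide_le_eq add_nonneg_pos zero_less_one)
        moreover have "0 < e / (?B + 1)" using e B by (simp only: divide_pos_pos add_nonneg_pos zero_less_one)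
        ultimately show ?thesis using le[of "e / (?B + 1)"] by linarith
      qed
      then have "cmod (\<rho> (d a') c b) \<le> 0" by (rule field_le_epsilon)
      then show ?thesis by simp
    qed
    moreover have "d a = d a' + d (upi h o\<^sub>L a)"
      unfolding a'_def using h(1) a by (simp add: der_diff[OF d] alg)
    ultimately show ?thesis by (simp add: rho_add)
  qed
  have "kernel_invariant_rep \<sigma> I z"
  proof
    fix d u c b
    assume d: "derivation_on alg d" and u: "u \<in> polys" and ker: "\<And>c b. \<rho> u c b = 0"
    obtain K f a where fa: "\<And>n. homog \<sigma> n (f n) (a n)" "\<And>L. K \<le> L \<Longrightarrow> u = (\<Sum>n<L. a n)"
      by (rule polysE[OF u]) (rule that)
    have "\<rho> (a m) c b = 0" if m: "m < K" for m c b
    proof (cases "b \<in> I \<and> c \<in> I \<and> (\<sigma> ^^ m) b = c")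
      case True
      have "0 = (\<Sum>n<K. \<rho> (a n) c b)"
        using ker[of c b] unfolding fa(2)[OF order_refl] rho_sum by simp
      also have "\<dots> = (\<Sum>n<K. if n = m then \<rho> (a m) c b else 0)"
      proof (rule sum.cong)
        fix n assume "n \<in> {..<K}"
        show "\<rho> (a n) c b = (if n = m then \<rho> (a m) c b else 0)"
        proof (cases "n = m")
          case False
          then have "(\<sigma> ^^ n) b \<noteq> c" using uniq[of b n m] True by metis
          then show ?thesis using False by (simp add: mat_homog[OF fa(1)])
        qed simp
      qed simp
      also have "\<dots> = \<rho> (a m) c b" using m by simp
      finally show ?thesis ..
    next
      case False
      then show ?thesis unfolding mat_homog[OF fa(1)] by (rule if_not_P)
    qed
    then have "\<rho> (d (a m)) c b = 0" if "m < K" for m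
      using homog_kernel[OF d fa(1)] that by blast
    moreover have "d u = (\<Sum>n<K. d (a n))"
      unfolding fa(2)[OF order_refl] by (rule der_sum[OF d]) (rule homog_polys[OF fa(1)])
    ultimately show "\<rho> (d u) c b = 0" by (simp add: rho_sum)
  qed
  then show ?thesis by (simp only: I_def)
qed

section \<open>Recovering Fourier coefficients and the conclusion\<close>

lemma coef_zero_of_powser:
  fixes a :: "nat \<Rightarrow> complex"
  assumes bound: "\<And>n. cmod (a n) \<le> C" and zero: "\<And>z. z \<noteq> 0 \<Longrightarrow> cmod z < 1 \<Longrightarrow> (\<Sum>n. a n * z ^ n) = 0"
  shows "a n = 0"
proof (rule ccontr)
  assume nz: "a n \<noteq> 0"
  \<comment> \<open>Nothing is assumed about the series at z = 0. Multiplying it by z makes it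
    vanish there too, and isolation of zeros then contradicts a nonzero coefficient.\<close>
  define a' where "a' = (\<lambda>n. case n of 0 \<Rightarrow> 0 | Suc m \<Rightarrow> a m)"
  have sm: "summable (\<lambda>n. a n * z ^ n)" if "cmod z < 1" for z
    by (rule summable_comparison_test'[where g = "\<lambda>n. C * cmod z ^ n" and N = 0])
      (use that bound in \<open>auto intro!: summable_mult summable_geometric mult_right_mono simp: norm_mult norm_power\<close>)
  have sums: "(\<lambda>n. a' n * z ^ n) sums 0" if "norm z < 1" for z
  proof (cases "z = 0")
    case True
    have "(\<lambda>n. a' n * z ^ n) = (\<lambda>_. 0)"
      using True by (auto simp: a'_def fun_eq_iff split: nat.split)
    then show ?thesis by simp
  next
    case False
    have "(\<lambda>n. a n * z ^ n) sums 0"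
      using summable_sums[OF sm[OF that]] zero[OF False that] by simp
    then have "(\<lambda>n. z * (a n * z ^ n)) sums (z * 0)" by (rule sums_mult)
    then have "(\<lambda>n. a' (Suc n) * z ^ Suc n) sums 0" by (simp add: a'_def mult_ac)
    then show ?thesis using sums_Suc[of "\<lambda>n. a' n * z ^ n" 0] by (simp add: a'_def)
  qed
  show False
  proof (rule powser_0_nonzero[where r = 1 and \<xi> = 0 and a = a' and f = "\<lambda>_. 0" and m = "Suc n"])
    fix s :: real assume "0 < s" and s: "\<And>w :: complex. w \<in> cball 0 s - {0} \<Longrightarrow> (0 :: complex) \<noteq> 0"
    then have "complex_of_real s \<in> cball 0 s - {0}" by simp
    then show False using s[of "complex_of_real s"] by simp
  qed (use sums nz in \<open>simp_all add: a'_def\<close>)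
qed

text \<open>On a periodic orbit many degrees contribute to one matrix entry, and varying
  \<open>z\<close> separates them as coefficients of a power series. On an infinite orbit each entry
  carries a single degree, so z = 1/2 is enough.\<close>

lemma approx_local_derivation_coef:
  assumes \<delta>: "approx_local_derivation_on alg \<delta>" and ab: "a \<in> polys" "b \<in> polys"
    and x: "\<not> eventually_periodic \<sigma> x"
  shows "coef n x (\<delta> (a o\<^sub>L b) - ((\<delta> a o\<^sub>L b) + (a o\<^sub>L \<delta> b))) = 0" (is "coef n x ?D = 0")
proof (cases "periodic \<sigma> x")
  case True
  let ?I = "range (\<lambda>k. (\<sigma> ^^ k) x)"
  have mem: "(\<sigma> ^^ k) x \<in> ?I" for k by blast
  then have "x \<in> ?I" using mem[of 0] by simp
  have zero: "(\<Sum>m. (if (\<sigma> ^^ m) x = (\<sigma> ^^ n) x then coef m x ?D else 0) * z ^ m) = 0"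
    if z: "z \<noteq> 0" "cmod z < 1" for z
  proof -
    interpret kernel_invariant_rep \<sigma> ?I z by (rule periodic_rep[OF True z])
    have "mat ?I z ?D ((\<sigma> ^^ n) x) x = 0"
      by (simp add: rho_diff approx_local_derivation_rho[OF \<delta> ab])
    moreover have "(if P then q else 0) * w = (if P then q * w else 0)" for P and q w :: complex by simp
    ultimately show ?thesis using mem[of n] \<open>x \<in> ?I\<close> by (simp add: mat_def)
  qed
  have "(if (\<sigma> ^^ n) x = (\<sigma> ^^ n) x then coef n x ?D else 0) = 0"
    by (rule coef_zero_of_powser[where C = "norm ?D", OF _ zero]) (simp add: norm_coef_le)
  then show ?thesis by simp
next
  case False
  have inj: "inj (\<lambda>k. (\<sigma> ^^ k) x)"
  proof (rule linorder_injI)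
    fix m k :: nat assume "m < k"
    show "(\<sigma> ^^ m) x \<noteq> (\<sigma> ^^ k) x"
    proof
      assume eq: "(\<sigma> ^^ m) x = (\<sigma> ^^ k) x"
      have "(\<sigma> ^^ (k - m)) ((\<sigma> ^^ m) x) = (\<sigma> ^^ k) x"
        using \<open>m < k\<close> by (metis comp_apply funpow_add le_add_diff_inverse2 less_imp_le)
      then have per: "periodic \<sigma> ((\<sigma> ^^ m) x)"
        unfolding periodic_def using eq \<open>m < k\<close> by (intro exI[of _ "k - m"]) auto
      \<comment> \<open>For \<open>m = 0\<close> the point \<open>x\<close> would be periodic, for
        \<open>m > 0\<close> eventually periodic; both are excluded.\<close>
      show False
        using x False per unfolding eventually_periodic_def
        by (cases m) auto
    qed
  qed
  let ?I = "(\<lambda>k. (\<sigma> ^^ k) x) ` {..n}"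
  have z: "(1 / 2 :: complex) \<noteq> 0" "cmod (1 / 2) < 1" by auto
  interpret kernel_invariant_rep \<sigma> ?I "1 / 2" by (rule aperiodic_rep[OF inj z])
  have "mat ?I (1 / 2) ?D ((\<sigma> ^^ n) x) x = 0"
    by (simp add: rho_diff approx_local_derivation_rho[OF \<delta> ab])
  moreover have "x \<in> ?I" "(\<sigma> ^^ n) x \<in> ?I" by (auto intro: image_eqI[of _ _ 0])
  ultimately have "(\<Sum>m. if (\<sigma> ^^ m) x = (\<sigma> ^^ n) x then coef m x ?D * (1 / 2) ^ m else 0) = 0"
    by (simp add: mat_def)
  moreover have "(\<sigma> ^^ m) x = (\<sigma> ^^ n) x \<longleftrightarrow> m = n" for m
    using inj by (auto dest: injD)
  moreover have "(\<Sum>m. if m = n then coef m x ?D * (1 / 2) ^ m else 0) = coef n x ?D * (1 / 2) ^ n"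
    using suminf_finite[of "{n}" "\<lambda>m. if m = n then coef m x ?D * (1 / 2) ^ m else 0"] by simp
  ultimately show ?thesis by simp
qed

text \<open>For polynomials the Fourier coefficients of the defect are continuous in the point and
  vanish on a dense set, hence everywhere, and \<open>coef_zero_imp_zero\<close> applies. Continuity
  of \<delta> carries the product rule over to the closure.\<close>

lemma approx_local_derivation_is_derivation:
  assumes \<delta>: "approx_local_derivation_on alg \<delta>"
    and ep: "interior {x. eventually_periodic \<sigma> x} = {}"
  shows "derivation_on alg \<delta>"
proof -
  have bd: "bounded_op_on alg \<delta>" using \<delta> by (simp add: approx_local_derivation_on_def)
  then have \<delta>_alg: "\<delta> a \<in> alg" if "a \<in> alg" for a using that by (simp add: bounded_op_on_def)
  have \<delta>_add: "\<delta> (a + b) = \<delta> a + \<delta> b" if "a \<in> alg" "b \<in> alg" for a b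
    using bd that by (simp add: bounded_op_on_def)
  obtain C where C: "\<And>a. a \<in> alg \<Longrightarrow> norm (\<delta> a) \<le> C * norm a"
    using bd unfolding bounded_op_on_def by blast
  have \<delta>_lim: "(\<lambda>k. \<delta> (p k)) \<longlonglongrightarrow> \<delta> a" if p: "\<And>k. p k \<in> alg" "p \<longlonglongrightarrow> a" and a: "a \<in> alg" for p a
  proof -
    have le: "norm (\<delta> (p k) - \<delta> a) \<le> C * norm (p k - a)" for k
    proof -
      have "\<delta> (p k) - \<delta> a = \<delta> (p k - a)"
        using \<delta>_add[of "p k - a" a] p(1)[of k] a by (simp add: alg_diff)
      then show ?thesis using C[of "p k - a"] p(1)[of k] a by (simp add: alg_diff)
    qed
    have "(\<lambda>k. C * norm (p k - a)) \<longlonglongrightarrow> 0"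
      using p(2) by (intro tendsto_mult_right_zero) (simp add: LIM_zero_iff tendsto_norm_zero_iff)
    then have "(\<lambda>k. \<delta> (p k) - \<delta> a) \<longlonglongrightarrow> 0"
      by (rule Lim_null_comparison[OF always_eventually[OF allI[OF le]]])
    then show ?thesis by (simp add: LIM_zero_iff)
  qed
  have dense: "closure (- {x. eventually_periodic \<sigma> x}) = UNIV"
    using ep by (simp add: closure_complement)
  have polys_case: "\<delta> (a o\<^sub>L b) = (\<delta> a o\<^sub>L b) + (a o\<^sub>L \<delta> b)" if ab: "a \<in> polys" "b \<in> polys" for a b
  proof -
    let ?D = "\<delta> (a o\<^sub>L b) - ((\<delta> a o\<^sub>L b) + (a o\<^sub>L \<delta> b))"
    have D: "?D \<in> alg"
      using ab by (intro alg_diff alg_add alg_mult \<delta>_alg polys_alg)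
    have "coef n x ?D = 0" for n x
    proof -
      have "closed {x. coef n x ?D = 0}"
        by (intro closed_Collect_eq coef_continuous[OF D] continuous_on_const)
      moreover have "- {x. eventually_periodic \<sigma> x} \<subseteq> {x. coef n x ?D = 0}"
        using approx_local_derivation_coef[OF \<delta> ab] by auto
      ultimately have "closure (- {x. eventually_periodic \<sigma> x}) \<subseteq> {x. coef n x ?D = 0}"
        by (intro closure_minimal)
      then show ?thesis unfolding dense by auto
    qed
    then have "?D = 0" by (rule coef_zero_imp_zero[OF D])
    then show ?thesis by simp
  qed
  have "\<delta> (a o\<^sub>L b) = (\<delta> a o\<^sub>L b) + (a o\<^sub>L \<delta> b)" if a: "a \<in> alg" and b: "b \<in> alg" for a b
  proof -
    obtain p where p: "\<And>k. p k \<in> polys" "p \<longlonglongrightarrow> a"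
      using a unfolding alg_eq_closure closure_sequential by blast
    obtain q where q: "\<And>k. q k \<in> polys" "q \<longlonglongrightarrow> b"
      using b unfolding alg_eq_closure closure_sequential by blast
    note comp = bounded_bilinear.tendsto[OF bounded_bilinear_blinfun_compose]
    note pq = polys_alg[OF p(1)] polys_alg[OF q(1)]
    have "(\<lambda>k. \<delta> (p k o\<^sub>L q k)) \<longlonglongrightarrow> \<delta> (a o\<^sub>L b)"
      by (intro \<delta>_lim alg_mult pq comp p q a b)
    moreover have "(\<lambda>k. (\<delta> (p k) o\<^sub>L q k) + (p k o\<^sub>L \<delta> (q k))) \<longlonglongrightarrow> (\<delta> a o\<^sub>L b) + (a o\<^sub>L \<delta> b)"
      by (intro tendsto_add comp \<delta>_lim pq p q a b)
    ultimately show ?thesis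
      unfolding polys_case[OF p(1) q(1)] by (rule LIMSEQ_unique)
  qed
  with bd show ?thesis by (simp add: derivation_on_def)
qed

lemma operator_space_derivations: "operator_space_on alg {d. derivation_on alg d}"
  unfolding operator_space_on_def
proof (intro conjI ballI allI)
  show "bounded_op_on alg d" if "d \<in> {d. derivation_on alg d}" for d
    using that by (simp add: derivation_on_def)
  show "(\<lambda>_. 0) \<in> {d. derivation_on alg d}"
    using alg_zero by (auto simp: derivation_on_def bounded_op_on_def intro!: exI[of _ 0])
next
  fix d e assume "d \<in> {d. derivation_on alg d}" "e \<in> {d. derivation_on alg d}"
  then have d: "derivation_on alg d" and e: "derivation_on alg e" by auto
  obtain C where C: "\<And>a. a \<in> alg \<Longrightarrow> norm (d a) \<le> C * norm a" using der_bound[OF d] by blast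
  obtain C' where C': "\<And>a. a \<in> alg \<Longrightarrow> norm (e a) \<le> C' * norm a" using der_bound[OF e] by blast
  have "norm (d a + e a) \<le> (C + C') * norm a" if "a \<in> alg" for a
    using norm_triangle_le[OF add_mono[OF C[OF that] C'[OF that]]] by (simp add: distrib_right)
  then have "\<exists>K. \<forall>a\<in>alg. norm (d a + e a) \<le> K * norm a" by blast
  then show "(\<lambda>a. d a + e a) \<in> {d. derivation_on alg d}"
    by (simp add: derivation_on_def bounded_op_on_def der_add[OF d] der_add[OF e] der_scale[OF d]
        der_scale[OF e] der_mult[OF d] der_mult[OF e] der_alg[OF d] der_alg[OF e] alg_add op_scale_add
        compose_add_left compose_add_right add_ac)
next
  fix c d assume "d \<in> {d. derivation_on alg d}"
  then have d: "derivation_on alg d" by auto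
  obtain C where C: "0 \<le> C" "\<And>a. a \<in> alg \<Longrightarrow> norm (d a) \<le> C * norm a" using der_bound[OF d] by blast
  have "norm (op_scale c (d a)) \<le> (cmod c * C) * norm a" if "a \<in> alg" for a
    using order_trans[OF norm_op_scale_le mult_left_mono[OF C(2)[OF that] norm_ge_zero]]
    by (simp add: mult.assoc)
  then have "\<exists>K. \<forall>a\<in>alg. norm (op_scale c (d a)) \<le> K * norm a" by blast
  then show "(\<lambda>a. op_scale c (d a)) \<in> {d. derivation_on alg d}"
    by (simp add: derivation_on_def bounded_op_on_def der_add[OF d] der_scale[OF d] der_mult[OF d]
        der_alg[OF d] alg_scale op_scale_add op_scale_compose_left
        op_scale_compose_right[OF alg_linear] mult.commute)
qed

end

theorem corollary4p7:
  fixes \<sigma> :: "'a::t2_space \<Rightarrow> 'a"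
  assumes "dynamical_system \<sigma>"
    and "interior {x. eventually_periodic \<sigma> x} = {}"
  shows "(\<forall>\<delta>. approx_local_derivation_on (semicrossed_product \<sigma>) \<delta> \<longrightarrow>
              derivation_on (semicrossed_product \<sigma>) \<delta>) \<and>
         reflexive_on (semicrossed_product \<sigma>) {\<delta>. derivation_on (semicrossed_product \<sigma>) \<delta>}"
proof -
  interpret lch_system \<sigma>
    by unfold_locales (use assms(1) in \<open>auto simp: dynamical_system_def\<close>)
  have main: "derivation_on alg \<delta>" if "approx_local_derivation_on alg \<delta>" for \<delta>
    by (rule approx_local_derivation_is_derivation[OF that assms(2)])
  \<comment> \<open>Membership of \<open>T a\<close> in the closure of the values at
    \<open>a\<close> yields a sequence of derivations whose values at \<open>a\<close> tend to
    \<open>T a\<close>. So \<open>T\<close> is approximately local, and reflexivity follows from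
    \<open>main\<close>.\<close>
  have "derivation_on alg T"
    if T: "bounded_op_on alg T" "\<forall>a\<in>alg. T a \<in> closure ((\<lambda>D. D a) ` {\<delta>. derivation_on alg \<delta>})" for T
  proof (rule main)
    have "\<exists>D. (\<forall>k. derivation_on alg (D k)) \<and> (\<lambda>k. D k a) \<longlonglongrightarrow> T a" if a: "a \<in> alg" for a
    proof -
      have "T a \<in> closure ((\<lambda>D. D a) ` {\<delta>. derivation_on alg \<delta>})"
        using T(2) a by (rule bspec)
      then obtain y where y: "\<forall>k. y k \<in> (\<lambda>D. D a) ` {\<delta>. derivation_on alg \<delta>}" "y \<longlonglongrightarrow> T a"
        unfolding closure_sequential by (elim exE conjE) (rule that)
      then have "\<forall>k. \<exists>D. derivation_on alg D \<and> y k = D a" by (simp add: image_iff)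
      from choice[OF this] obtain D where D: "\<forall>k. derivation_on alg (D k) \<and> y k = D k a" ..
      then have "y = (\<lambda>k. D k a)" by (intro ext) simp
      with y(2) D show ?thesis by (intro exI[of _ D]) simp
    qed
    then show "approx_local_derivation_on alg T"
      using T(1) by (simp add: approx_local_derivation_on_def)
  qed
  then show ?thesis
    unfolding reflexive_on_def using main operator_space_derivations by auto
qed

end
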